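(* Let $\mathrm{ev}\colon \mathrm{Mom}^{(0)}_{\geq 4}\to \mathrm{Mom}^{\mathrm{Euler}}_{\geq 4}$ be the (injective) map given by $\mathrm{ev}\big((q_k)_{k\ge 4}\big)=\big(-\tfrac{B_k}{2k}\,q_k\big)_{k\ge 4}$. Let $(b_k)_{k\ge 4}\in \mathrm{Mom}^{\mathrm{Euler}}_{\geq 4}$. For every prime $p$ fix a topological generator $c$ of $\mathbb{Z}_p^*/\{\pm1\}$ and let $\mu_{p,c}\in\mathrm{Meas}(\mathbb{Z}_p^*/\{\pm1\},\mathbb{Z}_p)$ be the measure with $$\int_{\mathbb{Z}_p^*/\{\pm1\}}x^{2k}\,d\mu_{p,c}(x)=(1-c^{2k})(1-p^{2k-1})\,b_{2k}\qquad (k\ge 2).$$ Then the following are equivalent: (a) The sequence $(b_k)_{k\ge 4}$ is in the image of $\mathrm{ev}$. (b) For every prime $p$, $\mu_{p,c}\in\mathfrak{Z}_p$.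
   Context: For a prime $p$, $\mathrm{Meas}(\mathbb{Z}_p^*/\{\pm1\},\mathbb{Z}_p)$ is the set of $\mathbb{Z}_p$-valued measures, i.e. $\mathbb{Z}_p$-linear maps $\mu\colon C(\mathbb{Z}_p^*/\{\pm1\},\mathbb{Z}_p)\to\mathbb{Z}_p$ on continuous functions; write $\int f\,d\mu=\mu(f)$. It is a commutative $\mathbb{Z}_p$-algebra under convolution $(\mu*\nu)(f)=\int\int f(xy)\,d\mu(x)\,d\nu(y)$. Even functions on $\mathbb{Z}_p^*$ (such as $x\mapsto x^{2k}$) are regarded as functions on $\mathbb{Z}_p^*/\{\pm1\}$. Bernoulli numbers: $\frac{t}{e^t-1}=\sum_{k\ge0}B_k\frac{t^k}{k!}$. $\mathrm{Mom}^{\mathrm{Euler}}_{\ge 4}$ is the group of integer sequences $(b_k)_{k\ge4}$ such that $b_{2k+1}=0$ for $k\ge2$ and such that for every prime $p$ there is a measure $\mu_p\in\mathrm{Meas}(\mathbb{Z}_p^*/\{\pm1\},\mathbb{Z}_p)$ with $\int x^{2k}\,d\mu_p=(1-p^{2k-1})b_{2k}$ for all $k\ge2$. (It follows that the measures $\mu_{p,c}$ exist: take $\mu_p-c_*\mu_p$ with $c_*$ induced by multiplication by $c$; a measure is determined by any tail of its even moments.) $\mathrm{Mom}^{(0)}_{\ge 4}$ is the group of integer sequences $(q_k)_{k\ge4}$ such that $q_{2k+1}=0$ for $k\ge2$ and such that for every prime $p$ there is a measure $\mu_p\in\mathrm{Meas}(\mathbb{Z}_p^*/\{\pm1\},\mathbb{Z}_p)$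 with $\int x^{2k}\,d\mu_p=q_{2k}$ for all $k\ge2$ and $\int 1\,d\mu_p=0$. Zeta-ideal: for every prime $p$ and $c\in\mathbb{Z}_p^*$ there is a (known, unique) measure $\mu^{\mathrm{zeta}}_{p,c}\in\mathrm{Meas}(\mathbb{Z}_p^*/\{\pm1\},\mathbb{Z}_p)$ with $\int x^{2k}\,d\mu^{\mathrm{zeta}}_{p,c}=-(1-c^{2k})(1-p^{2k-1})\frac{B_{2k}}{4k}$ for all $k\ge1$. The zeta-ideal $\mathfrak{Z}_p\subseteq\mathrm{Meas}(\mathbb{Z}_p^*/\{\pm1\},\mathbb{Z}_p)$ is the principal ideal generated by $\mu^{\mathrm{zeta}}_{p,c}$ for any $c$ that is a topological generator of $\mathbb{Z}_p^*/\{\pm1\}$; it is independent of this choice. (Topological meaning: under the identification of orientations with such sequences, $\mathrm{ev}$ corresponds to the map $\pi_0\mathbb{E}_\infty(\mathrm{MString},\mathrm{tmf})/[bstring,gl_1(\mathrm{tmf})]_{\mathrm{tors}}\to\pi_0\mathbb{E}_\infty(\mathrm{MString},\mathrm{KO})$ induced by evaluation at the cusp $\mathrm{tmf}\to\mathrm{KO}$.) *)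

theory Defs
  imports
    "HOL-Analysis.Product_Topology"
    "HOL-Analysis.Function_Topology"
    "HOL-Algebra.Ideal"
    "HOL-Algebra.Generated_Groups"
    "HOL-Computational_Algebra.Primes"
    "HOL-Computational_Algebra.Formal_Power_Series"
begin

section \<open>The ring of $p$-adic integers\<close>

text \<open>
  As \<open>p\<close> is quantified inside the statements below, \<open>\<int>\<^sub>p\<close> is a carrier-based ring and not a type:
  it is the inverse limit of the rings \<open>\<int>/p\<^sup>n\<close>, each of them represented by the residues
  \<open>0, \<dots>, p\<^sup>n - 1\<close>.
\<close>

type_synonym padic = "nat \<Rightarrow> int"

definition padic_of_int :: "nat \<Rightarrow> int \<Rightarrow> padic" where
  "padic_of_int p a = (\<lambda>n. a mod int p ^ n)"

definition padic_ring :: "nat \<Rightarrow> padic ring" where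
  "padic_ring p =
    \<lparr>carrier = {x. \<forall>n. x n \<in> {0..<int p ^ n} \<and> x (Suc n) mod int p ^ n = x n},
     monoid.mult = (\<lambda>x y n. (x n * y n) mod int p ^ n),
     one = padic_of_int p 1,
     ring.zero = padic_of_int p 0,
     add = (\<lambda>x y n. (x n + y n) mod int p ^ n)\<rparr>"

definition padic_topology :: "nat \<Rightarrow> padic topology" where
  "padic_topology p =
     subtopology (product_topology (\<lambda>_. discrete_topology UNIV) UNIV) (carrier (padic_ring p))"

text \<open>
  The equation \<open>x = r y\<close> in \<open>\<rat>\<^sub>p\<close>, for a rational number \<open>r\<close> and \<open>p\<close>-adic integers \<open>x, y\<close>: it is
  multiplied by the denominator of \<open>r\<close>, which is not a zero divisor of \<open>\<int>\<^sub>p\<close>.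
\<close>

definition padic_eq_rat_mult :: "nat \<Rightarrow> padic \<Rightarrow> rat \<Rightarrow> padic \<Rightarrow> bool" where
  "padic_eq_rat_mult p x r y \<longleftrightarrow>
     padic_of_int p (snd (quotient_of r)) \<otimes>\<^bsub>padic_ring p\<^esub> x =
     padic_of_int p (fst (quotient_of r)) \<otimes>\<^bsub>padic_ring p\<^esub> y"

lemma padic_ring_simps:
  "x \<in> carrier (padic_ring p) \<longleftrightarrow>
     (\<forall>n. x n \<in> {0..<int p ^ n} \<and> x (Suc n) mod int p ^ n = x n)"
  "x \<otimes>\<^bsub>padic_ring p\<^esub> y = (\<lambda>n. (x n * y n) mod int p ^ n)"
  "x \<oplus>\<^bsub>padic_ring p\<^esub> y = (\<lambda>n. (x n + y n) mod int p ^ n)"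
  "\<one>\<^bsub>padic_ring p\<^esub> = padic_of_int p 1"
  "\<zero>\<^bsub>padic_ring p\<^esub> = padic_of_int p 0"
  by (simp_all add: padic_ring_def)

lemma padic_of_int_closed: "p > 0 \<Longrightarrow> padic_of_int p a \<in> carrier (padic_ring p)"
  by (simp add: padic_ring_simps padic_of_int_def mod_mod_cancel)

lemma padic_ring_cring:
  assumes "p > 0"
  shows "cring (padic_ring p)"
proof -
  have closed: "(\<lambda>n. f n mod int p ^ n) \<in> carrier (padic_ring p)"
    if "\<And>n. f (Suc n) mod int p ^ n = f n mod int p ^ n" for f :: "nat \<Rightarrow> int"
    using that assms by (simp add: padic_ring_simps mod_mod_cancel)
  have res: "x n mod int p ^ n = x n" "x (Suc n) mod int p ^ n = x n"
    if "x \<in> carrier (padic_ring p)" for x n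
    using that by (auto simp: padic_ring_simps)
  have add: "x \<oplus>\<^bsub>padic_ring p\<^esub> y \<in> carrier (padic_ring p)"
    if "x \<in> carrier (padic_ring p)" "y \<in> carrier (padic_ring p)" for x y
    unfolding padic_ring_simps(3)
    by (rule closed, subst (1 2) mod_add_eq [symmetric]) (simp add: res that)
  have mult: "x \<otimes>\<^bsub>padic_ring p\<^esub> y \<in> carrier (padic_ring p)"
    if "x \<in> carrier (padic_ring p)" "y \<in> carrier (padic_ring p)" for x y
    unfolding padic_ring_simps(2)
    by (rule closed, subst (1 2) mod_mult_eq [symmetric]) (simp add: res that)
  have neg: "\<exists>y\<in>carrier (padic_ring p). y \<oplus>\<^bsub>padic_ring p\<^esub> x = \<zero>\<^bsub>padic_ring p\<^esub>"
    if x: "x \<in> carrier (padic_ring p)" for x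
  proof
    show "(\<lambda>n. (- x n) mod int p ^ n) \<in> carrier (padic_ring p)"
      by (rule closed, subst (1 2) mod_minus_eq [symmetric]) (simp add: res x)
    show "(\<lambda>n. (- x n) mod int p ^ n) \<oplus>\<^bsub>padic_ring p\<^esub> x = \<zero>\<^bsub>padic_ring p\<^esub>"
      by (simp add: padic_ring_simps padic_of_int_def mod_simps)
  qed
  show ?thesis
  proof (rule cringI)
    show "abelian_group (padic_ring p)"
    proof (rule abelian_groupI)
      fix x y z assume "x \<in> carrier (padic_ring p)" "y \<in> carrier (padic_ring p)"
        "z \<in> carrier (padic_ring p)"
      then show "x \<oplus>\<^bsub>padic_ring p\<^esub> y \<oplus>\<^bsub>padic_ring p\<^esub> z
          = x \<oplus>\<^bsub>padic_ring p\<^esub> (y \<oplus>\<^bsub>padic_ring p\<^esub> z)"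
        by (simp add: padic_ring_simps mod_simps add.assoc)
    next
      fix x assume "x \<in> carrier (padic_ring p)"
      then show "\<zero>\<^bsub>padic_ring p\<^esub> \<oplus>\<^bsub>padic_ring p\<^esub> x = x"
        by (simp add: padic_ring_simps(3,5) padic_of_int_def res)
    next
      show "\<zero>\<^bsub>padic_ring p\<^esub> \<in> carrier (padic_ring p)"
        using padic_of_int_closed [OF assms] by (simp add: padic_ring_simps(5))
    qed (use add neg in \<open>auto simp: padic_ring_simps(3) add.commute\<close>)
  next
    show "Group.comm_monoid (padic_ring p)"
    proof (rule comm_monoidI)
      fix x y z assume "x \<in> carrier (padic_ring p)" "y \<in> carrier (padic_ring p)"
        "z \<in> carrier (padic_ring p)"
      then show "x \<otimes>\<^bsub>padic_ring p\<^esub> y \<otimes>\<^bsub>padic_ring p\<^esub> z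
          = x \<otimes>\<^bsub>padic_ring p\<^esub> (y \<otimes>\<^bsub>padic_ring p\<^esub> z)"
        by (simp add: padic_ring_simps mod_simps mult.assoc)
    next
      fix x assume "x \<in> carrier (padic_ring p)"
      then show "\<one>\<^bsub>padic_ring p\<^esub> \<otimes>\<^bsub>padic_ring p\<^esub> x = x"
        by (simp add: padic_ring_simps(2,4) padic_of_int_def mod_simps res)
    next
      show "\<one>\<^bsub>padic_ring p\<^esub> \<in> carrier (padic_ring p)"
        using padic_of_int_closed [OF assms] by (simp add: padic_ring_simps(4))
    qed (use mult in \<open>auto simp: padic_ring_simps(2) mult.commute\<close>)
  next
    fix x y z assume "x \<in> carrier (padic_ring p)" "y \<in> carrier (padic_ring p)"
      "z \<in> carrier (padic_ring p)"
    then show "(x \<oplus>\<^bsub>padic_ring p\<^esub> y) \<otimes>\<^bsub>padic_ring p\<^esub> z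
        = x \<otimes>\<^bsub>padic_ring p\<^esub> z \<oplus>\<^bsub>padic_ring p\<^esub> y \<otimes>\<^bsub>padic_ring p\<^esub> z"
      by (simp add: padic_ring_simps mod_simps distrib_right)
  qed
qed


section \<open>The topological group $\mathbb{Z}_p^*/\{\pm 1\}$\<close>

definition pm_one :: "nat \<Rightarrow> padic set" where
  "pm_one p = {\<one>\<^bsub>padic_ring p\<^esub>, \<ominus>\<^bsub>padic_ring p\<^esub> \<one>\<^bsub>padic_ring p\<^esub>}"

definition units_mod_pm :: "nat \<Rightarrow> padic set monoid" where
  "units_mod_pm p = units_of (padic_ring p) Mod pm_one p"

text \<open>
  The quotient topology: points are cosets, so the preimage of a set \<open>U\<close> of cosets is \<open>\<Union>U\<close>.
\<close>

definition units_mod_pm_topology :: "nat \<Rightarrow> padic set topology" where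
  "units_mod_pm_topology p =
     topology (\<lambda>U. U \<subseteq> carrier (units_mod_pm p) \<and>
       openin (subtopology (padic_topology p) (Units (padic_ring p))) (\<Union>U))"

lemma units_mod_pm_coset:
  assumes "X \<in> carrier (units_mod_pm p)"
  obtains a where "a \<in> Units (padic_ring p)" "X = pm_one p #>\<^bsub>units_of (padic_ring p)\<^esub> a"
  using assms by (auto simp: units_mod_pm_def FactGroup_def RCOSETS_def units_of_def)

lemma pm_one_subgroup:
  assumes "p > 0"
  shows "subgroup (pm_one p) (units_of (padic_ring p))"
proof -
  interpret cring "padic_ring p" by (rule padic_ring_cring [OF assms])
  have sq: "\<ominus>\<^bsub>padic_ring p\<^esub> \<one>\<^bsub>padic_ring p\<^esub> \<otimes>\<^bsub>padic_ring p\<^esub>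
      (\<ominus>\<^bsub>padic_ring p\<^esub> \<one>\<^bsub>padic_ring p\<^esub>) = \<one>\<^bsub>padic_ring p\<^esub>"
    by (simp add: l_minus)
  have unit: "\<ominus>\<^bsub>padic_ring p\<^esub> \<one>\<^bsub>padic_ring p\<^esub> \<in> Units (padic_ring p)"
    using sq by (auto simp: Units_def intro!: bexI)
  have inv: "inv\<^bsub>padic_ring p\<^esub> (\<ominus>\<^bsub>padic_ring p\<^esub> \<one>\<^bsub>padic_ring p\<^esub>)
      = \<ominus>\<^bsub>padic_ring p\<^esub> \<one>\<^bsub>padic_ring p\<^esub>"
    by (rule inv_char) (use sq in auto)
  show ?thesis
    by (rule group.subgroupI [OF units_group])
      (use sq unit inv in \<open>auto simp: pm_one_def units_of_carrier units_of_mult units_of_inv\<close>)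
qed

lemma openin_units_mod_pm_topology:
  assumes "p > 0"
  shows "openin (units_mod_pm_topology p) U \<longleftrightarrow>
    U \<subseteq> carrier (units_mod_pm p) \<and>
    openin (subtopology (padic_topology p) (Units (padic_ring p))) (\<Union>U)"
proof -
  interpret cring "padic_ring p" by (rule padic_ring_cring [OF assms])
  let ?G = "units_of (padic_ring p)" and ?C = "carrier (units_mod_pm p)"
  have "group ?G" by (rule units_group)
  then have disj: "A = B \<or> A \<inter> B = {}" if "A \<in> ?C" "B \<in> ?C" for A B
    using group.rcos_disjoint [OF _ pm_one_subgroup [OF assms]] that
    by (force simp: units_mod_pm_def FactGroup_def pairwise_def disjnt_def)
  have Int: "\<Union>(S \<inter> T) = \<Union>S \<inter> \<Union>T" if "S \<subseteq> ?C" "T \<subseteq> ?C" for S T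
    using that disj by fast
  have Un: "\<Union>(\<Union>K) = (\<Union>U\<in>K. \<Union>U)" for K :: "padic set set set"
    by auto
  have "istopology (\<lambda>U. U \<subseteq> ?C \<and>
      openin (subtopology (padic_topology p) (Units (padic_ring p))) (\<Union>U))"
    unfolding istopology_def
  proof (intro conjI allI impI; (elim conjE)?)
    fix K :: "padic set set set"
    assume "\<forall>U\<in>K. U \<subseteq> ?C \<and>
      openin (subtopology (padic_topology p) (Units (padic_ring p))) (\<Union>U)"
    then show "\<Union>K \<subseteq> ?C"
      and "openin (subtopology (padic_topology p) (Units (padic_ring p))) (\<Union>(\<Union>K))"
      unfolding Un by (blast, intro openin_Union) auto
  qed (use Int in auto)
  then show ?thesis
    by (simp add: units_mod_pm_topology_def)
qed

lemma topspace_units_mod_pm_topology: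
  assumes "p > 0"
  shows "topspace (units_mod_pm_topology p) = carrier (units_mod_pm p)"
proof -
  interpret cring "padic_ring p" by (rule padic_ring_cring [OF assms])
  let ?T = "subtopology (padic_topology p) (Units (padic_ring p))"
  have "topspace ?T = Units (padic_ring p)"
    by (auto simp: padic_topology_def topspace_product_topology)
  moreover have "\<Union>(carrier (units_mod_pm p)) = Units (padic_ring p)"
    using group.rcosets_part_G [OF units_group pm_one_subgroup [OF assms]]
    by (simp add: units_mod_pm_def FactGroup_def units_of_carrier)
  ultimately have "openin ?T (\<Union>(carrier (units_mod_pm p)))"
    by (metis openin_topspace)
  then show ?thesis
    unfolding topspace_def openin_units_mod_pm_topology [OF assms] by auto
qed

definition top_generator :: "nat \<Rightarrow> padic \<Rightarrow> bool" where
  "top_generator p c \<longleftrightarrow>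
     c \<in> Units (padic_ring p) \<and>
     units_mod_pm_topology p closure_of
       generate (units_mod_pm p) {pm_one p #>\<^bsub>units_of (padic_ring p)\<^esub> c}
     = topspace (units_mod_pm_topology p)"


section \<open>Measures\<close>

definition cont_funs :: "nat \<Rightarrow> (padic set \<Rightarrow> padic) set" where
  "cont_funs p =
     {f \<in> extensional (carrier (units_mod_pm p)).
       continuous_map (units_mod_pm_topology p) (padic_topology p) f}"

definition padic_measures :: "nat \<Rightarrow> ((padic set \<Rightarrow> padic) \<Rightarrow> padic) set" where
  "padic_measures p =
     {\<mu> \<in> cont_funs p \<rightarrow>\<^sub>E carrier (padic_ring p).
       (\<forall>f\<in>cont_funs p. \<forall>g\<in>cont_funs p.
          \<mu> (\<lambda>x\<in>carrier (units_mod_pm p). f x \<oplus>\<^bsub>padic_ring p\<^esub> g x)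
            = \<mu> f \<oplus>\<^bsub>padic_ring p\<^esub> \<mu> g) \<and>
       (\<forall>a\<in>carrier (padic_ring p). \<forall>f\<in>cont_funs p.
          \<mu> (\<lambda>x\<in>carrier (units_mod_pm p). a \<otimes>\<^bsub>padic_ring p\<^esub> f x)
            = a \<otimes>\<^bsub>padic_ring p\<^esub> \<mu> f)}"

definition measure_ring :: "nat \<Rightarrow> ((padic set \<Rightarrow> padic) \<Rightarrow> padic) ring" where
  "measure_ring p =
    \<lparr>carrier = padic_measures p,
     monoid.mult = (\<lambda>\<mu> \<nu>. \<lambda>f\<in>cont_funs p.
       \<mu> (\<lambda>x\<in>carrier (units_mod_pm p).
         \<nu> (\<lambda>y\<in>carrier (units_mod_pm p). f (x \<otimes>\<^bsub>units_mod_pm p\<^esub> y)))),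
     one = (\<lambda>f\<in>cont_funs p. f \<one>\<^bsub>units_mod_pm p\<^esub>),
     ring.zero = (\<lambda>f\<in>cont_funs p. \<zero>\<^bsub>padic_ring p\<^esub>),
     add = (\<lambda>\<mu> \<nu>. \<lambda>f\<in>cont_funs p. \<mu> f \<oplus>\<^bsub>padic_ring p\<^esub> \<nu> f)\<rparr>"

text \<open>
  For a function \<open>f\<close> that is even on the units, \<open>f ` X\<close> is a singleton for each coset \<open>X\<close>, so
  \<open>descend p f\<close> is \<open>f\<close> regarded as a function on the quotient.
\<close>

definition descend :: "nat \<Rightarrow> (padic \<Rightarrow> padic) \<Rightarrow> padic set \<Rightarrow> padic" where
  "descend p f = (\<lambda>X\<in>carrier (units_mod_pm p). the_elem (f ` X))"

definition even_moment :: "nat \<Rightarrow> ((padic set \<Rightarrow> padic) \<Rightarrow> padic) \<Rightarrow> nat \<Rightarrow> padic" where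
  "even_moment p \<mu> k = \<mu> (descend p (\<lambda>x. x [^]\<^bsub>padic_ring p\<^esub> (2 * k)))"


section \<open>Bernoulli numbers and the zeta-ideal\<close>

definition bernoulli :: "nat \<Rightarrow> rat" where
  "bernoulli k = fact k * fps_nth (fps_X / (fps_exp 1 - 1)) k"

lemma bernoulli_fps:
  "Abs_fps (\<lambda>k. bernoulli k / fact k) * (fps_exp 1 - 1) = fps_X"
proof -
  have nz: "fps_exp 1 - 1 \<noteq> (0 :: rat fps)"
    by (auto simp: fps_eq_iff intro!: exI [of _ 1])
  have "subdegree (fps_exp 1 - 1 :: rat fps) = 1"
    by (rule subdegreeI) auto
  then have "fps_exp 1 - 1 dvd (fps_X :: rat fps)"
    using nz by (subst fps_dvd_iff) auto
  moreover have "Abs_fps (\<lambda>k. bernoulli k / fact k) = fps_X / (fps_exp 1 - 1)"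
    by (simp add: fps_eq_iff bernoulli_def)
  ultimately show ?thesis
    by simp
qed

text \<open>
  The factor \<open>- B\<^sub>2\<^sub>k / 4k\<close> is in general not \<open>p\<close>-integral, hence \<^const>\<open>padic_eq_rat_mult\<close>.
\<close>

definition zeta_measure :: "nat \<Rightarrow> padic \<Rightarrow> (padic set \<Rightarrow> padic) \<Rightarrow> padic" where
  "zeta_measure p c = (THE \<mu>. \<mu> \<in> padic_measures p \<and>
     (\<forall>k\<ge>1. padic_eq_rat_mult p (even_moment p \<mu> k) (- bernoulli (2 * k) / of_nat (4 * k))
        ((\<one>\<^bsub>padic_ring p\<^esub> \<ominus>\<^bsub>padic_ring p\<^esub> c [^]\<^bsub>padic_ring p\<^esub> (2 * k))
          \<otimes>\<^bsub>padic_ring p\<^esub> padic_of_int p (1 - int p ^ (2 * k - 1)))))"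

text \<open>The ideal does not depend on the topological generator that is chosen.\<close>

definition zeta_ideal :: "nat \<Rightarrow> ((padic set \<Rightarrow> padic) \<Rightarrow> padic) set" where
  "zeta_ideal p = PIdl\<^bsub>measure_ring p\<^esub> (zeta_measure p (SOME c. top_generator p c))"


section \<open>Moment sequences\<close>

text \<open>Sequences indexed by \<open>k \<ge> 4\<close> are functions in \<^term>\<open>extensional {4..}\<close>.\<close>

definition mom_euler :: "(nat \<Rightarrow> int) set" where
  "mom_euler =
     {b \<in> extensional {4..}.
       (\<forall>k\<ge>2. b (2 * k + 1) = 0) \<and>
       (\<forall>p. prime p \<longrightarrow> (\<exists>\<mu>\<in>padic_measures p. \<forall>k\<ge>2.
          even_moment p \<mu> k = padic_of_int p ((1 - int p ^ (2 * k - 1)) * b (2 * k))))}"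

definition mom_zero :: "(nat \<Rightarrow> int) set" where
  "mom_zero =
     {q \<in> extensional {4..}.
       (\<forall>k\<ge>2. q (2 * k + 1) = 0) \<and>
       (\<forall>p. prime p \<longrightarrow> (\<exists>\<mu>\<in>padic_measures p.
          (\<forall>k\<ge>2. even_moment p \<mu> k = padic_of_int p (q (2 * k))) \<and>
          \<mu> (descend p (\<lambda>_. \<one>\<^bsub>padic_ring p\<^esub>)) = \<zero>\<^bsub>padic_ring p\<^esub>))}"

text \<open>
  The values \<open>- B\<^sub>k / 2k \<cdot> q\<^sub>k\<close> are integers for \<open>q\<close> in \<^const>\<open>mom_zero\<close>. As this is a theorem, the
  map is defined with values in rational sequences, and an integer sequence is compared with them
  through \<^const>\<open>rat_of_int\<close>.
\<close>

definition ev :: "(nat \<Rightarrow> int) \<Rightarrow> nat \<Rightarrow> rat" where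
  "ev q = (\<lambda>k\<in>{4..}. - (bernoulli k / of_nat (2 * k)) * of_int (q k))"

end

theory Submission
  imports
    Defs
    "HOL-Number_Theory.Number_Theory"
    "HOL-Computational_Algebra.Polynomial"
begin

text \<open>
  All arguments take place on moments. After clearing denominators, polynomials in \<open>x\<^sup>2\<close> without terms
  of low degree approximate every even continuous function, because \<open>C(x - 1, p\<^sup>j - 1)\<close> is modulo \<open>p\<close>
  the indicator function of \<open>p\<^sup>j \<int>\<^sub>p\<close> up to sign. Hence a measure is determined by any tail of its
  even moments, and a sequence of measures whose even moments converge has a limit. As a limit one
  obtains Mazur's measure (the zeta measure), from the power sums \<open>\<Sum> a\<^sup>2\<^sup>k\<close> over the residues prime to
  \<open>p\<close>, and also the quotient by \<open>1 - [c]\<close> of any measure of total mass zero, for a topological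
  generator \<open>c\<close>.

  The latter makes all zeta measures of topological generators associated, and shows that a zeta
  measure has nonzero total mass, as \<open>B\<^sub>2\<^sub>k / 4k\<close> is not \<open>p\<close>-integral for some \<open>k\<close>. If
  \<open>\<mu>\<^sub>p\<^sub>,\<^sub>c\<close> is a multiple \<open>\<nu> * \<mu>\<^sup>z\<^sup>e\<^sup>t\<^sup>a\<close>, then the moments of \<open>\<nu>\<close> are, up to a change of generator,
  \<open>-4k b\<^sub>2\<^sub>k / B\<^sub>2\<^sub>k\<close>; lying in \<open>\<int>\<^sub>p\<close> for all \<open>p\<close>, these numbers are integers. The total mass of \<open>\<nu>\<close>
  vanishes because that of \<open>\<mu>\<^sub>p\<^sub>,\<^sub>c\<close> does.
\<close>


section \<open>Components of $p$-adic integers\<close>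

text \<open>Division by \<open>-B_{2k}/4k\<close> is not an operation on measures, so (b) is
  exploited by comparing moments and cancelling nonzero factors in the domain of p-adic integers.
  The moment of index 0 escapes such a comparison, since the given moments start at
  \<open>k = 2\<close>. It is recovered from uniqueness, which forces \<open>mu_{p,c}\<close> to be
  \<open>([1] - [c]) * mu_p\<close>, of mass \<open>1 - 1 = 0\<close>. Cancelling the mass of the
  zeta measure requires that mass to be nonzero, hence the study of Bernoulli denominators;
  recovering \<open>q\<close> from \<open>b\<close> requires nonzero numerators, hence the study of
  signs.

  The generator chosen inside \<open>zeta_ideal\<close> need not be the given \<open>c\<close>, so
  both directions carry a correction factor such as \<open>([1] - [c]) / ([1] - [c'])\<close>. It is
  a measure because the numerator has mass zero.

  Mazur's measure is built from integer power sums because Bernoulli numbers occur there with an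
  explicit error \<open>p^(2n-2)\<close>, which still leaves growing precision after division by
  \<open>p^n\<close>.\<close>

locale p_adic =
  fixes p :: nat
  assumes prime_p: "prime p"
begin

lemma p_pos: "p > 0"
  using prime_p by (rule prime_gt_0_nat)

sublocale Zp: cring "padic_ring p"
  using p_pos by (rule padic_ring_cring)

abbreviation Z where "Z \<equiv> carrier (padic_ring p)"
abbreviation U where "U \<equiv> Units (padic_ring p)"
abbreviation P :: "nat \<Rightarrow> int" where "P n \<equiv> int p ^ n"

abbreviation add (infixl "\<^bold>+" 65) where "x \<^bold>+ y \<equiv> x \<oplus>\<^bsub>padic_ring p\<^esub> y"
abbreviation diff (infixl "\<^bold>-" 65) where "x \<^bold>- y \<equiv> x \<ominus>\<^bsub>padic_ring p\<^esub> y"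
abbreviation mul (infixl "\<^bold>*" 70) where "x \<^bold>* y \<equiv> x \<otimes>\<^bsub>padic_ring p\<^esub> y"
abbreviation pow (infixr "\<^bold>^" 75) where "x \<^bold>^ (k::nat) \<equiv> x [^]\<^bsub>padic_ring p\<^esub> k"
abbreviation one ("\<^bold>1") where "\<^bold>1 \<equiv> \<one>\<^bsub>padic_ring p\<^esub>"
abbreviation zero ("\<^bold>0") where "\<^bold>0 \<equiv> \<zero>\<^bsub>padic_ring p\<^esub>"
abbreviation emb ("\<iota>") where "\<iota> a \<equiv> padic_of_int p a"

lemma P_pos [simp]: "P n > 0" "0 \<le> P n" "P n \<noteq> 0"
  using p_pos by simp_all

lemma prime_int_p: "prime (int p)"
  using prime_p by simp

lemma nth_add: "(x \<^bold>+ y) n = (x n + y n) mod P n"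
  and nth_mult: "(x \<^bold>* y) n = (x n * y n) mod P n"
  and nth_emb: "\<iota> a n = a mod P n"
  and nth_one: "\<^bold>1 n = 1 mod P n"
  and nth_zero: "\<^bold>0 n = 0"
  by (simp_all add: padic_ring_simps padic_of_int_def)

lemma emb_closed [simp]: "\<iota> a \<in> Z"
  using p_pos by (rule padic_of_int_closed)

lemma nth_range: "x \<in> Z \<Longrightarrow> 0 \<le> x n \<and> x n < P n"
  by (simp add: padic_ring_simps)

lemma nth_mod [simp]: "x \<in> Z \<Longrightarrow> x n mod P n = x n"
  using nth_range by simp

lemma nth_mod_le:
  assumes "x \<in> Z" "n \<le> m"
  shows "x m mod P n = x n"
  using assms(2)
proof (induction m rule: dec_induct)
  case base
  then show ?case using assms by simp
next
  case (step m)
  have "x (Suc m) mod P n = (x (Suc m) mod P m) mod P n"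
    using step by (simp add: mod_mod_cancel le_imp_power_dvd)
  also have "x (Suc m) mod P m = x m"
    using assms by (simp add: padic_ring_simps)
  finally show ?case using step by simp
qed

lemma mod_P_le:
  assumes "n \<le> m" "a mod P m = b mod P m"
  shows "a mod P n = b mod P n"
  using assms by (metis le_imp_power_dvd mod_mod_cancel)

lemma nth_eq_le:
  assumes "x \<in> Z" "y \<in> Z" "n \<le> m" "x m = y m"
  shows "x n = y n"
  using assms nth_mod_le by metis

lemma padic_closedI:
  assumes "\<And>n. 0 \<le> x n \<and> x n < P n" "\<And>n. x (Suc n) mod P n = x n"
  shows "x \<in> Z"
  using assms by (auto simp: padic_ring_simps)

lemma nth_0 [simp]: "x \<in> Z \<Longrightarrow> x 0 = 0"
  using nth_range [of x 0] by simp

lemma nth_pow: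
  assumes "x \<in> Z"
  shows "(x \<^bold>^ k) n = (x n ^ k) mod P n"
  by (induction k) (simp_all add: nth_one nth_mult mod_simps mult.commute)

lemma nth_diff:
  assumes "x \<in> Z" "y \<in> Z"
  shows "(x \<^bold>- y) n = (x n - y n) mod P n"
proof -
  have "(x \<^bold>- y) \<^bold>+ y = x"
    using assms by (simp add: Zp.minus_eq Zp.a_assoc Zp.l_neg)
  then have "((x \<^bold>- y) n + y n) mod P n = x n"
    by (metis nth_add)
  then have "(x n - y n) mod P n = (x \<^bold>- y) n mod P n"
    by (metis add_diff_cancel_right' mod_diff_left_eq)
  then show ?thesis using assms by simp
qed

lemma emb_mult: "\<iota> (a * b) = \<iota> a \<^bold>* \<iota> b"
  and emb_0: "\<iota> 0 = \<^bold>0"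
  by (simp_all add: fun_eq_iff nth_mult nth_emb nth_zero mod_simps)

lemma emb_eq_0_iff: "\<iota> a = \<^bold>0 \<longleftrightarrow> a = 0"
proof
  assume *: "\<iota> a = \<^bold>0"
  \<comment> \<open>Level \<open>|a|\<close> separates \<open>a\<close> from 0 because
    \<open>|a| < 2^|a| \<le> p^|a|\<close>.\<close>
  have "\<bar>a\<bar> < P (nat \<bar>a\<bar>)"
  proof -
    have "nat \<bar>a\<bar> < 2 ^ nat \<bar>a\<bar>" by (rule less_exp)
    also have "\<dots> \<le> p ^ nat \<bar>a\<bar>"
      using prime_ge_2_nat [OF prime_p] by (rule power_mono) simp
    finally have "int (nat \<bar>a\<bar>) < int (p ^ nat \<bar>a\<bar>)" by (simp only: of_nat_less_iff)
    then show ?thesis by simp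
  qed
  moreover have "P (nat \<bar>a\<bar>) dvd a"
    using * by (metis nth_emb nth_zero dvd_eq_mod_eq_0)
  ultimately show "a = 0"
    using dvd_imp_le_int [of a "P (nat \<bar>a\<bar>)"] by (metis P_pos(2) abs_of_nonneg not_less)
qed (simp add: emb_0)

text \<open>Valuations add, so the two factors cannot both fall short. This finite-level statement
  takes the place of a p-adic valuation: it gives the domain property and bounds the precision lost
  in divisions.\<close>

lemma prime_power_dvd_mult:
  fixes a b :: int
  assumes "P (n + m) dvd a * b"
  shows "P n dvd a \<or> P m dvd b"
proof (cases "a = 0 \<or> b = 0")
  case False
  have "n + m \<le> multiplicity (int p) (a * b)"
    using assms False prime_gt_1_nat [OF prime_p] by (intro multiplicity_geI) auto
  then have "n \<le> multiplicity (int p) a \<or> m \<le> multiplicity (int p) b"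
    using False prime_int_p by (subst (asm) prime_elem_multiplicity_mult_distrib) auto
  then show ?thesis
    using multiplicity_dvd' by blast
qed auto

lemma padic_domain:
  assumes "x \<in> Z" "y \<in> Z" "x \<^bold>* y = \<^bold>0"
  shows "x = \<^bold>0 \<or> y = \<^bold>0"
proof (rule ccontr)
  assume "\<not> ?thesis"
  then obtain n m where nm: "x n \<noteq> 0" "y m \<noteq> 0"
    by (auto simp: fun_eq_iff nth_zero)
  have "P (n + m) dvd x (n + m) * y (n + m)"
    using assms(3) by (metis nth_mult nth_zero dvd_eq_mod_eq_0)
  then have "P n dvd x (n + m) \<or> P m dvd y (n + m)"
    by (rule prime_power_dvd_mult)
  then show False
    using nm assms nth_mod_le [of x n "n + m"] nth_mod_le [of y m "n + m"] by auto
qed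

lemma padic_cancel:
  assumes "x \<in> Z" "y \<in> Z" "z \<in> Z" "x \<noteq> \<^bold>0" "x \<^bold>* y = x \<^bold>* z"
  shows "y = z"
proof -
  have "x \<^bold>* (y \<^bold>- z) = \<^bold>0"
    using assms by (simp add: Zp.minus_eq Zp.r_distr Zp.r_minus Zp.r_neg)
  then have "y \<^bold>- z = \<^bold>0"
    using padic_domain assms by blast
  then show ?thesis using assms by simp
qed

section \<open>Units and their powers modulo \<open>p^n\<close>\<close>

lemma P_1: "P 1 = int p" by simp

lemma Units_iff: "x \<in> U \<longleftrightarrow> x \<in> Z \<and> \<not> int p dvd x 1"
proof
  assume "x \<in> U"
  then obtain y where x: "x \<in> Z" and y: "y \<in> Z" "x \<^bold>* y = \<^bold>1"
    by (auto simp: Units_def)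
  have "(x 1 * y 1) mod int p = 1"
    using y nth_mult [of x y 1] nth_one [of 1] prime_gt_1_nat [OF prime_p] by simp
  then show "x \<in> Z \<and> \<not> int p dvd x 1"
    using x by (metis dvd_mult2 dvd_eq_mod_eq_0 zero_neq_one)
next
  assume x: "x \<in> Z \<and> \<not> int p dvd x 1"
  have cop: "coprime (x n) (P n)" for n
  proof (cases n)
    case (Suc m)
    then have "\<not> int p dvd x n"
      using x nth_mod_le [of x 1 n] by (metis P_1 dvd_mod_iff dvd_refl le_add1 plus_1_eq_Suc)
    then show ?thesis
      using prime_int_p by (simp add: coprime_commute prime_imp_coprime)
  qed simp
  have "\<exists>y. 0 \<le> y \<and> y < P n \<and> (x n * y) mod P n = 1 mod P n" for n
  proof -
    obtain y where "[x n * y = 1] (mod P n)"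
      using cong_solve_coprime_int [OF cop] by blast
    then show ?thesis
      using P_pos(1) [of n] by (intro exI [of _ "y mod P n"]) (auto simp: cong_def mod_simps)
  qed
  then obtain y where y: "\<And>n. 0 \<le> y n \<and> y n < P n" "\<And>n. (x n * y n) mod P n = 1 mod P n"
    by metis
  \<comment> \<open>Inverses modulo \<open>P n\<close> are unique, so the inverses chosen separately
    at each level are compatible.\<close>
  have "y \<in> Z"
  proof (rule padic_closedI)
    fix n
    have "(x (Suc n) * y (Suc n)) mod P n = 1 mod P n"
      using y(2) [of "Suc n"] by (rule mod_P_le [rotated]) simp
    then have "[x n * y (Suc n) = x n * y n] (mod P n)"
      using x y(2) [of n] nth_mod_le [of x n "Suc n"]
      by (metis cong_def le_Suc_eq mod_mult_left_eq order_refl)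
    then have "[y (Suc n) = y n] (mod P n)"
      using cop cong_mult_lcancel by blast
    then show "y (Suc n) mod P n = y n"
      using y by (simp add: cong_def)
  qed (use y in auto)
  moreover have "x \<^bold>* y = \<^bold>1"
    by (simp add: fun_eq_iff nth_mult nth_one y(2))
  ultimately show "x \<in> U"
    using x \<open>y \<in> Z\<close> Zp.m_comm [of x y] unfolding Units_def by auto
qed

lemma Units_Z [simp]: "x \<in> U \<Longrightarrow> x \<in> Z"
  by (simp add: Units_iff)

lemma Units_coprime:
  assumes "x \<in> U" "n > 0"
  shows "coprime (x n) (P m)"
proof -
  have "\<not> int p dvd x n"
    using assms nth_mod_le [of x 1 n]
    by (metis P_1 Units_iff dvd_mod_iff dvd_refl One_nat_def Suc_leI neq0_conv)
  then show ?thesis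
    using prime_int_p by (simp add: coprime_commute prime_imp_coprime)
qed

lemma emb_Units: "\<not> int p dvd a \<Longrightarrow> \<iota> a \<in> U"
  by (simp add: Units_iff nth_emb dvd_mod_iff)

text \<open>One exponent for all residues prime to \<open>p\<close>, from Euler's theorem. It allows
  multiplication by \<open>x^H\<close> without changing values on units, and it replaces the inverse
  of a unit by a positive power at a given level.\<close>

lemma euler_power:
  obtains H where "H \<ge> 2" "\<And>x. coprime x (int p) \<Longrightarrow> (x ^ H) mod P n = 1 mod P n"
proof -
  \<comment> \<open>The totient can be 1; doubling it secures \<open>H \<ge> 2\<close>.\<close>
  define H where "H = 2 * totient (p ^ n)"
  have "totient (p ^ n) > 0"
    using p_pos by simp
  then have "H \<ge> 2" unfolding H_def by linarith
  moreover have "(x ^ H) mod P n = 1 mod P n" if "coprime x (int p)" for x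
  proof -
    have "coprime (nat (x mod P n)) (p ^ n)"
    proof -
      have "coprime x (P n)" using that by simp
      then have "coprime (x mod P n) (P n)"
        using coprime_mod_left_iff P_pos(3) by blast
      moreover have "0 \<le> x mod P n" by (rule pos_mod_sign [OF P_pos(1)])
      ultimately have "coprime (int (nat (x mod P n))) (int (p ^ n))"
        by (simp only: nat_0_le of_nat_power)
      then show ?thesis by (simp only: coprime_int_iff)
    qed
    then have "[int (nat (x mod P n)) ^ totient (p ^ n) = 1] (mod int (p ^ n))"
      using euler_theorem cong_int_iff by (metis of_nat_1 of_nat_power)
    then have "[(x mod P n) ^ totient (p ^ n) = 1] (mod P n)"
      by (simp only: nat_0_le [OF pos_mod_sign [OF P_pos(1)]] of_nat_power)
    then have "[x ^ totient (p ^ n) = 1] (mod P n)"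
      by (simp add: cong_def power_mod)
    then have "[(x ^ totient (p ^ n)) ^ 2 = 1 ^ 2] (mod P n)"
      by (rule cong_pow)
    then show ?thesis
      by (simp add: cong_def H_def power_mult [symmetric] mult.commute)
  qed
  ultimately show ?thesis using that by blast
qed

text \<open>One of the factors \<open>a - b\<close> and \<open>a + b\<close> takes half of the
  exponent \<open>2 * j\<close>. Giving up half of the precision treats \<open>p = 2\<close>, where
  both factors may be even, like every other prime.\<close>

lemma sq_diff_level:
  fixes a b :: int
  assumes "a\<^sup>2 mod P (2 * j) = b\<^sup>2 mod P (2 * j)"
  shows "a mod P j = b mod P j \<or> a mod P j = (- b) mod P j"
proof -
  have "P (j + j) dvd (a - b) * (a - - b)"
    using assms unfolding mult_2 [symmetric]
    by (simp add: mod_eq_dvd_iff power2_eq_square algebra_simps)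
  then show ?thesis
    using prime_power_dvd_mult mod_eq_dvd_iff by blast
qed

section \<open>Even continuous functions on the units\<close>

abbreviation G where "G \<equiv> units_mod_pm p"
abbreviation sq where "sq x j \<equiv> (x j)\<^sup>2 mod P j"
abbreviation neg where "neg x \<equiv> \<ominus>\<^bsub>padic_ring p\<^esub> x"

section \<open>The quotient by plus or minus one, in terms of representatives\<close>

definition pm :: "padic \<Rightarrow> padic set" where
  "pm x = pm_one p #>\<^bsub>units_of (padic_ring p)\<^esub> x"

lemma pm_one_normal: "pm_one p \<lhd> units_of (padic_ring p)"
  using pm_one_subgroup [OF p_pos] Zp.units_comm_group
  by (simp add: comm_group.subgroup_imp_normal)

lemma pm_eq: "x \<in> Z \<Longrightarrow> pm x = {x, neg x}"
  by (auto simp: pm_def pm_one_def r_coset_def units_of_mult Zp.l_minus)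

lemma carrier_G: "carrier G = pm ` U"
  by (auto simp: units_mod_pm_def FactGroup_def RCOSETS_def units_of_def pm_def)

lemma pm_in_G [simp]: "x \<in> U \<Longrightarrow> pm x \<in> carrier G"
  by (simp add: carrier_G)

lemma pm_mult: "x \<in> U \<Longrightarrow> y \<in> U \<Longrightarrow> pm x \<otimes>\<^bsub>G\<^esub> pm y = pm (x \<^bold>* y)"
  using normal.rcos_sum [OF pm_one_normal, of x y]
  by (simp add: units_mod_pm_def FactGroup_def pm_def units_of_carrier units_of_mult)

lemma pm_1: "\<one>\<^bsub>G\<^esub> = pm \<^bold>1"
  by (simp add: units_mod_pm_def FactGroup_def pm_eq) (simp add: pm_one_def)

lemma pm_inv: "x \<in> U \<Longrightarrow> inv\<^bsub>G\<^esub> (pm x) = pm (inv\<^bsub>padic_ring p\<^esub> x)"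
  using normal.rcos_inv [OF pm_one_normal, of x] normal.inv_FactGroup [OF pm_one_normal, of "pm x"]
    pm_in_G [of x]
  by (simp add: units_mod_pm_def pm_def units_of_carrier Zp.units_of_inv)

lemma neg_U: "x \<in> U \<Longrightarrow> neg x \<in> U"
  using Zp.Units_m_closed [of "neg \<^bold>1" x] Zp.l_minus [of "\<^bold>1" x]
  by (metis Zp.Units_l_cancel Zp.add.inv_closed Zp.Units_closed Zp.Units_minus_one_closed
      Zp.l_one Zp.one_closed)

lemma nth_neg: "x \<in> Z \<Longrightarrow> neg x n = (- x n) mod P n"
  using nth_diff [of "\<^bold>0" x n] by (simp add: Zp.minus_eq nth_zero)

lemma sq_neg: "x \<in> Z \<Longrightarrow> sq (neg x) j = sq x j"
  by (simp add: nth_neg mod_simps)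

lemma sq_mod_le:
  assumes "x \<in> Z" "y \<in> Z" "i \<le> j" "sq x j = sq y j"
  shows "sq x i = sq y i"
proof -
  have "(x j)\<^sup>2 mod P i = (y j)\<^sup>2 mod P i"
    using assms by (meson mod_P_le)
  then have "(x j mod P i)\<^sup>2 mod P i = (y j mod P i)\<^sup>2 mod P i"
    by (simp only: power_mod)
  then show ?thesis
    using assms nth_mod_le by simp
qed

lemma sq_mult: "sq (x \<^bold>* y) j = (sq x j * sq y j) mod P j"
  by (simp add: nth_mult mod_simps power_mult_distrib)

text \<open>
  As \<open>p\<^sup>2\<^sup>j dvd x\<^sup>2 - y\<^sup>2\<close> forces \<open>x \<equiv> \<plusminus>y\<close> modulo \<open>p\<^sup>j\<close>, congruences between squares describe the uniform
  structure of the quotient by \<open>\<plusminus>1\<close>.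
\<close>

definition UC :: "(padic \<Rightarrow> padic) set" where
  "UC = {F. (\<forall>x\<in>U. F x \<in> Z) \<and> (\<forall>n. \<exists>j. \<forall>x\<in>U. \<forall>y\<in>U. sq x j = sq y j \<longrightarrow> F x n = F y n)}"

lemma UC_closed: "F \<in> UC \<Longrightarrow> x \<in> U \<Longrightarrow> F x \<in> Z"
  by (auto simp: UC_def)

lemma UC_level:
  assumes "F \<in> UC"
  obtains j where "\<And>x y. x \<in> U \<Longrightarrow> y \<in> U \<Longrightarrow> sq x j = sq y j \<Longrightarrow> F x n = F y n"
  using assms unfolding UC_def by blast

lemma UCI:
  assumes "\<And>x. x \<in> U \<Longrightarrow> F x \<in> Z"
    and "\<And>n. \<exists>j. \<forall>x\<in>U. \<forall>y\<in>U. sq x j = sq y j \<longrightarrow> F x n = F y n"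
  shows "F \<in> UC"
  using assms by (auto simp: UC_def)

lemma UC_even:
  assumes "F \<in> UC" "x \<in> U"
  shows "F (neg x) = F x"
proof
  fix n
  obtain j where j: "\<And>x y. x \<in> U \<Longrightarrow> y \<in> U \<Longrightarrow> sq x j = sq y j \<Longrightarrow> F x n = F y n"
    using UC_level [OF assms(1)] by blast
  show "F (neg x) n = F x n"
    by (rule j) (use assms in \<open>simp_all add: neg_U sq_neg\<close>)
qed

lemma descend_pm: "F \<in> UC \<Longrightarrow> x \<in> U \<Longrightarrow> descend p F (pm x) = F x"
  using pm_in_G [of x] by (simp add: descend_def pm_eq UC_even)

section \<open>The quotient topology and uniform continuity\<close>

lemma discrete_int: "discrete_topology UNIV = (euclidean :: int topology)"
  by (simp add: topology_eq open_discrete)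

lemma padic_topology_eq: "padic_topology p = top_of_set Z"
  by (simp add: padic_topology_def discrete_int euclidean_product_topology)

lemma units_topology_eq: "subtopology (padic_topology p) U = top_of_set U"
proof -
  have "Z \<inter> U = U" by auto
  then show ?thesis by (simp add: padic_topology_eq subtopology_subtopology)
qed

lemma open_coord: "open {x :: padic. x j \<in> S}"
proof -
  have "open ((\<lambda>x :: padic. x j) -` S)"
    by (intro open_vimage open_discrete continuous_on_product_coordinates)
  then show ?thesis by (simp add: vimage_def)
qed

lemma openin_units:
  assumes "W \<subseteq> U" "\<And>x y. x \<in> W \<Longrightarrow> y \<in> U \<Longrightarrow> x j = y j \<Longrightarrow> y \<in> W"
  shows "openin (top_of_set U) W"
  unfolding openin_open
proof (intro exI conjI)
  show "open {x :: padic. x j \<in> (\<lambda>x. x j) ` W}" by (rule open_coord)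
  show "W = U \<inter> {x. x j \<in> (\<lambda>x. x j) ` W}"
  proof
    show "U \<inter> {x. x j \<in> (\<lambda>x. x j) ` W} \<subseteq> W"
      using assms(2) by fastforce
  qed (use assms(1) in auto)
qed

lemma openin_G: "openin (units_mod_pm_topology p) V \<longleftrightarrow>
    V \<subseteq> carrier G \<and> openin (top_of_set U) (\<Union>V)"
  by (simp add: openin_units_mod_pm_topology [OF p_pos] units_topology_eq)

lemma topspace_G: "topspace (units_mod_pm_topology p) = carrier G"
  by (rule topspace_units_mod_pm_topology [OF p_pos])

lemma Union_pm:
  assumes "\<And>x y. x \<in> U \<Longrightarrow> Q (pm x) \<longleftrightarrow> R x" "\<And>x. x \<in> U \<Longrightarrow> R (neg x) \<longleftrightarrow> R x"
  shows "\<Union>{X \<in> carrier G. Q X} = {x \<in> U. R x}"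
  using assms neg_U by (force simp: carrier_G pm_eq)

text \<open>The target is a subspace of a product of discrete spaces, so continuity is tested one
  coordinate at a time, and each coordinate of \<open>F x\<close> depends only on \<open>x\<close>
  modulo some \<open>p^j\<close>.\<close>

lemma descend_cont:
  assumes F: "F \<in> UC"
  shows "descend p F \<in> cont_funs p"
proof -
  have "openin (units_mod_pm_topology p) {X \<in> carrier G. descend p F X n \<in> S}" for n S
  proof -
    obtain j where j: "\<And>x y. x \<in> U \<Longrightarrow> y \<in> U \<Longrightarrow> sq x j = sq y j \<Longrightarrow> F x n = F y n"
      using UC_level [OF F] by blast
    have "openin (top_of_set U) {x \<in> U. F x n \<in> S}"
    proof (rule openin_units [where j = j])
      fix x y assume "x \<in> {x \<in> U. F x n \<in> S}" "y \<in> U" "x j = y j"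
      then show "y \<in> {x \<in> U. F x n \<in> S}"
        using j [of x y] by auto
    qed auto
    moreover have "\<Union>{X \<in> carrier G. descend p F X n \<in> S} = {x \<in> U. F x n \<in> S}"
      by (rule Union_pm) (simp_all add: descend_pm F UC_even)
    ultimately show ?thesis by (simp add: openin_G)
  qed
  then have "continuous_map (units_mod_pm_topology p) euclidean (\<lambda>X. descend p F X n)" for n
    by (auto simp: continuous_map_def topspace_G)
  then have "continuous_map (units_mod_pm_topology p)
      (product_topology (\<lambda>_. euclidean) UNIV) (descend p F)"
    by (simp add: continuous_map_componentwise_UNIV)
  then have "continuous_map (units_mod_pm_topology p) (padic_topology p) (descend p F)"
    using UC_closed [OF F] by (auto simp: padic_topology_eq continuous_map_in_subtopology
        euclidean_product_topology topspace_G carrier_G descend_pm F)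
  then show ?thesis
    by (simp add: cont_funs_def descend_def)
qed

text \<open>Tychonoff: the coherence conditions and the unit condition at level 1 are closed in a
  product of finite sets.\<close>

lemma compact_U: "compact U"
proof -
  let ?K = "\<Pi>\<^sub>E n\<in>UNIV. {0..<P n}"
  have "compactin (product_topology (\<lambda>_. euclidean) UNIV) ?K"
    by (simp add: compactin_PiE finite_imp_compact)
  then have "compact ?K"
    by (simp add: euclidean_product_topology)
  moreover have "closed ((\<Inter>n. {x. x (Suc n) mod P n = x n}) \<inter> {x. x 1 \<in> {a. \<not> int p dvd a}})"
  proof (intro closed_Int closed_INT ballI)
    fix n
    have "continuous_on UNIV (\<lambda>x :: padic. x (Suc n) mod P n)"
      by (rule continuous_on_compose2 [of UNIV "\<lambda>a. a mod P n"])
        (auto intro: continuous_on_product_coordinates continuous_on_discrete)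
    then show "closed {x :: padic. x (Suc n) mod P n = x n}"
      by (intro closed_Collect_eq continuous_on_product_coordinates)
  next
    have "- {x :: padic. x 1 \<in> {a. \<not> int p dvd a}} = {x. x 1 \<in> {a. int p dvd a}}" by auto
    then show "closed {x :: padic. x 1 \<in> {a. \<not> int p dvd a}}"
      by (simp only: closed_def open_coord)
  qed
  ultimately have "compact (?K \<inter> ((\<Inter>n. {x. x (Suc n) mod P n = x n}) \<inter> {x. x 1 \<in> {a. \<not> int p dvd a}}))"
    by (rule compact_Int_closed)
  also have "?K \<inter> ((\<Inter>n. {x. x (Suc n) mod P n = x n}) \<inter> {x. x 1 \<in> {a. \<not> int p dvd a}}) = U"
    by (auto simp: Units_iff padic_ring_simps PiE_def Pi_def)
  finally show ?thesis .
qed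

text \<open>The Lebesgue number argument: the classes on which \<open>g\<close> is known to be
  constant cover the compact set \<open>U\<close>, and the largest level in a finite subcover works
  everywhere, since equality at a level passes to lower ones.\<close>

lemma uniform_level:
  assumes "\<And>x. x \<in> U \<Longrightarrow> \<exists>j. \<forall>y\<in>U. y j = x j \<longrightarrow> g y = g x"
  shows "\<exists>j. \<forall>x\<in>U. \<forall>y\<in>U. x j = y j \<longrightarrow> g x = g y"
proof -
  obtain l where l: "\<And>x y. x \<in> U \<Longrightarrow> y \<in> U \<Longrightarrow> y (l x) = x (l x) \<Longrightarrow> g y = g x"
  proof -
    from assms have "\<forall>x. \<exists>j. x \<in> U \<longrightarrow> (\<forall>y\<in>U. y j = x j \<longrightarrow> g y = g x)" by blast
    then obtain l where "\<forall>x. x \<in> U \<longrightarrow> (\<forall>y\<in>U. y (l x) = x (l x) \<longrightarrow> g y = g x)"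
      by (rule choice [THEN exE])
    then show ?thesis by (intro that) blast
  qed
  define V where "V x = {y :: padic. y (l x) \<in> {x (l x)}}" for x
  have "open (V x)" for x
    unfolding V_def by (rule open_coord)
  moreover have "U \<subseteq> (\<Union>x\<in>U. V x)"
    by (auto simp: V_def)
  ultimately obtain C where C: "C \<subseteq> U" "finite C" "U \<subseteq> (\<Union>x\<in>C. V x)"
    using compactE_image [OF compact_U, of U V] by blast
  show ?thesis
  proof (intro exI ballI impI)
    fix x y assume xy: "x \<in> U" "y \<in> U" "x (Max (l ` C)) = y (Max (l ` C))"
    then obtain z where z: "z \<in> C" "x (l z) = z (l z)"
      using C by (auto simp: V_def)
    then have "l z \<le> Max (l ` C)" using C by simp
    then have "x (l z) = y (l z)"
      using xy nth_eq_le Units_Z by blast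
    then show "g x = g y"
      using l [of z x] l [of z y] z xy C by auto
  qed
qed

text \<open>Converse of \<open>descend_cont\<close>: on the compact space of units continuity is
  uniform, and evenness turns congruences of arguments into congruences of their squares.\<close>

lemma cont_funs_UC:
  assumes f: "f \<in> cont_funs p"
  shows "(\<lambda>x. f (pm x)) \<in> UC"
proof (rule UCI)
  have cont: "continuous_map (units_mod_pm_topology p) (top_of_set Z) f"
    using f by (simp add: cont_funs_def padic_topology_eq)
  then have "f X \<in> Z" if "X \<in> carrier G" for X
    using that by (auto simp: continuous_map_def topspace_G)
  then show "f (pm x) \<in> Z" if "x \<in> U" for x
    using that by simp
  fix n
  have "\<exists>j. \<forall>y\<in>U. y j = x j \<longrightarrow> f (pm y) n = f (pm x) n" if x: "x \<in> U" for x
  proof -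
    have "openin (units_mod_pm_topology p)
        {X \<in> topspace (units_mod_pm_topology p). f X \<in> {z. z n \<in> {f (pm x) n}}}"
      by (rule openin_continuous_map_preimage [of _ euclidean])
        (use cont open_coord [of n "{f (pm x) n}"] in \<open>auto simp: continuous_map_in_subtopology\<close>)
    then have "openin (top_of_set U) (\<Union>{X \<in> carrier G. f X n = f (pm x) n})"
      by (simp add: openin_G topspace_G)
    moreover have "\<Union>{X \<in> carrier G. f X n = f (pm x) n} = {y \<in> U. f (pm y) n = f (pm x) n}"
      by (rule Union_pm) (simp_all add: pm_eq neg_U insert_commute)
    ultimately obtain T where T: "open T" "{y \<in> U. f (pm y) n = f (pm x) n} = U \<inter> T"
      by (auto simp: openin_open)
    have "openin (product_topology (\<lambda>_. euclidean) UNIV) T"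
      using T by (simp add: euclidean_product_topology)
    moreover have "x \<in> T" using T x by auto
    ultimately have "\<exists>X. x \<in> (\<Pi>\<^sub>E i\<in>UNIV. X i) \<and> (\<forall>i. openin (euclidean :: int topology) (X i))
        \<and> finite {i. X i \<noteq> topspace (euclidean :: int topology)} \<and> (\<Pi>\<^sub>E i\<in>UNIV. X i) \<subseteq> T"
      using product_topology_open_contains_basis [of "\<lambda>_ :: nat. euclidean :: int topology" UNIV T x] by simp
    then obtain X where X: "x \<in> (\<Pi>\<^sub>E i\<in>UNIV. X i)"
        "finite {i. X i \<noteq> topspace (euclidean :: int topology)}" "(\<Pi>\<^sub>E i\<in>UNIV. X i) \<subseteq> T"
      by blast
    \<comment> \<open>A basic open set restricts finitely many coordinates; by coherence the largest
      of them fixes all the others.\<close>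
    define j where "j = Max (insert 0 {i. X i \<noteq> UNIV})"
    have "y \<in> T" if y: "y \<in> U" "y j = x j" for y
    proof -
      have "y i \<in> X i" for i
      proof (cases "X i = UNIV")
        case False
        then have "i \<le> j" using X(2) by (simp add: j_def)
        then have "y i = x i" using y x nth_eq_le Units_Z by blast
        then show ?thesis using X(1) by (auto simp: PiE_def)
      qed auto
      then show ?thesis using X(3) by (auto simp: PiE_def)
    qed
    then show ?thesis using T by blast
  qed
  from uniform_level [of "\<lambda>x. f (pm x) n", OF this]
  obtain j where j: "\<And>x y. x \<in> U \<Longrightarrow> y \<in> U \<Longrightarrow> x j = y j \<Longrightarrow> f (pm x) n = f (pm y) n"
    by blast
  \<comment> \<open>The level doubles because a congruence of squares modulo \<open>p^(2j)\<close>
    only yields a congruence up to sign modulo \<open>p^j\<close>.\<close>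
  show "\<exists>j. \<forall>x\<in>U. \<forall>y\<in>U. sq x j = sq y j \<longrightarrow> f (pm x) n = f (pm y) n"
  proof (intro exI ballI impI)
    fix x y assume xy: "x \<in> U" "y \<in> U" "sq x (2 * j) = sq y (2 * j)"
    then have "x (2 * j) mod P j = y (2 * j) mod P j \<or> x (2 * j) mod P j = (- y (2 * j)) mod P j"
      by (intro sq_diff_level)
    moreover have "(- y (2 * j)) mod P j = neg y j"
      using xy nth_mod_le [of y j "2 * j"] by (metis Units_Z mod_minus_eq nth_neg mult_2 le_add1)
    ultimately have "x j = y j \<or> x j = neg y j"
      using xy nth_mod_le [of x j "2 * j"] nth_mod_le [of y j "2 * j"] by auto
    moreover have "pm (neg y) = pm y"
      using xy by (simp add: pm_eq neg_U insert_commute)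
    ultimately show "f (pm x) n = f (pm y) n"
      using j [of x y] j [of x "neg y"] xy neg_U by auto
  qed
qed

lemma cont_funs_descend:
  assumes f: "f \<in> cont_funs p"
  shows "f = descend p (\<lambda>x. f (pm x))"
proof (rule extensionalityI [where A = "carrier G"])
  show "f \<in> extensional (carrier G)" using f by (simp add: cont_funs_def)
  show "descend p (\<lambda>x. f (pm x)) \<in> extensional (carrier G)" by (simp add: descend_def)
  fix X assume "X \<in> carrier G"
  then show "f X = descend p (\<lambda>x. f (pm x)) X"
    using descend_pm [OF cont_funs_UC [OF f]] by (auto simp: carrier_G)
qed

section \<open>Measures as linear functionals\<close>

text \<open>Functionals act on functions of units, where the arithmetic happens, instead of
  functions of cosets. The last clause is there because members of \<open>UC\<close> are
  unconstrained outside \<open>U\<close>.\<close>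

definition lin :: "((padic \<Rightarrow> padic) \<Rightarrow> padic) \<Rightarrow> bool" where
  "lin J \<longleftrightarrow> (\<forall>F\<in>UC. J F \<in> Z) \<and>
     (\<forall>F\<in>UC. \<forall>H\<in>UC. J (\<lambda>x. F x \<^bold>+ H x) = J F \<^bold>+ J H) \<and>
     (\<forall>a\<in>Z. \<forall>F\<in>UC. J (\<lambda>x. a \<^bold>* F x) = a \<^bold>* J F) \<and>
     (\<forall>F\<in>UC. \<forall>H\<in>UC. (\<forall>x\<in>U. F x = H x) \<longrightarrow> J F = J H)"

lemma linI:
  assumes "\<And>F. F \<in> UC \<Longrightarrow> J F \<in> Z"
    and "\<And>F H. F \<in> UC \<Longrightarrow> H \<in> UC \<Longrightarrow> J (\<lambda>x. F x \<^bold>+ H x) = J F \<^bold>+ J H"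
    and "\<And>a F. a \<in> Z \<Longrightarrow> F \<in> UC \<Longrightarrow> J (\<lambda>x. a \<^bold>* F x) = a \<^bold>* J F"
    and "\<And>F H. F \<in> UC \<Longrightarrow> H \<in> UC \<Longrightarrow> (\<And>x. x \<in> U \<Longrightarrow> F x = H x) \<Longrightarrow> J F = J H"
  shows "lin J"
  using assms unfolding lin_def by blast

lemma lin_closed: "lin J \<Longrightarrow> F \<in> UC \<Longrightarrow> J F \<in> Z"
  and lin_add: "lin J \<Longrightarrow> F \<in> UC \<Longrightarrow> H \<in> UC \<Longrightarrow> J (\<lambda>x. F x \<^bold>+ H x) = J F \<^bold>+ J H"
  and lin_smult: "lin J \<Longrightarrow> a \<in> Z \<Longrightarrow> F \<in> UC \<Longrightarrow> J (\<lambda>x. a \<^bold>* F x) = a \<^bold>* J F"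
  and lin_cong: "lin J \<Longrightarrow> F \<in> UC \<Longrightarrow> H \<in> UC \<Longrightarrow> (\<And>x. x \<in> U \<Longrightarrow> F x = H x) \<Longrightarrow> J F = J H"
  unfolding lin_def by blast+

lemma UC_const: "a \<in> Z \<Longrightarrow> (\<lambda>x. a) \<in> UC"
  by (rule UCI) auto

lemma UC_add:
  assumes "F \<in> UC" "H \<in> UC"
  shows "(\<lambda>x. F x \<^bold>+ H x) \<in> UC"
proof (rule UCI)
  fix n
  obtain i where i: "\<And>x y. x \<in> U \<Longrightarrow> y \<in> U \<Longrightarrow> sq x i = sq y i \<Longrightarrow> F x n = F y n"
    using UC_level [OF assms(1)] by blast
  obtain j where j: "\<And>x y. x \<in> U \<Longrightarrow> y \<in> U \<Longrightarrow> sq x j = sq y j \<Longrightarrow> H x n = H y n"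
    using UC_level [OF assms(2)] by blast
  show "\<exists>j. \<forall>x\<in>U. \<forall>y\<in>U. sq x j = sq y j \<longrightarrow> (F x \<^bold>+ H x) n = (F y \<^bold>+ H y) n"
  proof (intro exI ballI impI)
    fix x y assume xy: "x \<in> U" "y \<in> U" "sq x (max i j) = sq y (max i j)"
    then have "sq x i = sq y i" "sq x j = sq y j"
      using sq_mod_le [of x y _ "max i j"] by auto
    then have "F x n = F y n" "H x n = H y n"
      using i j xy by blast+
    then show "(F x \<^bold>+ H x) n = (F y \<^bold>+ H y) n"
      by (simp add: nth_add)
  qed
qed (use assms UC_closed in auto)

lemma UC_smult:
  assumes "F \<in> UC" "a \<in> Z"
  shows "(\<lambda>x. a \<^bold>* F x) \<in> UC"
proof (rule UCI)
  fix n
  obtain i where i: "\<And>x y. x \<in> U \<Longrightarrow> y \<in> U \<Longrightarrow> sq x i = sq y i \<Longrightarrow> F x n = F y n"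
    using UC_level [OF assms(1)] by blast
  have "(a \<^bold>* F x) n = (a \<^bold>* F y) n" if "x \<in> U" "y \<in> U" "sq x i = sq y i" for x y
    using i [OF that] by (simp add: nth_mult)
  then show "\<exists>j. \<forall>x\<in>U. \<forall>y\<in>U. sq x j = sq y j \<longrightarrow> (a \<^bold>* F x) n = (a \<^bold>* F y) n"
    by blast
qed (use assms UC_closed in auto)

definition pw :: "nat \<Rightarrow> padic \<Rightarrow> padic" where
  "pw k x = x \<^bold>^ (2 * k)"

lemma nth_pw: "x \<in> Z \<Longrightarrow> pw k x n = ((x n)\<^sup>2) ^ k mod P n"
  by (simp add: pw_def nth_pow power_mult)

lemma UC_pw: "pw k \<in> UC"
proof (rule UCI)
  fix n
  have "pw k x n = pw k y n" if "x \<in> U" "y \<in> U" "sq x n = sq y n" for x y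
    using that by (metis nth_pw Units_Z power_mod)
  then show "\<exists>j. \<forall>x\<in>U. \<forall>y\<in>U. sq x j = sq y j \<longrightarrow> pw k x n = pw k y n"
    by blast
qed (simp add: pw_def)

lemma UC_translate:
  assumes "F \<in> UC" "y \<in> U"
  shows "(\<lambda>x. F (y \<^bold>* x)) \<in> UC"
proof (rule UCI)
  fix n
  obtain i where i: "\<And>x y. x \<in> U \<Longrightarrow> y \<in> U \<Longrightarrow> sq x i = sq y i \<Longrightarrow> F x n = F y n"
    using UC_level [OF assms(1)] by blast
  have "F (y \<^bold>* x) n = F (y \<^bold>* z) n" if "x \<in> U" "z \<in> U" "sq x i = sq z i" for x z
    by (rule i) (use that assms in \<open>simp_all only: sq_mult Zp.Units_m_closed\<close>)
  then show "\<exists>j. \<forall>x\<in>U. \<forall>z\<in>U. sq x j = sq z j \<longrightarrow> F (y \<^bold>* x) n = F (y \<^bold>* z) n"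
    by blast
qed (use assms UC_closed Zp.Units_m_closed in blast)

text \<open>If the residue at level \<open>n\<close> is zero, all residues at higher levels are
  multiples of \<open>p^n\<close>, and the quotient at level \<open>m\<close> is read off at level
  \<open>m + n\<close>.\<close>

lemma divide_by_P:
  assumes "z \<in> Z" "z n = 0"
  shows "(\<lambda>m. z (m + n) div P n) \<in> Z" "\<iota> (P n) \<^bold>* (\<lambda>m. z (m + n) div P n) = z"
proof -
  have eq: "z (m + n) div P n mod P l = z (l + n) div P n" if "l \<le> m" for l m
  proof -
    have "z (l + n) = z (m + n) mod (P n * P l)"
      using nth_mod_le [OF assms(1), of "l + n" "m + n"] that by (simp add: power_add mult.commute)
    also have "\<dots> = P n * (z (m + n) div P n mod P l) + z (m + n) mod P n"
      by (simp add: zmod_zmult2_eq)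
    finally have "z (l + n) div P n
        = (P n * (z (m + n) div P n mod P l) + z (m + n) mod P n) div P n"
      by (rule arg_cong)
    then show ?thesis
      by (simp only: div_mult_self4 [OF P_pos(3)] mod_div_trivial add_0_right)
  qed
  show "(\<lambda>m. z (m + n) div P n) \<in> Z"
  proof (rule padic_closedI)
    fix m
    show "0 \<le> z (m + n) div P n \<and> z (m + n) div P n < P m"
      using eq [of m m] pos_mod_bound [OF P_pos(1), of "z (m + n) div P n" m]
        pos_mod_sign [OF P_pos(1), of "z (m + n) div P n" m] by simp
    show "z (Suc m + n) div P n mod P m = z (m + n) div P n"
      by (rule eq) simp
  qed
  show "\<iota> (P n) \<^bold>* (\<lambda>m. z (m + n) div P n) = z"
  proof
    fix m
    have "z (m + n) mod P n = 0"
      using nth_mod_le [OF assms(1), of n "m + n"] assms(2) by simp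
    then have "P n * (z (m + n) div P n) = z (m + n)"
      by (simp add: dvd_eq_mod_eq_0)
    then show "(\<iota> (P n) \<^bold>* (\<lambda>m. z (m + n) div P n)) m = z m"
      using nth_mod_le [OF assms(1), of m "m + n"] by (simp add: nth_mult nth_emb mod_simps)
  qed
qed

lemma UC_diff:
  assumes "F \<in> UC" "H \<in> UC"
  shows "(\<lambda>x. F x \<^bold>- H x) \<in> UC"
proof -
  have "(\<lambda>x. F x \<^bold>+ \<iota> (-1) \<^bold>* H x) \<in> UC"
    using assms by (intro UC_add UC_smult) auto
  moreover have "F x \<^bold>+ \<iota> (-1) \<^bold>* H x = F x \<^bold>- H x" if "x \<in> U" for x
    using assms that UC_closed
    by (auto simp: fun_eq_iff nth_add nth_mult nth_emb nth_diff mod_simps)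
  ultimately show ?thesis
    by (simp add: UC_def)
qed

text \<open>Linear functionals are automatically continuous: \<open>F - H\<close> is
  \<open>p^n\<close> times a function in \<open>UC\<close>, and linearity pulls out the factor. The
  approximation arguments below rest on this.\<close>

lemma lin_level:
  assumes J: "lin J" and F: "F \<in> UC" "H \<in> UC" and eq: "\<And>x. x \<in> U \<Longrightarrow> F x n = H x n"
  shows "J F n = J H n"
proof -
  define D where "D x = F x \<^bold>- H x" for x
  have D: "D \<in> UC" using F UC_diff by (simp add: D_def [abs_def])
  have D0: "D x n = 0" if "x \<in> U" for x
    using that F eq UC_closed by (simp add: D_def nth_diff)
  define E where "E x = (\<lambda>m. D x (m + n) div P n)" for x
  have E: "E \<in> UC"
  proof (rule UCI)
    show "E x \<in> Z" if "x \<in> U" for x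
      unfolding E_def using that D D0 UC_closed by (intro divide_by_P(1)) auto
    fix m
    obtain j where "\<And>x y. x \<in> U \<Longrightarrow> y \<in> U \<Longrightarrow> sq x j = sq y j \<Longrightarrow> D x (m + n) = D y (m + n)"
      using UC_level [OF D] by blast
    then show "\<exists>j. \<forall>x\<in>U. \<forall>y\<in>U. sq x j = sq y j \<longrightarrow> E x m = E y m"
      unfolding E_def by metis
  qed
  have "F x = H x \<^bold>+ \<iota> (P n) \<^bold>* E x" if "x \<in> U" for x
  proof -
    have "\<iota> (P n) \<^bold>* E x = D x"
      unfolding E_def by (rule divide_by_P(2) [OF UC_closed [OF D that] D0 [OF that]])
    then have "\<iota> (P n) \<^bold>* E x = F x \<^bold>- H x"
      by (simp only: D_def)
    then show ?thesis
      using UC_closed F that by (simp add: fun_eq_iff nth_add nth_diff mod_simps)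
  qed
  then have "J F = J (\<lambda>x. H x \<^bold>+ \<iota> (P n) \<^bold>* E x)"
    using F E by (intro lin_cong [OF J] UC_add UC_smult) auto
  also have "\<dots> = J H \<^bold>+ \<iota> (P n) \<^bold>* J E"
    using lin_add [OF J F(2) UC_smult [OF E emb_closed]] lin_smult [OF J emb_closed E] by simp
  finally show ?thesis
    using lin_closed [OF J F(2)] by (simp add: nth_add nth_mult nth_emb mod_simps)
qed

text \<open>Integer sums reduced at each level avoid sums in the ring \<open>padic_ring p\<close>,
  so that integer polynomials enter congruences directly.\<close>

lemma lin_combination:
  fixes e :: "nat \<Rightarrow> int"
  assumes J: "lin J" and K: "finite K"
  defines "S \<equiv> \<lambda>x n. (\<Sum>k\<in>K. e k * pw k x n) mod P n"
  shows "S \<in> UC" "J S n = (\<Sum>k\<in>K. e k * J (pw k) n) mod P n"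
proof -
  have "(\<lambda>x n. (\<Sum>k\<in>K. e k * pw k x n) mod P n) \<in> UC \<and>
      (\<forall>n. J (\<lambda>x n. (\<Sum>k\<in>K. e k * pw k x n) mod P n) n = (\<Sum>k\<in>K. e k * J (pw k) n) mod P n)"
    using K
  proof (induction K)
    case empty
    have "(\<lambda>n. 0) = \<^bold>0" by (simp add: fun_eq_iff nth_zero)
    moreover have "J (\<lambda>x. \<^bold>0) = \<^bold>0"
      using lin_smult [OF J Zp.zero_closed UC_const [OF Zp.zero_closed]]
        lin_closed [OF J UC_const [OF Zp.zero_closed]] by simp
    ultimately show ?case
      using UC_const [of "\<^bold>0"] by (simp add: nth_zero)
  next
    case (insert i K)
    let ?S = "\<lambda>x n. (\<Sum>k\<in>K. e k * pw k x n) mod P n"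
    have "(\<lambda>x n. (\<Sum>k\<in>insert i K. e k * pw k x n) mod P n) = (\<lambda>x. \<iota> (e i) \<^bold>* pw i x \<^bold>+ ?S x)"
      using insert by (simp add: fun_eq_iff nth_add nth_mult nth_emb mod_simps)
    moreover have "(\<lambda>x. \<iota> (e i) \<^bold>* pw i x \<^bold>+ ?S x) \<in> UC"
      using insert by (intro UC_add UC_smult UC_pw) auto
    moreover have "J (\<lambda>x. \<iota> (e i) \<^bold>* pw i x \<^bold>+ ?S x) = \<iota> (e i) \<^bold>* J (pw i) \<^bold>+ J ?S"
      using insert lin_add [OF J UC_smult [OF UC_pw emb_closed], of ?S "e i" i]
        lin_smult [OF J emb_closed UC_pw] by simp
    ultimately show ?case
      using insert by (simp add: nth_add nth_mult nth_emb mod_simps)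
  qed
  then show "S \<in> UC" "J S n = (\<Sum>k\<in>K. e k * J (pw k) n) mod P n"
    by (auto simp: S_def)
qed

section \<open>Measures as functionals on functions of units\<close>

lemma lin_measure:
  assumes \<mu>: "\<mu> \<in> padic_measures p"
  shows "lin (\<lambda>F. \<mu> (descend p F))"
proof (rule linI)
  fix F assume F: "F \<in> UC"
  show "\<mu> (descend p F) \<in> Z"
    using \<mu> descend_cont [OF F] by (auto simp: padic_measures_def PiE_def)
  fix a assume a: "a \<in> Z"
  have "descend p (\<lambda>x. a \<^bold>* F x) = (\<lambda>X\<in>carrier G. a \<^bold>* descend p F X)"
  proof (rule extensionalityI [where A = "carrier G"])
    fix X assume "X \<in> carrier G"
    then show "descend p (\<lambda>x. a \<^bold>* F x) X = (\<lambda>X\<in>carrier G. a \<^bold>* descend p F X) X"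
      using F a by (auto simp: carrier_G descend_pm UC_smult)
  qed (simp_all add: descend_def)
  then show "\<mu> (descend p (\<lambda>x. a \<^bold>* F x)) = a \<^bold>* \<mu> (descend p F)"
    using \<mu> a descend_cont [OF F] by (simp add: padic_measures_def)
next
  fix F H assume FH: "F \<in> UC" "H \<in> UC"
  have "descend p (\<lambda>x. F x \<^bold>+ H x) = (\<lambda>X\<in>carrier G. descend p F X \<^bold>+ descend p H X)"
  proof (rule extensionalityI [where A = "carrier G"])
    fix X assume "X \<in> carrier G"
    then show "descend p (\<lambda>x. F x \<^bold>+ H x) X = (\<lambda>X\<in>carrier G. descend p F X \<^bold>+ descend p H X) X"
      using FH by (auto simp: carrier_G descend_pm UC_add)
  qed (simp_all add: descend_def)
  then show "\<mu> (descend p (\<lambda>x. F x \<^bold>+ H x)) = \<mu> (descend p F) \<^bold>+ \<mu> (descend p H)"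
    using \<mu> FH [THEN descend_cont] by (simp add: padic_measures_def)
  assume eq: "\<And>x. x \<in> U \<Longrightarrow> F x = H x"
  have "descend p F = descend p H"
  proof (rule extensionalityI [where A = "carrier G"])
    fix X assume "X \<in> carrier G"
    then show "descend p F X = descend p H X"
      using FH eq by (auto simp: carrier_G descend_pm)
  qed (simp_all add: descend_def)
  then show "\<mu> (descend p F) = \<mu> (descend p H)" by simp
qed

text \<open>Converse of \<open>lin_measure\<close>: constructing a measure reduces to constructing a
  functional on \<open>UC\<close>, which is evaluated at the pullback of a function on
  cosets.\<close>

lemma measure_of_lin:
  assumes J: "lin J"
  shows "\<exists>\<mu>\<in>padic_measures p. \<forall>F\<in>UC. \<mu> (descend p F) = J F"
proof
  let ?\<mu> = "\<lambda>f\<in>cont_funs p. J (\<lambda>x. f (pm x))"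
  show "\<forall>F\<in>UC. ?\<mu> (descend p F) = J F"
  proof
    fix F assume F: "F \<in> UC"
    then have "J (\<lambda>x. descend p F (pm x)) = J F"
      by (intro lin_cong [OF J] cont_funs_UC descend_cont) (auto simp: descend_pm)
    then show "?\<mu> (descend p F) = J F"
      by (simp add: descend_cont F)
  qed
  have lift: "(\<lambda>X\<in>carrier G. K X) \<in> cont_funs p"
    if "(\<lambda>x. K (pm x)) \<in> UC" for K
  proof -
    have "(\<lambda>X\<in>carrier G. K X) = descend p (\<lambda>x. K (pm x))"
    proof (rule extensionalityI [where A = "carrier G"])
      fix X assume "X \<in> carrier G"
      then show "(\<lambda>X\<in>carrier G. K X) X = descend p (\<lambda>x. K (pm x)) X"
        using that descend_pm [OF that] by (auto simp: carrier_G)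
    qed (simp_all add: descend_def)
    then show ?thesis using descend_cont [OF that] by simp
  qed
  have restr: "J (\<lambda>x. (\<lambda>X\<in>carrier G. K X) (pm x)) = J (\<lambda>x. K (pm x))"
    if "(\<lambda>x. K (pm x)) \<in> UC" for K
    using that cont_funs_UC [OF lift [OF that]] by (intro lin_cong [OF J]) auto
  show "?\<mu> \<in> padic_measures p"
    unfolding padic_measures_def
  proof (intro CollectI conjI ballI PiE_I)
    fix f assume f: "f \<in> cont_funs p"
    show "?\<mu> f \<in> Z" using f lin_closed [OF J cont_funs_UC [OF f]] by simp
  next
    fix f g assume fg: "f \<in> cont_funs p" "g \<in> cont_funs p"
    have "(\<lambda>x. f (pm x) \<^bold>+ g (pm x)) \<in> UC"
      using fg by (intro UC_add cont_funs_UC)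
    then show "?\<mu> (\<lambda>x\<in>carrier G. f x \<^bold>+ g x) = ?\<mu> f \<^bold>+ ?\<mu> g"
      using fg lift [of "\<lambda>X. f X \<^bold>+ g X"] restr [of "\<lambda>X. f X \<^bold>+ g X"]
        lin_add [OF J cont_funs_UC cont_funs_UC, of f g] by simp
  next
    fix a f assume af: "a \<in> Z" "f \<in> cont_funs p"
    have "(\<lambda>x. a \<^bold>* f (pm x)) \<in> UC"
      using af by (intro UC_smult cont_funs_UC)
    then show "?\<mu> (\<lambda>x\<in>carrier G. a \<^bold>* f x) = a \<^bold>* ?\<mu> f"
      using af lift [of "\<lambda>X. a \<^bold>* f X"] restr [of "\<lambda>X. a \<^bold>* f X"]
        lin_smult [OF J _ cont_funs_UC, of a f] by simp
  qed auto
qed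

end

section \<open>Density of even polynomials\<close>

lemma prod_falling:
  assumes "N \<ge> 1"
  shows "(\<Prod>i\<in>{1..<Suc m}. int N - int i) = fact m * int ((N - 1) choose m)"
proof (induction m)
  case (Suc m)
  have "int ((N - 1) choose Suc m) * (1 + int m) = int ((N - 1) choose m) * (int N - int (Suc m))"
  proof (cases "m < N")
    case True
    have "Suc m * ((N - 1) choose Suc m) = ((N - 1) choose m) * (N - 1 - m)"
      by (metis binomial_absorb_comp binomial_absorption mult.commute)
    then have "int (Suc m) * int ((N - 1) choose Suc m) = int ((N - 1) choose m) * int (N - 1 - m)"
      by (simp only: of_nat_mult [symmetric])
    moreover have "int (N - 1 - m) = int N - int (Suc m)"
      using True by simp
    ultimately show ?thesis
      by (simp only: of_nat_Suc mult.commute add.commute)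
  qed (use assms in \<open>simp add: binomial_eq_0\<close>)
  moreover have "(\<Prod>i\<in>{1..<Suc (Suc m)}. int N - int i)
      = (\<Prod>i\<in>{1..<Suc m}. int N - int i) * (int N - int (Suc m))"
    by (rule prod.atLeastLessThan_Suc) simp
  ultimately have "(\<Prod>i\<in>{1..<Suc (Suc m)}. int N - int i)
      = fact m * (int ((N - 1) choose Suc m) * (1 + int m))"
    by (simp only: Suc.IH mult.assoc)
  then show ?case
    by (simp only: fact_Suc of_nat_Suc mult.commute mult.left_commute)
qed simp

context p_adic
begin

text \<open>From \<open>N * C(N-1, p^j - 1) = C(N, p^j) * p^j\<close>: if \<open>p\<close> did not
  divide the binomial coefficient on the left, all of \<open>p^j\<close> would have to divide
  \<open>N\<close>.\<close>

lemma choose_dvd: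
  assumes "N \<ge> 1" "\<not> p ^ j dvd N"
  shows "p dvd ((N - 1) choose (p ^ j - 1))"
proof (rule ccontr)
  assume "\<not> ?thesis"
  then have "coprime (p ^ j) ((N - 1) choose (p ^ j - 1))"
    using prime_p by (simp add: prime_imp_coprime)
  moreover have "N * ((N - 1) choose (p ^ j - 1)) = (N choose (p ^ j)) * p ^ j"
    using assms p_pos by (metis times_binomial_minus1_eq mult.commute zero_less_power)
  ultimately have "p ^ j dvd N"
    by (metis coprime_dvd_mult_left_iff dvd_triv_right)
  then show False using assms by simp
qed

text \<open>Pascal's rule: the entries of row \<open>N\<close> in columns 1 to
  \<open>p^j - 1\<close> vanish modulo \<open>p\<close>, so neighbours in row \<open>N - 1\<close>
  differ by a sign.\<close>

lemma choose_cong: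
  assumes "N \<ge> 1" "p ^ j dvd N" "i < p ^ j"
  shows "[int ((N - 1) choose i) = (- 1) ^ i] (mod int p)"
  using assms(3)
proof (induction i)
  case (Suc i)
  have "p dvd (N choose Suc i)"
  proof (rule ccontr)
    assume "\<not> ?thesis"
    then have "coprime (p ^ j) (N choose Suc i)"
      using prime_p by (simp add: prime_imp_coprime)
    moreover have "Suc i * (N choose Suc i) = N * ((N - 1) choose i)"
      using assms by (metis Suc_times_binomial_eq Suc_diff_1 mult.commute less_le_trans zero_less_one)
    ultimately have "p ^ j dvd Suc i"
      using assms by (metis coprime_dvd_mult_left_iff dvd_mult2)
    then show False using Suc.prems by (simp add: nat_dvd_not_less)
  qed
  then have "int p dvd int (N choose Suc i)" by simp
  moreover have "N choose Suc i = ((N - 1) choose i) + ((N - 1) choose Suc i)"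
    using assms by (metis Suc_diff_1 binomial_Suc_Suc less_le_trans zero_less_one)
  ultimately have "[int ((N - 1) choose Suc i) = - int ((N - 1) choose i)] (mod int p)"
    by (simp add: cong_iff_dvd_diff add.commute)
  also have "[- int ((N - 1) choose i) = - ((- 1) ^ i)] (mod int p)"
    using Suc by (simp add: cong_minus_minus_iff)
  finally show ?case by simp
qed simp

text \<open>The exponent is the totient of \<open>p^(s+1)\<close> and at least \<open>s\<close>.
  Raising to it sends units to 1 and multiples of \<open>p\<close> to 0 modulo \<open>p^s\<close>,
  which lifts the indicator from precision \<open>p\<close> to precision \<open>p^s\<close>.\<close>

lemma choose_power_indicator:
  assumes "N \<ge> 1"
  shows "[int ((N - 1) choose (p ^ j - 1)) ^ ((p - 1) * p ^ s) = (if p ^ j dvd N then 1 else 0)] (mod P s)"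
proof (cases "p ^ j dvd N")
  case True
  let ?C = "(N - 1) choose (p ^ j - 1)"
  have "[int ?C = (- 1) ^ (p ^ j - 1)] (mod int p)"
    using p_pos by (intro choose_cong [OF assms True]) simp
  moreover have "\<not> int p dvd (- 1) ^ (p ^ j - 1)"
    using prime_gt_1_nat [OF prime_p] by (simp add: minus_one_power_iff)
  ultimately have "\<not> int p dvd int ?C"
    using cong_dvd_iff by blast
  then have "coprime ?C (p ^ Suc s)"
    using prime_p by (simp add: coprime_commute prime_imp_coprime)
  then have "[?C ^ totient (p ^ Suc s) = 1] (mod p ^ Suc s)"
    by (rule euler_theorem)
  moreover have "totient (p ^ Suc s) = (p - 1) * p ^ s"
    using totient_prime_power_Suc [OF prime_p, of s] by (simp only: mult.commute)
  ultimately have "[int ?C ^ ((p - 1) * p ^ s) = 1] (mod P (Suc s))"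
    by (metis cong_int_iff of_nat_1 of_nat_power)
  then show ?thesis
    using True cong_dvd_modulus [of _ _ "P (Suc s)" "P s"] by simp
next
  case False
  let ?C = "int ((N - 1) choose (p ^ j - 1))"
  have "s \<le> (p - 1) * p ^ s"
    using prime_gt_1_nat [OF prime_p] less_exp [of s] power_mono [of 2 p s] 
    by (metis One_nat_def Suc_leI Suc_pred less_imp_le_nat mult_le_mono nat_mult_1 order_trans
        prime_ge_2_nat prime_p zero_less_diff zero_le)
  moreover have "int p dvd ?C"
    using choose_dvd [OF assms False] by simp
  ultimately have "P s dvd ?C ^ ((p - 1) * p ^ s)"
    by (meson dvd_power_same le_imp_power_dvd dvd_trans)
  then show ?thesis using False by (simp add: cong_0_iff)
qed

text \<open>
  The falling factorial of \<open>N - 1\<close> for \<open>N = y + p\<^sup>j - r\<close>; the shift by \<open>p\<^sup>j\<close> keeps \<open>N\<close> positive.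
\<close>

definition indicator_poly :: "nat \<Rightarrow> nat \<Rightarrow> int \<Rightarrow> int poly" where
  "indicator_poly j s r = (\<Prod>i\<in>{1..<p ^ j}. [:P j - r - int i, 1:]) ^ ((p - 1) * p ^ s)"

text \<open>\<open>W\<close> is the denominator of the binomial polynomial, raised to the same
  power. Retaining it keeps the coefficients integral, so the modulus carries it too.\<close>

lemma indicator_poly:
  fixes s :: nat and j :: nat
  assumes "0 \<le> y" "0 \<le> r" "r < P j"
  defines "W \<equiv> fact (p ^ j - 1) ^ ((p - 1) * p ^ s)"
  shows "[poly (indicator_poly j s r) y = W * (if y mod P j = r then 1 else 0)] (mod W * P s)"
proof -
  define N where "N = nat (y + P j - r)"
  have N: "int N = y + P j - r" "N \<ge> 1"
    using assms by (auto simp: N_def)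
  have "p ^ j dvd N \<longleftrightarrow> P j dvd int N"
    by (metis int_dvd_int_iff of_nat_power)
  also have "\<dots> \<longleftrightarrow> P j dvd y - r"
    using dvd_add_left_iff [of "P j" "P j" "y - r"] by (simp add: N algebra_simps)
  also have "\<dots> \<longleftrightarrow> y mod P j = r"
    using assms by (simp add: mod_eq_dvd_iff [symmetric])
  finally have iff: "p ^ j dvd N \<longleftrightarrow> y mod P j = r" .
  have "(\<Prod>i\<in>{1..<p ^ j}. y + (P j - r - int i)) = (\<Prod>i\<in>{1..<Suc (p ^ j - 1)}. int N - int i)"
    using p_pos by (intro prod.cong) (auto simp: N)
  also have "\<dots> = fact (p ^ j - 1) * int ((N - 1) choose (p ^ j - 1))"
    by (rule prod_falling [OF N(2)])
  finally have "poly (indicator_poly j s r) y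
      = W * int ((N - 1) choose (p ^ j - 1)) ^ ((p - 1) * p ^ s)"
    by (simp add: indicator_poly_def poly_prod W_def power_mult_distrib add.commute)
  then show ?thesis
    using choose_power_indicator [OF N(2), of j s] unfolding iff
    by (simp only: cong_iff_dvd_diff right_diff_distrib [symmetric] mult_dvd_mono [OF dvd_refl])
qed

text \<open>Interpolation on the finitely many classes of squares modulo \<open>p^j\<close> by
  indicator polynomials. \<open>M\<close> collects the denominators, and \<open>t\<close> is a
  precision at which a congruence for \<open>M * F\<close> still determines \<open>F\<close> modulo
  \<open>p^s\<close>.\<close>

lemma density:
  assumes F: "F \<in> UC"
  obtains M :: int and t K and e :: "nat \<Rightarrow> int"
  where "\<And>z. P t dvd M * z \<Longrightarrow> P s dvd z" "s \<le> t" "finite K" "K \<subseteq> {2..}"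
    "\<And>x. x \<in> U \<Longrightarrow> [M * F x t = (\<Sum>k\<in>K. e k * ((x t)\<^sup>2) ^ k)] (mod P t)"
proof -
  obtain j where j: "\<And>x y. x \<in> U \<Longrightarrow> y \<in> U \<Longrightarrow> sq x j = sq y j \<Longrightarrow> F x s = F y s"
    using UC_level [OF F] by blast
  define W :: int where "W = fact (p ^ j - 1) ^ ((p - 1) * p ^ s)"
  \<comment> \<open>The extra factor \<open>P j\<close> forces \<open>j \<le> t\<close>, so that the
    residue of the square modulo \<open>p^j\<close> can be read off at level
    \<open>t\<close>.\<close>
  define M where "M = P j * W"
  have W: "W \<noteq> 0" by (simp add: W_def)
  then have M: "M \<noteq> 0" using P_pos(3) [of j] by (simp add: M_def del: P_pos)
  define t where "t = multiplicity (int p) M + s"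
  have tM: "P t dvd M * P s"
    by (simp add: t_def power_add multiplicity_dvd)
  have Mt: "P s dvd z" if z: "P t dvd M * z" for z
  proof -
    obtain u where u: "M = P (multiplicity (int p) M) * u" "\<not> int p dvd u"
      using multiplicity_decompose' [OF M, of "int p"] prime_int_p not_prime_unit by blast
    have "P (multiplicity (int p) M) * P s dvd P (multiplicity (int p) M) * (u * z)"
      using z u(1) by (metis mult.assoc power_add t_def)
    then have "P s dvd u * z" using p_pos by simp
    moreover have "coprime (P s) u"
      using u(2) prime_int_p by (simp add: prime_imp_coprime)
    ultimately show ?thesis
      by (simp add: coprime_dvd_mult_right_iff)
  qed
  have "j \<le> multiplicity (int p) M"
    using M prime_gt_1_nat [OF prime_p] by (intro multiplicity_geI) (auto simp: M_def)
  then have jt: "j \<le> t" by (simp add: t_def)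
  obtain H where H: "H \<ge> 2" "\<And>x. coprime x (int p) \<Longrightarrow> (x ^ H) mod P t = 1 mod P t"
    using euler_power by blast
  \<comment> \<open>The value is taken at an arbitrary representative of the class; the default 0
    serves residues that are not squares of units. Another representative changes \<open>F\<close>
    by a multiple of \<open>p^s\<close>, which \<open>M\<close> turns into a multiple of
    \<open>p^t\<close>.\<close>
  define f where "f r = (if \<exists>x\<in>U. sq x j = r then F (SOME x. x \<in> U \<and> sq x j = r) t else 0)" for r
  \<comment> \<open>The factor \<open>y^H\<close> is 1 modulo \<open>p^t\<close> on squares of units
    and removes the coefficients of degree 0 and 1.\<close>
  define Q where "Q = monom 1 H * (\<Sum>r\<in>{0..<P j}. smult (P j * f r) (indicator_poly j s r))"
  have Q: "[M * F x t = poly Q ((x t)\<^sup>2)] (mod P t)" if x: "x \<in> U" for x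
  proof -
    define y where "y = (x t)\<^sup>2"
    have y0: "y \<ge> 0" by (simp add: y_def)
    have yj: "y mod P j = sq x j"
      using x jt nth_mod_le [of x j t] by (metis y_def power_mod Units_Z)
    have "\<exists>x'\<in>U. sq x' j = sq x j" using x by blast
    then obtain x' where x': "x' \<in> U" "sq x' j = sq x j" "f (sq x j) = F x' t"
      using someI_ex [of "\<lambda>z. z \<in> U \<and> sq z j = sq x j"] x by (auto simp: f_def)
    then have "F x' s = F x s" using j x by blast
    then have "F x' t mod P s = F x t mod P s"
      using x x' F UC_closed nth_mod_le [of _ s t] by (simp add: t_def)
    then have "M * P s dvd M * F x' t - M * F x t"
      using M by (simp add: mod_eq_dvd_iff right_diff_distrib [symmetric])
    then have 1: "[M * F x' t = M * F x t] (mod P t)"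
      using tM by (metis cong_iff_dvd_diff dvd_trans)
    have "[(\<Sum>r\<in>{0..<P j}. f r * poly (indicator_poly j s r) y)
        = (\<Sum>r\<in>{0..<P j}. f r * (W * (if y mod P j = r then 1 else 0)))] (mod W * P s)"
      unfolding W_def by (intro cong_sum cong_mult cong_refl indicator_poly y0) auto
    also have "(\<Sum>r\<in>{0..<P j}. f r * (W * (if y mod P j = r then 1 else 0))) = W * F x' t"
    proof -
      have "(\<Sum>r\<in>{0..<P j}. f r * (W * (if y mod P j = r then 1 else 0)))
          = (\<Sum>r\<in>{0..<P j}. if y mod P j = r then f r * W else 0)"
        by (intro sum.cong) auto
      also have "\<dots> = f (y mod P j) * W"
        using pos_mod_bound [OF P_pos(1)] pos_mod_sign [OF P_pos(1)] by simp
      finally show ?thesis using x'(3) yj by simp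
    qed
    finally have "M * P s dvd P j * (\<Sum>r\<in>{0..<P j}. f r * poly (indicator_poly j s r) y) - M * F x' t"
      by (simp add: M_def cong_iff_dvd_diff mult.assoc right_diff_distrib [symmetric])
    then have 2: "[P j * (\<Sum>r\<in>{0..<P j}. f r * poly (indicator_poly j s r) y) = M * F x' t] (mod P t)"
      using tM by (metis cong_iff_dvd_diff dvd_trans)
    have "[y ^ H = 1] (mod P t)"
    proof (cases "t = 0")
      case False
      then have "coprime (x t) (P 1)" using x Units_coprime [of x t 1] by simp
      then have "coprime y (int p)" by (simp add: y_def)
      then show ?thesis using H by (simp add: cong_def)
    qed (simp add: cong_def)
    then have "[y ^ H * (P j * (\<Sum>r\<in>{0..<P j}. f r * poly (indicator_poly j s r) y))
        = 1 * (M * F x t)] (mod P t)"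
      by (rule cong_mult) (rule cong_trans [OF 2 1])
    moreover have "poly Q y = y ^ H * (P j * (\<Sum>r\<in>{0..<P j}. f r * poly (indicator_poly j s r) y))"
      by (simp add: Q_def poly_monom poly_sum sum_distrib_left mult.assoc mult.left_commute)
    ultimately show ?thesis
      by (simp add: y_def cong_sym_eq)
  qed
  have "poly Q y = (\<Sum>k\<in>{2..degree Q}. coeff Q k * y ^ k)" for y
  proof -
    have "coeff Q k = 0" if "k < 2" for k
      using that H by (simp add: Q_def coeff_monom_mult)
    then have "(\<Sum>k\<in>{2..degree Q}. coeff Q k * y ^ k) = (\<Sum>k\<le>degree Q. coeff Q k * y ^ k)"
      by (intro sum.mono_neutral_left) auto
    then show ?thesis by (simp add: poly_altdef)
  qed
  then show ?thesis
    using Mt Q by (intro that [of t M "{2..degree Q}" "coeff Q"]) (auto simp: t_def)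
qed

section \<open>Uniqueness, limits and convolution of measures\<close>

text \<open>A congruence valid at all units passes to the values of \<open>J\<close> through
  \<open>lin_level\<close>; only finitely many moments enter.\<close>

lemma lin_density:
  fixes e :: "nat \<Rightarrow> int"
  assumes J: "lin J" and F: "F \<in> UC" and K: "finite K"
    and eq: "\<And>x. x \<in> U \<Longrightarrow> [M * F x t = (\<Sum>k\<in>K. e k * ((x t)\<^sup>2) ^ k)] (mod P t)"
  shows "[M * J F t = (\<Sum>k\<in>K. e k * J (pw k) t)] (mod P t)"
proof -
  let ?S = "\<lambda>x n. (\<Sum>k\<in>K. e k * pw k x n) mod P n"
  have "(\<iota> M \<^bold>* F x) t = ?S x t" if x: "x \<in> U" for x
  proof -
    have "[(\<Sum>k\<in>K. e k * pw k x t) = (\<Sum>k\<in>K. e k * ((x t)\<^sup>2) ^ k)] (mod P t)"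
      using x by (intro cong_sum cong_mult cong_refl) (simp add: nth_pw cong_def)
    then show ?thesis
      using eq [OF x] by (simp add: nth_mult nth_emb mod_simps cong_def)
  qed
  then have "J (\<lambda>x. \<iota> M \<^bold>* F x) t = J ?S t"
    using F lin_combination(1) [OF J K] by (intro lin_level [OF J] UC_smult) auto
  then have "(\<iota> M \<^bold>* J F) t = (\<Sum>k\<in>K. e k * J (pw k) t) mod P t"
    by (simp only: lin_combination(2) [OF J K] lin_smult [OF J emb_closed F])
  then show ?thesis
    by (simp add: nth_mult nth_emb mod_simps cong_def)
qed

lemma lin_unique:
  assumes J: "lin J" "lin L" and eq: "\<And>k. k \<ge> 2 \<Longrightarrow> J (pw k) = L (pw k)" and F: "F \<in> UC"
  shows "J F = L F"
proof
  fix s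
  obtain M :: int and t K and e :: "nat \<Rightarrow> int"
    where MtKe: "\<And>z. P t dvd M * z \<Longrightarrow> P s dvd z" "s \<le> t" "finite K" "K \<subseteq> {2..}"
    "\<And>x. x \<in> U \<Longrightarrow> [M * F x t = (\<Sum>k\<in>K. e k * ((x t)\<^sup>2) ^ k)] (mod P t)"
    by (rule density [OF F, where s = s]) (rule that)
  have "(\<Sum>k\<in>K. e k * J (pw k) t) = (\<Sum>k\<in>K. e k * L (pw k) t)"
    using MtKe(4) eq by (intro sum.cong) (auto dest!: subsetD)
  then have "[M * J F t = M * L F t] (mod P t)"
    using lin_density [OF J(1) F MtKe(3,5)] lin_density [OF J(2) F MtKe(3,5)]
    by (simp add: cong_def)
  then have "P s dvd J F t - L F t"
    using MtKe(1) [of "J F t - L F t"] by (simp add: cong_iff_dvd_diff right_diff_distrib)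
  then have "J F t mod P s = L F t mod P s"
    by (simp add: mod_eq_dvd_iff)
  then show "J F s = L F s"
    using nth_mod_le [OF _ MtKe(2)] lin_closed J F by metis
qed

lemma even_moment_eq: "even_moment p \<mu> k = \<mu> (descend p (pw k))"
  by (simp add: even_moment_def pw_def [abs_def])

lemma measure_extI:
  assumes "\<mu> \<in> extensional (cont_funs p)" "\<nu> \<in> extensional (cont_funs p)"
    and "\<And>F. F \<in> UC \<Longrightarrow> \<mu> (descend p F) = \<nu> (descend p F)"
  shows "\<mu> = \<nu>"
proof (rule extensionalityI [OF assms(1,2)])
  fix f assume "f \<in> cont_funs p"
  then show "\<mu> f = \<nu> f"
    using assms(3) [OF cont_funs_UC] cont_funs_descend by metis
qed

lemma measure_extensional: "\<mu> \<in> padic_measures p \<Longrightarrow> \<mu> \<in> extensional (cont_funs p)"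
  by (auto simp: padic_measures_def PiE_def)

lemma measure_unique:
  assumes "\<mu> \<in> padic_measures p" "\<nu> \<in> padic_measures p"
    and "\<And>k. k \<ge> 2 \<Longrightarrow> even_moment p \<mu> k = even_moment p \<nu> k"
  shows "\<mu> = \<nu>"
proof (rule measure_extI)
  fix F assume "F \<in> UC"
  then show "\<mu> (descend p F) = \<nu> (descend p F)"
    using lin_unique [OF lin_measure lin_measure, of \<mu> \<nu> F] assms by (simp add: even_moment_eq)
qed (use assms measure_extensional in auto)

lemma moment_closed [simp]: "\<mu> \<in> padic_measures p \<Longrightarrow> even_moment p \<mu> k \<in> Z"
  using lin_closed [OF lin_measure UC_pw] by (simp add: even_moment_eq)

section \<open>Limits of functionals\<close>

lemma eventually_const_iff:
  "(\<exists>v. \<forall>\<^sub>F n in sequentially. f n = v) \<longleftrightarrow> (\<exists>n0. \<forall>n\<ge>n0. \<forall>m\<ge>n0. f n = f m)"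
  unfolding eventually_sequentially by (metis order_refl)

text \<open>If \<open>d\<close> is nonzero at level \<open>l\<close>, division by it costs at most
  \<open>l\<close> levels of precision: agreement of the products at \<open>l + N\<close> gives
  agreement of the quotients at \<open>N\<close>.\<close>

lemma eventually_const_divide:
  assumes d: "d \<in> Z" "d \<noteq> \<^bold>0" and s: "\<And>n. s n \<in> Z"
    and conv: "\<And>N. \<exists>v. \<forall>\<^sub>F n in sequentially. (d \<^bold>* s n) N = v"
  shows "\<exists>v. \<forall>\<^sub>F n in sequentially. s n N = v"
proof -
  obtain l where l: "d l \<noteq> 0" using d by (auto simp: fun_eq_iff nth_zero)
  obtain n0 where n0: "\<And>n m. n \<ge> n0 \<Longrightarrow> m \<ge> n0 \<Longrightarrow> (d \<^bold>* s n) (l + N) = (d \<^bold>* s m) (l + N)"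
    using conv [of "l + N"] unfolding eventually_const_iff by blast
  have "s n N = s m N" if "n \<ge> n0" "m \<ge> n0" for n m
  proof -
    have "P (l + N) dvd d (l + N) * (s n (l + N) - s m (l + N))"
      using n0 [OF that] by (simp add: nth_mult mod_eq_dvd_iff right_diff_distrib)
    then have "P l dvd d (l + N) \<or> P N dvd (s n (l + N) - s m (l + N))"
      by (rule prime_power_dvd_mult)
    moreover have "\<not> P l dvd d (l + N)"
      using l nth_mod_le [OF d(1), of l "l + N"] by auto
    ultimately have "s n (l + N) mod P N = s m (l + N) mod P N"
      by (simp add: mod_eq_dvd_iff)
    then show ?thesis
      using nth_mod_le [OF s, of N "l + N"] by simp
  qed
  then show ?thesis unfolding eventually_const_iff by blast
qed

text \<open>By density, \<open>M * J n F\<close> modulo \<open>p^t\<close> depends on finitely many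
  moments, all of which become constant. The limit is linear because at a given level it agrees with
  some \<open>J n\<close> on the finitely many functions involved.\<close>

lemma lin_limit:
  assumes J: "\<And>n. lin (J n)"
    and conv: "\<And>k N. k \<ge> 2 \<Longrightarrow> \<exists>v. \<forall>\<^sub>F n in sequentially. J n (pw k) N = v"
  obtains L where "lin L" "\<And>F N. F \<in> UC \<Longrightarrow> \<forall>\<^sub>F n in sequentially. J n F N = L F N"
proof -
  have ex: "\<exists>v. \<forall>\<^sub>F n in sequentially. J n F s = v" if F: "F \<in> UC" for F s
  proof -
    obtain M :: int and t K and e :: "nat \<Rightarrow> int"
      where MtKe: "\<And>z. P t dvd M * z \<Longrightarrow> P s dvd z" "s \<le> t" "finite K" "K \<subseteq> {2..}"
      "\<And>x. x \<in> U \<Longrightarrow> [M * F x t = (\<Sum>k\<in>K. e k * ((x t)\<^sup>2) ^ k)] (mod P t)"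
      by (rule density [OF F, where s = s]) (rule that)
    have "\<forall>k\<in>K. \<exists>v. \<forall>\<^sub>F n in sequentially. J n (pw k) t = v"
      using conv MtKe(4) by auto
    from bchoice [OF this] obtain v where "\<forall>k\<in>K. \<forall>\<^sub>F n in sequentially. J n (pw k) t = v k"
      by blast
    then have "\<forall>\<^sub>F n in sequentially. \<forall>k\<in>K. J n (pw k) t = v k"
      using MtKe(3) by (simp add: eventually_ball_finite)
    then obtain n0 where n0: "\<And>n k. n \<ge> n0 \<Longrightarrow> k \<in> K \<Longrightarrow> J n (pw k) t = v k"
      by (auto simp: eventually_sequentially)
    have 1: "[M * J n F t = (\<Sum>k\<in>K. e k * v k)] (mod P t)" if "n \<ge> n0" for n
    proof -
      have "(\<Sum>k\<in>K. e k * J n (pw k) t) = (\<Sum>k\<in>K. e k * v k)"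
        using n0 [OF that] by (intro sum.cong) auto
      then show ?thesis
        using lin_density [OF J F MtKe(3,5), of n] by simp
    qed
    have "J n F s = J m F s" if "n \<ge> n0" "m \<ge> n0" for n m
    proof -
      have "[M * J n F t = M * J m F t] (mod P t)"
        using 1 that cong_trans cong_sym by blast
      then have "P s dvd J n F t - J m F t"
        using MtKe(1) [of "J n F t - J m F t"] by (simp add: cong_iff_dvd_diff right_diff_distrib)
      then have "J n F t mod P s = J m F t mod P s"
        by (simp add: mod_eq_dvd_iff)
      then show ?thesis
        using nth_mod_le [OF lin_closed [OF J F] MtKe(2)] by simp
    qed
    then show ?thesis unfolding eventually_const_iff by blast
  qed
  define L where "L F N = (SOME v. \<forall>\<^sub>F n in sequentially. J n F N = v)" for F N
  have L: "\<forall>\<^sub>F n in sequentially. J n F N = L F N" if "F \<in> UC" for F N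
    unfolding L_def using ex [OF that] by (rule someI_ex)
  have "lin L"
  proof (rule linI)
    fix F assume F: "F \<in> UC"
    show "L F \<in> Z"
    proof (rule padic_closedI)
      fix N
      have "\<forall>\<^sub>F n in sequentially. J n F N = L F N \<and> J n F (Suc N) = L F (Suc N)"
        using L [OF F] by (simp add: eventually_conj_iff)
      from eventually_happens' [OF sequentially_bot this]
      obtain n where "J n F N = L F N" "J n F (Suc N) = L F (Suc N)"
        by blast
      then show "0 \<le> L F N \<and> L F N < P N" "L F (Suc N) mod P N = L F N"
        using nth_range [OF lin_closed [OF J F, of n], of N]
          nth_mod_le [OF lin_closed [OF J F, of n], of N "Suc N"] by auto
    qed
    fix a assume a: "a \<in> Z"
    show "L (\<lambda>x. a \<^bold>* F x) = a \<^bold>* L F"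
    proof
      fix N
      have "\<forall>\<^sub>F n in sequentially. J n F N = L F N \<and> J n (\<lambda>x. a \<^bold>* F x) N = L (\<lambda>x. a \<^bold>* F x) N"
        using L [OF F] L [OF UC_smult [OF F a]] by (simp add: eventually_conj_iff)
      from eventually_happens' [OF sequentially_bot this]
      obtain n where n: "J n F N = L F N" "J n (\<lambda>x. a \<^bold>* F x) N = L (\<lambda>x. a \<^bold>* F x) N"
        by blast
      then show "L (\<lambda>x. a \<^bold>* F x) N = (a \<^bold>* L F) N"
        using lin_smult [OF J a F, of n] by (simp add: nth_mult)
    qed
  next
    fix F H assume FH: "F \<in> UC" "H \<in> UC"
    show "L (\<lambda>x. F x \<^bold>+ H x) = L F \<^bold>+ L H"
    proof
      fix N
      have "\<forall>\<^sub>F n in sequentially. J n F N = L F N \<and> J n H N = L H N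
          \<and> J n (\<lambda>x. F x \<^bold>+ H x) N = L (\<lambda>x. F x \<^bold>+ H x) N"
        using L [OF FH(1)] L [OF FH(2)] L [OF UC_add [OF FH]] by (simp add: eventually_conj_iff)
      from eventually_happens' [OF sequentially_bot this]
      obtain n where n: "J n F N = L F N" "J n H N = L H N"
          "J n (\<lambda>x. F x \<^bold>+ H x) N = L (\<lambda>x. F x \<^bold>+ H x) N"
        by blast
      then show "L (\<lambda>x. F x \<^bold>+ H x) N = (L F \<^bold>+ L H) N"
        using lin_add [OF J FH, of n] by (simp add: nth_add)
    qed
    assume "\<And>x. x \<in> U \<Longrightarrow> F x = H x"
    then have "J n F = J n H" for n
      using FH lin_cong [OF J] by blast
    then show "L F = L H"
      by (simp add: L_def fun_eq_iff)
  qed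
  then show ?thesis using L that by blast
qed

text \<open>The factors \<open>d k\<close> let the moments be prescribed as quotients; the divisors
  that occur are multiples of \<open>4k\<close> clearing a Bernoulli denominator, and
  \<open>1 - c^(2k)\<close>.\<close>

lemma measure_limit:
  assumes J: "\<And>n. lin (J n)"
    and d: "\<And>k. k \<ge> 1 \<Longrightarrow> d k \<in> Z" "\<And>k. k \<ge> 1 \<Longrightarrow> d k \<noteq> \<^bold>0"
    and conv: "\<And>k N. k \<ge> 1 \<Longrightarrow> \<forall>\<^sub>F n in sequentially. (d k \<^bold>* J n (pw k)) N = w k N"
  shows "\<exists>\<mu>\<in>padic_measures p. \<forall>k\<ge>1. d k \<^bold>* even_moment p \<mu> k = w k"
proof -
  have "\<exists>v. \<forall>\<^sub>F n in sequentially. J n (pw k) N = v" if "k \<ge> 2" for k N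
  proof (rule eventually_const_divide)
    show "d k \<in> Z" "d k \<noteq> \<^bold>0" using that d by auto
    show "\<exists>v. \<forall>\<^sub>F n in sequentially. (d k \<^bold>* J n (pw k)) N = v" for N
      using that conv [of k N] by auto
  qed (rule lin_closed [OF J UC_pw])
  from lin_limit [OF J this] obtain L
    where L: "lin L" "\<And>F N. F \<in> UC \<Longrightarrow> \<forall>\<^sub>F n in sequentially. J n F N = L F N"
    by blast
  have "d k \<^bold>* L (pw k) = w k" if "k \<ge> 1" for k
  proof
    fix N
    have "\<forall>\<^sub>F n in sequentially. J n (pw k) N = L (pw k) N \<and> (d k \<^bold>* J n (pw k)) N = w k N"
      using L(2) [OF UC_pw] conv [OF that] by (simp add: eventually_conj_iff)
    from eventually_happens' [OF sequentially_bot this]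
    obtain n where "J n (pw k) N = L (pw k) N" "(d k \<^bold>* J n (pw k)) N = w k N"
        by blast
    then show "(d k \<^bold>* L (pw k)) N = w k N"
      by (simp add: nth_mult)
  qed
  moreover obtain \<mu> where "\<mu> \<in> padic_measures p" "\<And>F. F \<in> UC \<Longrightarrow> \<mu> (descend p F) = L F"
    using measure_of_lin [OF L(1)] by blast
  ultimately show ?thesis
    using UC_pw by (intro bexI [of _ \<mu>]) (simp_all add: even_moment_eq)
qed

text \<open>Finite integer combinations of Dirac measures, the raw material of the constructions
  below.\<close>

lemma lin_point_sum:
  assumes r: "\<And>a. a \<in> A \<Longrightarrow> r a \<in> U"
  shows "lin (\<lambda>F N. (\<Sum>a\<in>A. w a * F (r a) N) mod P N)"
proof (rule linI)
  fix F assume F: "F \<in> UC"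
  show "(\<lambda>N. (\<Sum>a\<in>A. w a * F (r a) N) mod P N) \<in> Z"
  proof (rule padic_closedI)
    fix N
    have "(\<Sum>a\<in>A. w a * F (r a) (Suc N)) mod P N = (\<Sum>a\<in>A. w a * F (r a) (Suc N) mod P N) mod P N"
      by (simp add: mod_sum_eq)
    also have "\<dots> = (\<Sum>a\<in>A. w a * F (r a) N mod P N) mod P N"
    proof (rule arg_cong [where f = "\<lambda>x. x mod P N"], rule sum.cong [OF refl])
      fix a assume a: "a \<in> A"
      have "F (r a) (Suc N) mod P N = F (r a) N"
        using nth_mod_le [OF UC_closed [OF F r [OF a]], of N "Suc N"] by simp
      then show "w a * F (r a) (Suc N) mod P N = w a * F (r a) N mod P N"
        by (metis mod_mult_right_eq)
    qed
    finally show "(\<Sum>a\<in>A. w a * F (r a) (Suc N)) mod P (Suc N) mod P N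
        = (\<Sum>a\<in>A. w a * F (r a) N) mod P N"
      by (simp add: mod_sum_eq mod_mod_cancel)
  qed (simp add: pos_mod_bound [OF P_pos(1)] pos_mod_sign [OF P_pos(1)])
  fix a assume "a \<in> Z"
  show "(\<lambda>N. (\<Sum>i\<in>A. w i * (a \<^bold>* F (r i)) N) mod P N)
      = a \<^bold>* (\<lambda>N. (\<Sum>a\<in>A. w a * F (r a) N) mod P N)"
  proof
    fix N
    have "(\<Sum>i\<in>A. w i * (a \<^bold>* F (r i)) N) mod P N = (\<Sum>i\<in>A. w i * (a N * F (r i) N)) mod P N"
      by (subst (1 2) mod_sum_eq [symmetric]) (simp add: nth_mult mod_simps)
    also have "\<dots> = (a N * (\<Sum>i\<in>A. w i * F (r i) N)) mod P N"
      by (simp add: sum_distrib_left algebra_simps)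
    finally show "(\<Sum>i\<in>A. w i * (a \<^bold>* F (r i)) N) mod P N
        = (a \<^bold>* (\<lambda>N. (\<Sum>a\<in>A. w a * F (r a) N) mod P N)) N"
      by (simp add: nth_mult mod_simps)
  qed
next
  fix F H assume FH: "F \<in> UC" "H \<in> UC"
  show "(\<lambda>N. (\<Sum>a\<in>A. w a * (F (r a) \<^bold>+ H (r a)) N) mod P N)
    = (\<lambda>N. (\<Sum>a\<in>A. w a * F (r a) N) mod P N) \<^bold>+ (\<lambda>N. (\<Sum>a\<in>A. w a * H (r a) N) mod P N)"
  proof
    fix N
    have "(\<Sum>i\<in>A. w i * (F (r i) \<^bold>+ H (r i)) N) mod P N
        = (\<Sum>i\<in>A. w i * (F (r i) N + H (r i) N)) mod P N"
      by (subst (1 2) mod_sum_eq [symmetric]) (simp add: nth_add mod_simps)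
    also have "\<dots> = ((\<Sum>i\<in>A. w i * F (r i) N) + (\<Sum>i\<in>A. w i * H (r i) N)) mod P N"
      by (simp add: sum.distrib algebra_simps)
    finally show "(\<Sum>i\<in>A. w i * (F (r i) \<^bold>+ H (r i)) N) mod P N
        = ((\<lambda>N. (\<Sum>a\<in>A. w a * F (r a) N) mod P N) \<^bold>+ (\<lambda>N. (\<Sum>a\<in>A. w a * H (r a) N) mod P N)) N"
      by (simp add: nth_add mod_simps)
  qed
  assume "\<And>x. x \<in> U \<Longrightarrow> F x = H x"
  then show "(\<lambda>N. (\<Sum>a\<in>A. w a * F (r a) N) mod P N) = (\<lambda>N. (\<Sum>a\<in>A. w a * H (r a) N) mod P N)"
    using r by simp
qed

section \<open>Iterated integrals and convolution\<close>

lemma lin_compose: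
  assumes J: "lin J" and K: "\<And>x. x \<in> U \<Longrightarrow> lin (K x)"
    and KF: "\<And>F. F \<in> UC \<Longrightarrow> (\<lambda>x. K x F) \<in> UC"
  shows "lin (\<lambda>F. J (\<lambda>x. K x F))"
proof (rule linI)
  fix F assume F: "F \<in> UC"
  show "J (\<lambda>x. K x F) \<in> Z"
    using lin_closed [OF J KF [OF F]] .
  fix a assume a: "a \<in> Z"
  have "J (\<lambda>x. K x (\<lambda>y. a \<^bold>* F y)) = J (\<lambda>x. a \<^bold>* K x F)"
    by (intro lin_cong [OF J] KF UC_smult F a lin_smult K)
  then show "J (\<lambda>x. K x (\<lambda>y. a \<^bold>* F y)) = a \<^bold>* J (\<lambda>x. K x F)"
    using lin_smult [OF J a KF [OF F]] by simp
next
  fix F H assume FH: "F \<in> UC" "H \<in> UC"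
  have "J (\<lambda>x. K x (\<lambda>y. F y \<^bold>+ H y)) = J (\<lambda>x. K x F \<^bold>+ K x H)"
    by (intro lin_cong [OF J] KF UC_add FH lin_add K)
  then show "J (\<lambda>x. K x (\<lambda>y. F y \<^bold>+ H y)) = J (\<lambda>x. K x F) \<^bold>+ J (\<lambda>x. K x H)"
    using lin_add [OF J KF [OF FH(1)] KF [OF FH(2)]] by simp
  assume "\<And>x. x \<in> U \<Longrightarrow> F x = H x"
  then show "J (\<lambda>x. K x F) = J (\<lambda>x. K x H)"
    by (intro lin_cong [OF J] KF FH lin_cong [OF K])
qed

text \<open>A level for \<open>F\<close> serves all its translates at once, because the square of
  \<open>x * y\<close> modulo \<open>p^j\<close> only involves the squares of the factors;
  \<open>lin_level\<close> then carries the equality through \<open>J\<close>.\<close>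

lemma UC_convolution:
  assumes J: "lin J" and F: "F \<in> UC"
  shows "(\<lambda>x. J (\<lambda>y. F (x \<^bold>* y))) \<in> UC"
proof (rule UCI)
  show "J (\<lambda>y. F (x \<^bold>* y)) \<in> Z" if "x \<in> U" for x
    using that by (intro lin_closed [OF J] UC_translate F)
  fix n
  obtain j where j: "\<And>x y. x \<in> U \<Longrightarrow> y \<in> U \<Longrightarrow> sq x j = sq y j \<Longrightarrow> F x n = F y n"
    using UC_level [OF F] by blast
  have "J (\<lambda>y. F (x \<^bold>* y)) n = J (\<lambda>y. F (z \<^bold>* y)) n"
    if "x \<in> U" "z \<in> U" "sq x j = sq z j" for x z
    by (intro lin_level [OF J] UC_translate F j Zp.Units_m_closed) (use that in \<open>simp_all only: sq_mult\<close>)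
  then show "\<exists>j. \<forall>x\<in>U. \<forall>z\<in>U. sq x j = sq z j \<longrightarrow> J (\<lambda>y. F (x \<^bold>* y)) n = J (\<lambda>y. F (z \<^bold>* y)) n"
    by blast
qed

lemma pw_mult: "x \<in> Z \<Longrightarrow> y \<in> Z \<Longrightarrow> pw k (x \<^bold>* y) = pw k x \<^bold>* pw k y"
  by (simp add: pw_def Zp.nat_pow_distrib)

text \<open>Even powers are multiplicative, so their double integral splits into a product. The
  convolution on cosets is identified with the functional \<open>?L\<close> on representatives for
  every function in \<open>UC\<close>, and moments are a special case.\<close>

lemma convolution:
  assumes \<mu>: "\<mu> \<in> padic_measures p" and \<nu>: "\<nu> \<in> padic_measures p"
  shows "\<mu> \<otimes>\<^bsub>measure_ring p\<^esub> \<nu> \<in> padic_measures p" (is "?m \<in> _")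
    and "even_moment p (\<mu> \<otimes>\<^bsub>measure_ring p\<^esub> \<nu>) k = even_moment p \<mu> k \<^bold>* even_moment p \<nu> k"
proof -
  let ?I = "\<lambda>F. \<mu> (descend p F)" and ?J = "\<lambda>F. \<nu> (descend p F)"
  let ?L = "\<lambda>F. ?I (\<lambda>x. ?J (\<lambda>y. F (x \<^bold>* y)))"
  have I: "lin ?I" and J: "lin ?J" using \<mu> \<nu> lin_measure by auto
  have "lin (\<lambda>F. ?J (\<lambda>y. F (x \<^bold>* y)))" if "x \<in> U" for x
  proof (rule linI)
    fix F H assume "F \<in> UC" "H \<in> UC" "\<And>x. x \<in> U \<Longrightarrow> F x = H x"
    then show "?J (\<lambda>y. F (x \<^bold>* y)) = ?J (\<lambda>y. H (x \<^bold>* y))"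
      using that by (intro lin_cong [OF J] UC_translate) auto
  qed (use that in \<open>auto intro!: lin_closed [OF J] lin_add [OF J] lin_smult [OF J] UC_translate\<close>)
  then have L: "lin ?L"
    using J by (intro lin_compose [OF I] UC_convolution)
  have eq: "?m (descend p F) = ?L F" if F: "F \<in> UC" for F
  proof -
    have "(\<lambda>X\<in>carrier G. \<nu> (\<lambda>Y\<in>carrier G. descend p F (X \<otimes>\<^bsub>G\<^esub> Y)))
        = descend p (\<lambda>x. ?J (\<lambda>y. F (x \<^bold>* y)))"
    proof (rule extensionalityI [where A = "carrier G"])
      fix X assume "X \<in> carrier G"
      then obtain x where x: "x \<in> U" "X = pm x" by (auto simp: carrier_G)
      have "(\<lambda>Y\<in>carrier G. descend p F (pm x \<otimes>\<^bsub>G\<^esub> Y)) = descend p (\<lambda>y. F (x \<^bold>* y))"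
      proof (rule extensionalityI [where A = "carrier G"])
        fix Y assume "Y \<in> carrier G"
        then obtain y where "y \<in> U" "Y = pm y" by (auto simp: carrier_G)
        then show "(\<lambda>Y\<in>carrier G. descend p F (pm x \<otimes>\<^bsub>G\<^esub> Y)) Y = descend p (\<lambda>y. F (x \<^bold>* y)) Y"
          using x F by (simp add: pm_mult descend_pm UC_translate)
      qed (simp_all add: descend_def)
      then show "(\<lambda>X\<in>carrier G. \<nu> (\<lambda>Y\<in>carrier G. descend p F (X \<otimes>\<^bsub>G\<^esub> Y))) X
          = descend p (\<lambda>x. ?J (\<lambda>y. F (x \<^bold>* y))) X"
        using x descend_pm [OF UC_convolution [OF J F]] by simp
    qed (simp_all add: descend_def)
    then show ?thesis
      using descend_cont [OF F] by (simp add: measure_ring_def)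
  qed
  obtain m where m: "m \<in> padic_measures p" "\<And>F. F \<in> UC \<Longrightarrow> m (descend p F) = ?L F"
    using measure_of_lin [OF L] by blast
  have "?m = m"
  proof (rule measure_extI [OF _ measure_extensional [OF m(1)]])
    show "?m \<in> extensional (cont_funs p)" by (simp add: measure_ring_def)
  qed (use m eq in simp)
  then show "?m \<in> padic_measures p" using m by simp
  have "?J (\<lambda>y. pw k (x \<^bold>* y)) = even_moment p \<nu> k \<^bold>* pw k x" if x: "x \<in> U" for x
  proof -
    have "?J (\<lambda>y. pw k (x \<^bold>* y)) = ?J (\<lambda>y. pw k x \<^bold>* pw k y)"
      using x UC_closed [OF UC_pw x]
      by (intro lin_cong [OF J] UC_translate UC_smult UC_pw) (auto simp: pw_mult)
    also have "\<dots> = pw k x \<^bold>* ?J (pw k)"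
      by (rule lin_smult [OF J UC_closed [OF UC_pw x] UC_pw])
    finally show ?thesis
      using \<nu> UC_closed [OF UC_pw x] by (simp add: Zp.m_comm even_moment_eq [symmetric])
  qed
  then have "?L (pw k) = ?I (\<lambda>x. even_moment p \<nu> k \<^bold>* pw k x)"
    using \<nu> by (intro lin_cong [OF I] UC_convolution [OF J] UC_smult UC_pw) auto
  also have "\<dots> = even_moment p \<nu> k \<^bold>* even_moment p \<mu> k"
    using \<nu> by (simp add: lin_smult [OF I _ UC_pw] even_moment_eq [of \<mu>])
  finally show "even_moment p ?m k = even_moment p \<mu> k \<^bold>* even_moment p \<nu> k"
    using eq [OF UC_pw] \<mu> \<nu> by (simp add: even_moment_eq [of ?m] Zp.m_comm)
qed

section \<open>Measures of total mass zero\<close>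

lemma pw_level: "x \<in> Z \<Longrightarrow> y \<in> Z \<Longrightarrow> sq x j = sq y j \<Longrightarrow> pw k x j = pw k y j"
  by (metis nth_pw power_mod)

text \<open>Nonnegative exponents reach the whole subgroup: at level \<open>j\<close> some power
  \<open>c^H\<close> is 1, so the inverse of \<open>c\<close> agrees with
  \<open>c^(H-1)\<close>.\<close>

lemma generate_level:
  assumes c: "c \<in> U" and g: "g \<in> generate G {pm c}"
  shows "\<exists>i. \<exists>y\<in>U. g = pm y \<and> sq y j = sq (c \<^bold>^ i) j"
  using g
proof (induction g)
  case one
  show ?case
    by (intro exI [of _ 0] bexI [of _ "\<^bold>1"]) (simp_all add: pm_1)
next
  case (incl h)
  then show ?case
    using c by (intro exI [of _ 1] bexI [of _ c]) simp_all
next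
  case (inv h)
  obtain H where H: "H \<ge> 2" "\<And>x. coprime x (int p) \<Longrightarrow> (x ^ H) mod P j = 1 mod P j"
    using euler_power by blast
  have "(c \<^bold>^ H) j = \<^bold>1 j"
  proof (cases "j = 0")
    case False
    then have "coprime (c j) (int p)" using Units_coprime [OF c, of j 1] by simp
    then show ?thesis using H c by (simp add: nth_pow nth_one)
  qed (use c in simp)
  moreover have "c \<^bold>^ (H - 1) = c \<^bold>^ H \<^bold>* inv\<^bsub>padic_ring p\<^esub> c"
  proof -
    have "c \<^bold>^ H = c \<^bold>^ (H - 1) \<^bold>* c"
      using H(1) by (cases H) simp_all
    then show ?thesis using c by (simp add: Zp.m_assoc Zp.Units_r_inv)
  qed
  ultimately have "(c \<^bold>^ (H - 1)) j = (\<^bold>1 \<^bold>* inv\<^bsub>padic_ring p\<^esub> c) j"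
    by (simp only: nth_mult)
  then have "(c \<^bold>^ (H - 1)) j = (inv\<^bsub>padic_ring p\<^esub> c) j"
    using c by simp
  then show ?case
    using inv c by (intro exI [of _ "H - 1"] bexI [of _ "inv\<^bsub>padic_ring p\<^esub> c"]) (simp_all add: pm_inv)
next
  case (eng g h)
  then obtain i x k y where "x \<in> U" "g = pm x" "sq x j = sq (c \<^bold>^ i) j"
    "y \<in> U" "h = pm y" "sq y j = sq (c \<^bold>^ k) j" by blast
  then show ?case
    using c by (intro exI [of _ "i + k"] bexI [of _ "x \<^bold>* y"])
      (simp_all add: pm_mult Zp.Units_m_closed Zp.nat_pow_mult [symmetric] sq_mult del: Zp.nat_pow_mult)
qed

lemma top_generator_Units: "top_generator p c \<Longrightarrow> c \<in> U"
  by (simp add: top_generator_def)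

text \<open>The cosets with a prescribed square modulo \<open>p^j\<close> form an open set around
  \<open>pm x\<close>, which the dense subgroup generated by \<open>c\<close> must meet.\<close>

lemma top_generator_level:
  assumes c: "top_generator p c" and x: "x \<in> U"
  shows "\<exists>i. sq (c \<^bold>^ i) j = sq x j"
proof -
  let ?V = "{X \<in> carrier G. \<exists>y\<in>U. X = pm y \<and> sq y j = sq x j}"
  have *: "(\<exists>z\<in>U. pm y = pm z \<and> sq z j = sq x j) \<longleftrightarrow> sq y j = sq x j" if "y \<in> U" for y
  proof
    assume "\<exists>z\<in>U. pm y = pm z \<and> sq z j = sq x j"
    then obtain z where z: "z \<in> U" "pm y = pm z" "sq z j = sq x j" by blast
    then have "z = y \<or> z = neg y"
      using that by (auto simp: pm_eq doubleton_eq_iff)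
    then show "sq y j = sq x j"
      using z that sq_neg [of y] by auto
  qed (use that in blast)
  have "\<Union>?V = {y \<in> U. sq y j = sq x j}"
    by (rule Union_pm) (use * in \<open>auto simp: sq_neg\<close>)
  moreover have "openin (top_of_set U) {y \<in> U. sq y j = sq x j}"
    by (rule openin_units [where j = j]) auto
  ultimately have "openin (units_mod_pm_topology p) ?V"
    by (simp add: openin_G)
  moreover have "pm x \<in> ?V" using x by auto
  moreover have "pm x \<in> units_mod_pm_topology p closure_of generate G {pm c}"
    using c x by (simp add: top_generator_def pm_def [symmetric] topspace_G)
  ultimately have "\<exists>g. g \<in> generate G {pm c} \<and> g \<in> ?V"
    unfolding in_closure_of by meson
  then obtain g where g: "g \<in> generate G {pm c}" "g \<in> ?V"
    by (elim exE conjE)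
  obtain i y where y: "y \<in> U" "g = pm y" "sq y j = sq (c \<^bold>^ i) j"
    using generate_level [OF top_generator_Units [OF c] g(1)] by blast
  moreover have "sq y j = sq x j"
    using g(2) * [OF y(1)] y(2) by simp
  ultimately have "sq (c \<^bold>^ i) j = sq x j" by simp
  then show ?thesis by (rule exI)
qed

lemma pw_pow: "c \<in> Z \<Longrightarrow> pw k (c \<^bold>^ i) = (c \<^bold>^ (2 * k)) \<^bold>^ i"
  by (simp add: pw_def Zp.nat_pow_pow mult.commute)

text \<open>If \<open>c^(2k)\<close> were 1, density would give \<open>x^(2k) = 1\<close> for all
  units, but the integer \<open>(1 + p)^(2k)\<close> exceeds 1.\<close>

lemma top_generator_not_torsion:
  assumes c: "top_generator p c" and k: "k \<ge> 1"
  shows "c \<^bold>^ (2 * k) \<noteq> \<^bold>1"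
proof
  assume tors: "c \<^bold>^ (2 * k) = \<^bold>1"
  let ?x = "\<iota> (1 + int p)"
  have x: "?x \<in> U"
    using prime_gt_1_nat [OF prime_p] by (intro emb_Units) simp
  have "pw k ?x j = \<^bold>1 j" for j
  proof -
    obtain i where "sq (c \<^bold>^ i) j = sq ?x j"
      using top_generator_level [OF c x] by blast
    then have "pw k ?x j = pw k (c \<^bold>^ i) j"
      using top_generator_Units [OF c] by (intro pw_level) auto
    then show ?thesis
      using tors top_generator_Units [OF c] by (simp add: pw_pow)
  qed
  then have "(1 + int p) ^ (2 * k) mod P j = 1 mod P j" for j
    unfolding nth_pw [OF emb_closed] nth_emb nth_one power_mult [symmetric] power_mod .
  then have "\<iota> ((1 + int p) ^ (2 * k) - 1) = \<^bold>0"
    by (auto simp: fun_eq_iff nth_emb nth_zero mod_eq_dvd_iff)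
  then have "(1 + int p) ^ (2 * k) = 1"
    by (simp add: emb_eq_0_iff)
  moreover have "(1 + int p) ^ (2 * k) > 1"
    using k p_pos by (intro one_less_power) auto
  ultimately show False by simp
qed

text \<open>
  The operator \<open>F \<mapsto> F - F(c \<cdot>)\<close> is inverted on locally constant functions by summing along the
  powers of \<open>c\<close>. On \<open>x\<^sup>2\<^sup>k\<close> this sum is geometric, so that the approximations converge.
\<close>

lemma augmentation_principal:
  assumes c: "top_generator p c" and \<nu>: "\<nu> \<in> padic_measures p" and 0: "even_moment p \<nu> 0 = \<^bold>0"
  shows "\<exists>\<rho>\<in>padic_measures p. \<forall>k. (\<^bold>1 \<^bold>- c \<^bold>^ (2 * k)) \<^bold>* even_moment p \<rho> k = even_moment p \<nu> k"
proof -
  let ?I = "\<lambda>F. \<nu> (descend p F)"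
  have I: "lin ?I" using \<nu> by (rule lin_measure)
  have cU: "c \<in> U" using c by (rule top_generator_Units)
  then have cZ: "c \<in> Z" by simp
  \<comment> \<open>The least exponent depends on \<open>x\<close> only through its square modulo
    \<open>p^j\<close>, which places \<open>T j\<close> in \<open>UC\<close> with level
    \<open>j\<close>.\<close>
  define i where "i j x = (LEAST i. sq (c \<^bold>^ i) j = sq x j)" for j x
  have i: "sq (c \<^bold>^ i j x) j = sq x j" if "x \<in> U" for j x
    unfolding i_def using top_generator_level [OF c that] by (rule LeastI_ex)
  \<comment> \<open>Solution of \<open>G(x) - G(c x) = F(x)\<close> along the powers of
    \<open>c\<close> with \<open>G(1) = 0\<close>: passing from \<open>c^t\<close> to
    \<open>c^(t+1)\<close> subtracts \<open>F(c^t)\<close>.\<close>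
  define T where "T j x F N = (\<Sum>t\<in>{..<i j x}. - 1 * F (c \<^bold>^ t) N) mod P N" for j x F N
  have T: "lin (T j x)" for j x
    unfolding T_def [abs_def] using cU by (intro lin_point_sum Zp.Units_pow_closed)
  have TUC: "(\<lambda>x. T j x F) \<in> UC" if "F \<in> UC" for j F
  proof (rule UCI)
    show "T j x F \<in> Z" for x using lin_closed [OF T that] .
    show "\<exists>l. \<forall>x\<in>U. \<forall>y\<in>U. sq x l = sq y l \<longrightarrow> T j x F n = T j y F n" for n
      by (rule exI [of _ j]) (simp add: T_def i_def)
  qed
  let ?d = "\<lambda>k. \<^bold>1 \<^bold>- c \<^bold>^ (2 * k)"
  have "\<exists>\<rho>\<in>padic_measures p. \<forall>k\<ge>1. ?d k \<^bold>* even_moment p \<rho> k = even_moment p \<nu> k"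
  proof (rule measure_limit [where J = "\<lambda>j F. ?I (\<lambda>x. T j x F)"])
    show "lin (\<lambda>F. ?I (\<lambda>x. T j x F))" for j
      by (rule lin_compose [OF I T TUC])
    fix k :: nat assume k: "k \<ge> 1"
    show dZ: "?d k \<in> Z" using cZ by simp
    show "?d k \<noteq> \<^bold>0"
      using top_generator_not_torsion [OF c k] cZ by simp
    fix N
    have "(?d k \<^bold>* ?I (\<lambda>x. T j x (pw k))) N = even_moment p \<nu> k N" if "N \<le> j" for j
    proof -
      \<comment> \<open>The geometric sum telescopes to \<open>x^(2k) - 1\<close>. The constant,
        written as \<open>\<iota> (- 1)\<close> times \<open>pw 0\<close>, integrates to minus the
        total mass, which is zero by assumption.\<close>
      have "(?d k \<^bold>* T j x (pw k)) N = (pw k x \<^bold>+ \<iota> (- 1) \<^bold>* pw 0 x) N" if x: "x \<in> U" for x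
      proof -
        define \<gamma> where "\<gamma> = (c \<^bold>^ (2 * k)) N"
        have pwt: "pw k (c \<^bold>^ t) N = \<gamma> ^ t mod P N" for t
          using cZ by (simp add: pw_pow nth_pow \<gamma>_def power_mod)
        have "T j x (pw k) N = (- (\<Sum>t<i j x. \<gamma> ^ t)) mod P N"
          unfolding T_def by (subst mod_sum_eq [symmetric])
            (simp add: pwt mod_simps sum_negf mod_sum_eq)
        then have "(?d k \<^bold>* T j x (pw k)) N = ((1 - \<gamma>) * (- (\<Sum>t<i j x. \<gamma> ^ t))) mod P N"
          using cZ by (simp only: nth_mult nth_diff nth_one Zp.one_closed Zp.nat_pow_closed
              \<gamma>_def [symmetric] mod_simps)
        also have "(1 - \<gamma>) * (- (\<Sum>t<i j x. \<gamma> ^ t)) = \<gamma> ^ i j x - 1"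
          using one_diff_power_eq [of \<gamma> "i j x"] by simp
        also have "(\<gamma> ^ i j x - 1) mod P N = (pw k (c \<^bold>^ i j x) N - 1) mod P N"
          by (simp add: pwt mod_simps)
        also have "pw k (c \<^bold>^ i j x) N = pw k x N"
        proof (rule pw_level)
          show "sq (c \<^bold>^ i j x) N = sq x N"
            by (rule sq_mod_le [OF _ _ \<open>N \<le> j\<close>]) (use x cZ i [OF x] in auto)
        qed (use x cZ in auto)
        finally have "(?d k \<^bold>* T j x (pw k)) N = (pw k x N - 1) mod P N" .
        moreover have "pw 0 x N = 1 mod P N" by (simp add: pw_def nth_one)
        then have "(pw k x \<^bold>+ \<iota> (- 1) \<^bold>* pw 0 x) N = (pw k x N - 1) mod P N"
          by (simp add: nth_add nth_mult nth_emb mod_simps)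
        ultimately show ?thesis by simp
      qed
      then have "?I (\<lambda>x. ?d k \<^bold>* T j x (pw k)) N = ?I (\<lambda>x. pw k x \<^bold>+ \<iota> (- 1) \<^bold>* pw 0 x) N"
        by (intro lin_level [OF I] UC_smult UC_add UC_pw TUC dZ emb_closed)
      also have "?I (\<lambda>x. pw k x \<^bold>+ \<iota> (- 1) \<^bold>* pw 0 x) = even_moment p \<nu> k \<^bold>+ \<iota> (- 1) \<^bold>* even_moment p \<nu> 0"
        unfolding lin_add [OF I UC_pw UC_smult [OF UC_pw emb_closed]]
          lin_smult [OF I emb_closed UC_pw] even_moment_eq ..
      also have "\<dots> = even_moment p \<nu> k" using \<nu> by (simp add: 0)
      finally show ?thesis
        by (simp only: lin_smult [OF I dZ TUC [OF UC_pw]])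
    qed
    then show "\<forall>\<^sub>F j in sequentially. (?d k \<^bold>* ?I (\<lambda>x. T j x (pw k))) N = even_moment p \<nu> k N"
      unfolding eventually_sequentially by blast
  qed
  then obtain \<rho> where \<rho>: "\<rho> \<in> padic_measures p"
    "\<And>k. k \<ge> 1 \<Longrightarrow> ?d k \<^bold>* even_moment p \<rho> k = even_moment p \<nu> k" by blast
  have "?d k \<^bold>* even_moment p \<rho> k = even_moment p \<nu> k" for k
  proof (cases "k = 0")
    \<comment> \<open>At \<open>k = 0\<close> both \<open>1 - c^0\<close> and the mass of
      \<open>\<nu>\<close> vanish.\<close>
    case True
    then show ?thesis using 0 \<rho>(1) by (simp add: Zp.minus_eq Zp.r_neg)
  qed (use \<rho> in simp)
  then show ?thesis using \<rho>(1) by blast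
qed

text \<open>The measure \<open>[1] - [c]\<close>. Booleans index the two points, so that the sum
  stays correct when \<open>c = 1\<close>.\<close>

lemma dirac_difference:
  assumes c: "c \<in> U"
  shows "\<exists>\<mu>\<in>padic_measures p. \<forall>k. even_moment p \<mu> k = \<^bold>1 \<^bold>- c \<^bold>^ (2 * k)"
proof -
  let ?J = "\<lambda>F N. (\<Sum>b\<in>{True, False}. (if b then 1 else - 1) * F (if b then \<^bold>1 else c) N) mod P N"
  have "lin ?J" using c by (intro lin_point_sum) auto
  then obtain \<mu> where "\<mu> \<in> padic_measures p" "\<And>F. F \<in> UC \<Longrightarrow> \<mu> (descend p F) = ?J F"
    using measure_of_lin by blast
  moreover have "?J (pw k) = \<^bold>1 \<^bold>- c \<^bold>^ (2 * k)" for k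
    using c by (simp add: fun_eq_iff pw_def nth_diff)
  ultimately show ?thesis
    using UC_pw by (intro bexI [of _ \<mu>]) (simp_all add: even_moment_eq)
qed

end

section \<open>Bernoulli numbers\<close>

definition bernoulli_gf :: "rat fps" where
  "bernoulli_gf = Abs_fps (\<lambda>k. bernoulli k / fact k)"

lemma bernoulli_gf_eq: "bernoulli_gf * (fps_exp 1 - 1) = fps_X"
  unfolding bernoulli_gf_def by (rule Defs.bernoulli_fps)

lemma bernoulli_gf_nth: "fps_nth bernoulli_gf k = bernoulli k / fact k"
  by (simp add: bernoulli_gf_def)

text \<open>Faulhaber's formula. The sum of the \<open>e^(at)\<close> is
  \<open>(e^(Mt) - 1)/(e^t - 1)\<close>, the product of the Bernoulli generating function with
  \<open>E = (e^(Mt) - 1)/t\<close>; compare coefficients of \<open>t^m\<close>.\<close>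

lemma sum_powers_bernoulli:
  "(\<Sum>a<M. (of_nat a :: rat) ^ m)
    = (\<Sum>j\<le>m. fact m * bernoulli j / (fact j * fact (Suc (m - j))) * of_nat M ^ Suc (m - j))"
proof -
  define E :: "rat fps" where "E = Abs_fps (\<lambda>i. of_nat M ^ Suc i / fact (Suc i))"
  have E: "fps_X * E = fps_exp (of_nat M) - 1"
  proof (rule fps_ext)
    fix n show "fps_nth (fps_X * E) n = fps_nth (fps_exp (of_nat M) - 1) n"
      by (cases n) (simp_all add: E_def ring_distribs)
  qed
  have "(\<Sum>a<M. fps_exp (of_nat a)) * (fps_exp 1 - 1) = fps_exp (of_nat M) - (1 :: rat fps)"
  proof (induction M)
    case (Suc M)
    have "fps_exp (1 + of_nat M) = fps_exp 1 * fps_exp (of_nat M :: rat)"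
      by (rule fps_exp_add_mult)
    then show ?case using Suc by (simp add: algebra_simps)
  qed simp
  also have "\<dots> = bernoulli_gf * E * (fps_exp 1 - 1)"
    unfolding E [symmetric] bernoulli_gf_eq [symmetric] by (simp only: mult_ac)
  finally have "(\<Sum>a<M. fps_exp (of_nat a)) = bernoulli_gf * E"
  proof (rule mult_right_cancel [THEN iffD1, rotated])
    show "fps_exp 1 - 1 \<noteq> (0 :: rat fps)"
      by (auto simp: fps_eq_iff intro!: exI [of _ 1])
  qed
  then have "fps_nth (\<Sum>a<M. fps_exp (of_nat a :: rat)) m = fps_nth (bernoulli_gf * E) m"
    by simp
  then have "(\<Sum>a<M. of_nat a ^ m / fact m)
      = (\<Sum>j\<le>m. bernoulli j / fact j * (of_nat M ^ Suc (m - j) / fact (Suc (m - j))))"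
    by (simp add: fps_sum_nth fps_mult_nth E_def bernoulli_gf_nth atMost_atLeast0)
  then have "fact m * (\<Sum>a<M. of_nat a ^ m / fact m)
      = fact m * (\<Sum>j\<le>m. bernoulli j / fact j * (of_nat M ^ Suc (m - j) / fact (Suc (m - j))))"
    by (rule arg_cong)
  then show ?thesis
    unfolding sum_distrib_left by (simp add: mult_ac)
qed

lemma common_denominator:
  fixes f :: "'a \<Rightarrow> rat"
  assumes "finite A"
  shows "\<exists>D::int. D > 0 \<and> (\<forall>x\<in>A. of_int D * f x \<in> \<int>)"
  using assms
proof (induction A)
  case (insert x A)
  then obtain D :: int where D: "D > 0" "\<And>y. y \<in> A \<Longrightarrow> of_int D * f y \<in> \<int>" by blast
  obtain a b where ab: "quotient_of (f x) = (a, b)" by fastforce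
  then have "b > 0" "f x = of_int a / of_int b"
    using quotient_of_denom_pos quotient_of_div by blast+
  then have "of_int (D * b) * f x = of_int (D * a)" by simp
  moreover have "of_int (D * b) * f y = of_int b * (of_int D * f y)" for y
    by simp
  ultimately have "of_int (D * b) * f y \<in> \<int>" if "y \<in> insert x A" for y
    using that D(2) by (metis Ints_mult Ints_of_int insertE)
  then show ?case
    using D(1) \<open>b > 0\<close> by (intro exI [of _ "D * b"]) auto
qed (auto intro: exI [of _ 1])

text \<open>In Faulhaber's formula every term except that of \<open>j = m\<close> has a factor
  \<open>M^2\<close>, and the coefficients do not depend on \<open>M\<close>, so one
  \<open>D\<close> clears them for all \<open>M\<close>. With \<open>M = p^n\<close> this makes
  \<open>B_m\<close> the p-adic limit of the power sums divided by \<open>p^n\<close>.\<close>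

lemma sum_powers_quadratic_error:
  "\<exists>D::int. D > 0 \<and> (\<forall>M. \<exists>Y::int.
     of_int D * ((\<Sum>a<M. (of_nat a :: rat) ^ m) - of_nat M * bernoulli m) = of_nat M ^ 2 * of_int Y)"
proof -
  define c where "c j = fact m * bernoulli j / (fact j * fact (Suc (m - j)))" for j
  obtain D :: int where D: "D > 0" "\<And>j. j \<in> {..<m} \<Longrightarrow> of_int D * c j \<in> \<int>"
    using common_denominator [of "{..<m}" c] by blast
  have "\<exists>Y::int. of_int D * ((\<Sum>a<M. (of_nat a :: rat) ^ m) - of_nat M * bernoulli m)
      = of_nat M ^ 2 * of_int Y" for M
  proof -
    have "(\<Sum>a<M. (of_nat a :: rat) ^ m) = (\<Sum>j<m. c j * of_nat M ^ Suc (m - j)) + of_nat M * bernoulli m"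
      unfolding sum_powers_bernoulli lessThan_Suc_atMost [symmetric] by (simp add: c_def)
    then have "of_int D * ((\<Sum>a<M. (of_nat a :: rat) ^ m) - of_nat M * bernoulli m)
        = (\<Sum>j<m. of_int D * (c j * of_nat M ^ Suc (m - j)))"
      by (simp add: sum_distrib_left)
    also have "\<dots> = (\<Sum>j<m. of_nat M ^ 2 * (of_int D * c j * of_nat M ^ (m - j - 1)))"
    proof (rule sum.cong [OF refl])
      fix j assume "j \<in> {..<m}"
      then have "Suc (m - j) = 2 + (m - j - 1)" by simp
      then have "(of_nat M :: rat) ^ Suc (m - j) = of_nat M ^ 2 * of_nat M ^ (m - j - 1)"
        by (metis power_add)
      then show "of_int D * (c j * of_nat M ^ Suc (m - j))
          = of_nat M ^ 2 * (of_int D * c j * of_nat M ^ (m - j - 1))"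
        by (simp only: mult_ac)
    qed
    also have "\<dots> = of_nat M ^ 2 * (\<Sum>j<m. of_int D * c j * of_nat M ^ (m - j - 1))"
      by (simp add: sum_distrib_left)
    finally have *: "of_int D * ((\<Sum>a<M. (of_nat a :: rat) ^ m) - of_nat M * bernoulli m)
        = of_nat M ^ 2 * (\<Sum>j<m. of_int D * c j * of_nat M ^ (m - j - 1))" .
    have "(\<Sum>j<m. of_int D * c j * of_nat M ^ (m - j - 1)) \<in> \<int>"
      by (intro Ints_sum Ints_mult D(2) Ints_power) auto
    then obtain Y where "(\<Sum>j<m. of_int D * c j * of_nat M ^ (m - j - 1)) = of_int Y"
      by (auto elim: Ints_cases)
    with * show ?thesis by auto
  qed
  then show ?thesis using D(1) by blast
qed

text \<open>Faulhaber's formula for \<open>M = 1\<close>, where the power sum is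
  \<open>0^m = 0\<close>.\<close>

lemma bernoulli_recurrence:
  assumes "m \<ge> 1"
  shows "of_nat (Suc m) * bernoulli m = - (\<Sum>j<m. of_nat (Suc m choose j) * bernoulli j)"
proof -
  have "(0 :: rat) = (\<Sum>a<1. of_nat a ^ m)" using assms by simp
  also have "\<dots> = (\<Sum>j\<le>m. fact m * bernoulli j / (fact j * fact (Suc (m - j))))"
    unfolding sum_powers_bernoulli by simp
  finally have "0 = of_nat (Suc m) * (\<Sum>j\<le>m. fact m * bernoulli j / (fact j * fact (Suc (m - j))))"
    by simp
  also have "\<dots> = (\<Sum>j\<le>m. of_nat (Suc m choose j) * bernoulli j)"
    unfolding sum_distrib_left
  proof (rule sum.cong [OF refl])
    fix j assume "j \<in> {..m}"
    then have "Suc m - j = Suc (m - j)" "j \<le> Suc m" by auto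
    then have "(of_nat (Suc m choose j) :: rat) = fact (Suc m) / (fact j * fact (Suc (m - j)))"
      using binomial_fact [of j "Suc m", where ?'a = rat] by simp
    then show "of_nat (Suc m) * (fact m * bernoulli j / (fact j * fact (Suc (m - j))))
        = of_nat (Suc m choose j) * bernoulli j"
      by (simp only: fact_Suc) simp
  qed
  also have "\<dots> = (\<Sum>j<m. of_nat (Suc m choose j) * bernoulli j) + of_nat (Suc m) * bernoulli m"
    by (simp add: lessThan_Suc_atMost [symmetric])
  finally show ?thesis by linarith
qed

lemma bernoulli_0: "bernoulli 0 = 1"
proof -
  have "fps_nth (bernoulli_gf * (fps_exp 1 - 1)) 1 = 1"
    unfolding bernoulli_gf_eq by simp
  then show ?thesis by (simp add: fps_mult_nth bernoulli_gf_nth)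
qed

lemma bernoulli_1: "bernoulli 1 = - 1 / 2"
  using bernoulli_recurrence [of 1] by (simp add: bernoulli_0)

lemma bernoulli_2: "bernoulli 2 = 1 / 6"
  using bernoulli_recurrence [of 2] bernoulli_1
  by (simp add: bernoulli_0 numeral_2_eq_2 binomial_eq_0 field_simps)

text \<open>
  \<open>g = t / (e\<^sup>t - 1) + t / 2\<close> is \<open>(t / 2) coth (t / 2)\<close>; the Riccati equation of \<open>coth\<close> becomes
  \<open>t g' = g - g\<^sup>2 + t\<^sup>2 / 4\<close>, from which the signs of the coefficients can be read off.
\<close>

lemma bernoulli_even_nonzero:
  assumes "k \<ge> 1"
  shows "bernoulli (2 * k) \<noteq> 0"
proof -
  let ?f = bernoulli_gf
  let ?e = "fps_exp 1 :: rat fps"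
  let ?h = "fps_const (1 / 2) :: rat fps"
  define g where "g = ?f + ?h * fps_X"
  have f: "?f * ?e = fps_X + ?f"
    using bernoulli_gf_eq by (simp add: algebra_simps)
  \<comment> \<open>Differentiating \<open>f e^t = t + f\<close> and multiplying by \<open>f\<close>
    eliminates the exponential.\<close>
  have "fps_deriv (?f * ?e) = fps_deriv (fps_X + ?f)"
    by (simp only: f)
  then have "fps_deriv ?f * ?e + ?f * ?e = 1 + fps_deriv ?f"
    by (simp add: add.commute mult.commute)
  then have "?f * (fps_deriv ?f * ?e + ?f * ?e) = ?f * (1 + fps_deriv ?f)"
    by simp
  then have "fps_deriv ?f * (?f * ?e) + ?f * (?f * ?e) = ?f + ?f * fps_deriv ?f"
    by (simp add: algebra_simps)
  then have f': "fps_X * fps_deriv ?f = ?f - fps_X * ?f - ?f * ?f"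
    unfolding f by (simp add: algebra_simps)
  have half: "?h * ?h = fps_const (1 / 4)" "?h + ?h = 1"
    by (simp_all add: fps_const_mult [symmetric] del: fps_const_mult) (simp_all add: fps_const_add [symmetric])
  have g': "fps_X * fps_deriv g = g - g * g + fps_const (1 / 4) * (fps_X * fps_X)"
  proof -
    have "fps_X * fps_deriv g = fps_X * fps_deriv ?f + ?h * fps_X"
      by (simp add: g_def algebra_simps)
    moreover have "g * g = ?f * ?f + (?h + ?h) * (fps_X * ?f) + (?h * ?h) * (fps_X * fps_X)"
      by (simp only: g_def ring_distribs mult_ac add_ac)
    moreover have "g = ?f + ?h * fps_X" "?h * fps_X + ?h * fps_X = fps_X"
      using half(2) by (simp_all add: g_def flip: distrib_right)
    ultimately show ?thesis
      unfolding f' half by (simp add: algebra_simps)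
  qed
  define b where "b n = fps_nth g n" for n
  have rec: "of_nat n * b n = b n - (\<Sum>i\<le>n. b i * b (n - i)) + (if n = 2 then 1 / 4 else 0)" for n
  proof -
    have "fps_nth (fps_X * fps_deriv g) n = of_nat n * b n"
      by (cases n) (simp_all add: b_def)
    moreover have "fps_nth (fps_X * fps_deriv g) n
        = fps_nth g n - fps_nth (g * g) n + fps_nth (fps_const (1 / 4) * (fps_X * fps_X)) n"
      unfolding g' by (simp only: fps_add_nth fps_sub_nth)
    moreover have "fps_nth (fps_const (1 / 4) * (fps_X * fps_X) :: rat fps) n = (if n = 2 then 1 / 4 else 0)"
      by (simp add: power2_eq_square [symmetric] fps_X_power_nth)
    moreover have "fps_nth (g * g) n = (\<Sum>i\<le>n. b i * b (n - i))"
      by (simp only: fps_mult_nth b_def atMost_atLeast0)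
    ultimately show ?thesis by (simp add: b_def)
  qed
  have b0: "b 0 = 1"
    by (simp add: b_def g_def bernoulli_gf_nth bernoulli_0)
  have b1: "b 1 = 0"
    using bernoulli_1 by (simp add: b_def g_def bernoulli_gf_nth)
  have b2: "b 2 = 1 / 12"
    using bernoulli_2 by (simp add: b_def g_def bernoulli_gf_nth)
  \<comment> \<open>From \<open>n = 3\<close> on the inhomogeneous term is gone; the two end terms
    of the convolution equal \<open>b n\<close> each and move to the left.\<close>
  have rec': "of_nat (n + 1) * b n = - (\<Sum>i\<in>{1..<n}. b i * b (n - i))" if "n \<ge> 3" for n
  proof -
    have "{..n} = insert 0 (insert n {1..<n})" using that by auto
    then have "(\<Sum>i\<le>n. b i * b (n - i)) = 2 * b n + (\<Sum>i\<in>{1..<n}. b i * b (n - i))"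
      using that b0 by simp
    then show ?thesis using rec [of n] that by (simp add: algebra_simps)
  qed
  \<comment> \<open>The sign of \<open>b (2k)\<close> is \<open>(-1)^(k+1)\<close>: each product
    \<open>b (2l) * b (2(k-l))\<close> has sign \<open>(-1)^k\<close>, so nothing cancels in the
    sum.\<close>
  have "(odd n \<longrightarrow> b n = 0) \<and> (\<forall>k\<ge>1. n = 2 * k \<longrightarrow> (- 1) ^ Suc k * b n > 0)" for n
  proof (induction n rule: less_induct)
    case (less n)
    consider "n = 0" | "n = 1" | "n = 2" | "n \<ge> 3" by linarith
    then show ?case
    proof cases
      case 4
      show ?thesis
      proof (intro conjI impI allI)
        assume "odd n"
        have "b i * b (n - i) = 0" if "i \<in> {1..<n}" for i
          using that less.IH [of i] less.IH [of "n - i"] \<open>odd n\<close> by (cases "odd i") auto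
        then show "b n = 0" using rec' [OF 4] by (simp add: sum.neutral del: of_nat_Suc)
      next
        fix k assume k: "k \<ge> 1" "n = 2 * k"
        have pos: "(- 1) ^ k * (b i * b (n - i)) > 0" if i: "i \<in> {1..<n}" "even i" for i
        proof -
          obtain l where l: "i = 2 * l" using i by blast
          have kl: "n - i = 2 * (k - l)" "k - l \<ge> 1"
            using l i k by auto
          have "\<forall>k\<ge>1. n - i = 2 * k \<longrightarrow> (- 1) ^ Suc k * b (n - i) > 0"
            using less.IH [of "n - i"] i by auto
          then have "(- 1) ^ Suc (k - l) * b (n - i) > 0"
            using kl by blast
          moreover have "(- 1) ^ Suc l * b i > 0"
            using less.IH [of i] i l by auto
          ultimately have "((- 1) ^ Suc l * b i) * ((- 1) ^ Suc (k - l) * b (n - i)) > 0"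
            using mult_pos_pos by blast
          then have "((- 1) ^ Suc l * (- 1) ^ Suc (k - l)) * (b i * b (n - i)) > 0"
            by (simp only: mult_ac)
          moreover have "(- 1) ^ Suc l * (- 1) ^ Suc (k - l) = ((- 1) ^ k :: rat)"
            using l k i by (simp add: power_add [symmetric])
          ultimately show ?thesis by simp
        qed
        have "(- 1) ^ k * (b i * b (n - i)) \<ge> 0" if "i \<in> {1..<n}" for i
          using that less.IH [of i] pos [of i] by (cases "even i") auto
        \<comment> \<open>One strictly positive summand is enough, and \<open>i = 2\<close> is
          available because \<open>n \<ge> 3\<close>.\<close>
        moreover have "2 \<in> {1..<n}" using 4 by simp
        ultimately have "(\<Sum>i\<in>{1..<n}. (- 1) ^ k * (b i * b (n - i))) > 0"
          using pos [of 2] by (intro sum_pos2 [of _ 2]) auto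
        then have "(- 1) ^ k * (\<Sum>i\<in>{1..<n}. b i * b (n - i)) > 0"
          by (simp only: sum_distrib_left)
        then have "(- 1) ^ Suc k * (of_nat (n + 1) * b n) > 0"
          unfolding rec' [OF 4] by simp
        then have "of_nat (n + 1) * ((- 1) ^ Suc k * b n) > 0"
          by (simp only: mult.left_commute)
        then show "(- 1) ^ Suc k * b n > 0"
          by (rule zero_less_mult_pos) simp
      qed
    qed (use b0 b1 b2 in auto)
  qed
  then have "(- 1) ^ Suc k * b (2 * k) > 0" using assms by blast
  then have "b (2 * k) \<noteq> 0" by auto
  then show ?thesis
    using assms by (simp add: b_def g_def bernoulli_gf_nth)
qed


text \<open>A fragment of the von Staudt-Clausen theorem: for odd \<open>p\<close> the number
  \<open>B_(p-1)\<close> has \<open>p\<close> in its denominator, because \<open>p * B_(p-1)\<close>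
  is congruent to -1 in the localization at \<open>p\<close>.\<close>

lemma bernoulli_denominator:
  assumes p: "prime p"
  shows "\<exists>k\<ge>1. \<exists>d N :: int. \<not> int p dvd N \<and> of_int (d * int p) * bernoulli (2 * k) = of_int N"
proof (cases "p = 2")
  case True
  \<comment> \<open>\<open>3 * 2 * B_2 = 1\<close>.\<close>
  show ?thesis
    by (intro exI [of _ 1] conjI exI [of _ 3]) (simp_all add: True bernoulli_2)
next
  case False
  then have p3: "p \<ge> 3" "odd p"
    using p prime_ge_2_nat [OF p] prime_odd_nat [OF p] by linarith+
  have pi: "prime (int p)" using p by simp
  \<comment> \<open>This is the localization of the integers at \<open>p\<close>.\<close>
  define integral where "integral r \<longleftrightarrow> (\<exists>d::int. \<not> int p dvd d \<and> of_int d * r \<in> \<int>)" for r :: rat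
  have integral_add: "integral (r + s)" if rs: "integral r" "integral s" for r s
  proof -
    obtain d e :: int where de: "\<not> int p dvd d" "of_int d * r \<in> \<int>" "\<not> int p dvd e" "of_int e * s \<in> \<int>"
      using rs by (auto simp: integral_def)
    have "of_int e * (of_int d * r) + of_int d * (of_int e * s) \<in> \<int>"
      by (rule Ints_add [OF Ints_mult [OF Ints_of_int de(2)] Ints_mult [OF Ints_of_int de(4)]])
    also have "of_int e * (of_int d * r) + of_int d * (of_int e * s) = of_int (d * e) * (r + s)"
      by (simp add: algebra_simps)
    finally have "of_int (d * e) * (r + s) \<in> \<int>" .
    moreover have "\<not> int p dvd d * e"
      using de pi by (simp add: prime_dvd_mult_iff)
    ultimately show ?thesis
      unfolding integral_def by blast
  qed
  have integral_mult: "integral (of_nat a * r)" if r: "integral r" for a r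
  proof -
    obtain d :: int where d: "\<not> int p dvd d" "of_int d * r \<in> \<int>"
      using r by (auto simp: integral_def)
    have "of_nat a * (of_int d * r) \<in> \<int>"
      by (rule Ints_mult [OF Ints_of_nat d(2)])
    then show ?thesis
      using d(1) unfolding integral_def by (intro exI [of _ d]) (simp add: mult_ac)
  qed
  have integral_1: "integral 1" and integral_0: "integral 0"
    using p3 by (auto simp: integral_def intro!: exI [of _ 1])
  have integral_sum: "integral (\<Sum>i\<in>I. f i)" if "finite I" "\<And>i. i \<in> I \<Longrightarrow> integral (f i)"
    for I :: "nat set" and f
    using that by (induction I) (auto simp: integral_0 integral_add)
  \<comment> \<open>Below \<open>p - 1\<close> the recurrence only divides by
    \<open>j + 1 < p\<close>, a unit of the localization.\<close>
  have integral_bernoulli: "integral (bernoulli j)" if "j < p - 1" for j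
    using that
  proof (induction j rule: less_induct)
    case (less j)
    show ?case
    proof (cases "j = 0")
      case False
      have "integral (\<Sum>i<j. of_nat (Suc j choose i) * bernoulli i)"
        using less by (intro integral_sum integral_mult) auto
      then obtain d :: int where d: "\<not> int p dvd d"
          "of_int d * (\<Sum>i<j. of_nat (Suc j choose i) * bernoulli i) \<in> \<int>"
        by (auto simp: integral_def)
      have eq: "of_nat (Suc j) * bernoulli j = - (\<Sum>i<j. of_nat (Suc j choose i) * bernoulli i)"
        using False by (intro bernoulli_recurrence) simp
      have "of_int (d * int (Suc j)) * bernoulli j = of_int d * (of_nat (Suc j) * bernoulli j)"
        by (simp only: of_int_mult of_int_of_nat_eq mult.assoc)
      also have "\<dots> \<in> \<int>"
        unfolding eq mult_minus_right using d(2) by (rule Ints_minus)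
      finally have "of_int (d * int (Suc j)) * bernoulli j \<in> \<int>" .
      moreover have "\<not> int p dvd int (Suc j)"
        using less.prems by (auto simp only: int_dvd_int_iff dest!: dvd_imp_le)
      ultimately show ?thesis
        using d(1) pi unfolding integral_def
        by (intro exI [of _ "d * int (Suc j)"]) (simp add: prime_dvd_mult_iff)
    qed (simp add: bernoulli_0 integral_1)
  qed
  \<comment> \<open>In the recurrence for \<open>p - 1\<close> the binomials \<open>C(p, i)\<close>
    with \<open>0 < i < p - 1\<close> are multiples of \<open>p\<close>; \<open>r\<close> gathers
    these terms divided by \<open>p\<close>, and the term \<open>i = 0\<close> supplies the
    1.\<close>
  define r where "r = (\<Sum>i\<in>{1..<p - 1}. of_nat ((p choose i) div p) * bernoulli i)"
  have "integral r"
    unfolding r_def by (intro integral_sum integral_mult integral_bernoulli) auto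
  then obtain d z :: int where d: "\<not> int p dvd d" "of_int d * r = of_int z"
    by (auto simp: integral_def elim: Ints_cases)
  have "{..<p - 1} = insert 0 {1..<p - 1}" using p3 by auto
  then have "(\<Sum>i<p - 1. of_nat (p choose i) * bernoulli i)
      = 1 + (\<Sum>i\<in>{1..<p - 1}. of_nat (p choose i) * bernoulli i)"
    by (simp add: bernoulli_0)
  also have "(\<Sum>i\<in>{1..<p - 1}. of_nat (p choose i) * bernoulli i) = of_nat p * r"
    unfolding r_def sum_distrib_left
  proof (rule sum.cong [OF refl])
    fix i assume "i \<in> {1..<p - 1}"
    then have "p dvd (p choose i)"
      using p by (intro dvd_choose_prime) auto
    then have "p choose i = p * ((p choose i) div p)" by simp
    then have "(of_nat (p choose i) :: rat) = of_nat p * of_nat ((p choose i) div p)"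
      by (metis of_nat_mult)
    then show "of_nat (p choose i) * bernoulli i = of_nat p * (of_nat ((p choose i) div p) * bernoulli i)"
      by (simp only: mult.assoc)
  qed
  finally have "of_nat p * bernoulli (p - 1) = - 1 - of_nat p * r"
    using bernoulli_recurrence [of "p - 1"] p3 by simp
  then have "of_int d * (of_nat p * bernoulli (p - 1)) = of_int d * (- 1 - of_nat p * r)"
    by simp
  then have "of_int (d * int p) * bernoulli (p - 1) = - of_int d - of_nat p * (of_int d * r)"
    by (simp add: algebra_simps)
  also have "\<dots> = of_int (- d - int p * z)"
    by (simp add: d(2))
  finally have "of_int (d * int p) * bernoulli (2 * ((p - 1) div 2)) = of_int (- d - int p * z)"
    using p3 by simp
  moreover have "\<not> int p dvd (- d - int p * z)"
    using d(1) by (metis dvd_add_right_iff dvd_minus_iff dvd_triv_left minus_diff_commute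
        diff_conv_add_uminus add.commute)
  moreover have "(p - 1) div 2 \<ge> 1" using p3 by simp
  ultimately show ?thesis by blast
qed

section \<open>Mazur's measure\<close>

lemma power_sum_cong_sq:
  fixes x y :: int
  shows "[(x + y) ^ m = x ^ m + of_nat m * x ^ (m - 1) * y] (mod y\<^sup>2)"
proof (induction m)
  case (Suc m)
  have "[(x + y) * (x + y) ^ m = (x + y) * (x ^ m + of_nat m * x ^ (m - 1) * y)] (mod y\<^sup>2)"
    using Suc by (rule cong_scalar_left)
  also have "(x + y) * (x ^ m + of_nat m * x ^ (m - 1) * y)
      = x ^ Suc m + of_nat (Suc m) * x ^ m * y + y\<^sup>2 * (of_nat m * x ^ (m - 1))"
    by (cases m) (simp_all add: algebra_simps power2_eq_square)
  also have "[\<dots> = x ^ Suc m + of_nat (Suc m) * x ^ m * y] (mod y\<^sup>2)"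
    by (simp add: cong_iff_dvd_diff)
  finally show ?case by simp
qed simp

context p_adic
begin

definition residues_prime_to :: "nat \<Rightarrow> int set" where
  "residues_prime_to n = {a. 0 < a \<and> a < P n \<and> \<not> int p dvd a}"

lemma finite_residues_prime_to [simp]: "finite (residues_prime_to n)"
  by (rule finite_subset [of _ "{0..P n}"]) (auto simp: residues_prime_to_def)

lemma residues_prime_to_mult:
  assumes n: "n \<ge> 1" and C: "\<not> int p dvd C" and a: "a \<in> residues_prime_to n"
  shows "C * a mod P n \<in> residues_prime_to n"
proof -
  have "int p dvd P n" using n by (simp add: dvd_power)
  then have "int p dvd C * a mod P n \<longleftrightarrow> int p dvd C * a"
    by (rule dvd_mod_iff)
  then have ndvd: "\<not> int p dvd C * a mod P n"
    using a C prime_int_p by (simp add: prime_dvd_mult_iff residues_prime_to_def)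
  then have "C * a mod P n \<noteq> 0" by auto
  then show ?thesis
    using ndvd pos_mod_sign [OF P_pos(1), of "C * a" n] pos_mod_bound [OF P_pos(1), of "C * a" n]
    unfolding residues_prime_to_def by auto
qed

text \<open>A form of Voronoi's congruence. Multiplication by \<open>C\<close> permutes the residues
  prime to \<open>p\<close>; expanding \<open>(r a + p^n q a)^(2k)\<close> to first order compares
  the two power sums. Pairing \<open>a\<close> with \<open>p^n - a\<close> turns the factor
  \<open>2k\<close> into the \<open>4k\<close> of the zeta moments, and \<open>C\<close> is odd so
  that \<open>(C - 1)/2\<close> is an integer.\<close>

lemma mazur_congruence:
  fixes C :: int and n k :: nat
  assumes n: "n \<ge> 2" and C: "odd C" "\<not> int p dvd C" and k: "k \<ge> 1"
  defines "r \<equiv> \<lambda>a. C * a mod P n" and "q \<equiv> \<lambda>a. C * a div P n"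
  shows "[(1 - C ^ (2 * k)) * (\<Sum>a\<in>residues_prime_to n. a ^ (2 * k))
    = - (4 * int k * P n * (\<Sum>a\<in>{a\<in>residues_prime_to n. 2 * a < P n}.
          r a ^ (2 * k - 1) * (q a - (C - 1) div 2)))] (mod P (2 * n))"
proof -
  let ?A = "residues_prime_to n" and ?h = "(C - 1) div 2"
  let ?H = "{a\<in>?A. 2 * a < P n}"
  let ?S = "\<Sum>a\<in>?A. a ^ (2 * k)" and ?L = "\<Sum>a\<in>?H. r a ^ (2 * k - 1) * (q a - ?h)"
  define f where "f a = r a ^ (2 * k - 1) * q a" for a
  have pP: "int p dvd P n" using n by (simp add: dvd_power)
  have r: "r a = C * a mod P n" and q: "q a = C * a div P n" for a
    by (simp_all add: r_def q_def)
  have Ca: "C * a = r a + P n * q a" for a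
    by (simp add: r_def q_def)
  have rA: "r a \<in> ?A" if "a \<in> ?A" for a
    unfolding r_def using residues_prime_to_mult [OF _ C(2) that] n by simp
  then have r_range: "0 < r a \<and> r a < P n" if "a \<in> ?A" for a
    using that by (simp add: residues_prime_to_def)
  have inj: "inj_on r ?A"
  proof (rule inj_onI)
    fix a b assume ab: "a \<in> ?A" "b \<in> ?A" "r a = r b"
    then have "P n dvd C * (a - b)"
      by (simp add: r_def mod_eq_dvd_iff right_diff_distrib)
    moreover have "coprime (P n) C"
      using C prime_int_p by (simp add: prime_imp_coprime)
    ultimately have "P n dvd a - b" by (simp add: coprime_dvd_mult_right_iff)
    then have "a mod P n = b mod P n" by (simp add: mod_eq_dvd_iff)
    then show "a = b" using ab by (simp add: residues_prime_to_def)
  qed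
  have bij: "bij_betw r ?A ?A"
    using rA inj by (simp add: bij_betw_def endo_inj_surj image_subset_iff)
  have "C ^ (2 * k) * ?S = (\<Sum>a\<in>?A. (r a + P n * q a) ^ (2 * k))"
    by (simp add: sum_distrib_left Ca [symmetric] power_mult_distrib)
  also have "[\<dots> = (\<Sum>a\<in>?A. r a ^ (2 * k) + of_nat (2 * k) * r a ^ (2 * k - 1) * (P n * q a))] (mod P (2 * n))"
  proof (rule cong_sum)
    fix a
    have "P (2 * n) dvd (P n * q a)\<^sup>2"
      by (simp add: power_mult_distrib power_mult [symmetric] mult.commute)
    then show "[(r a + P n * q a) ^ (2 * k)
        = r a ^ (2 * k) + of_nat (2 * k) * r a ^ (2 * k - 1) * (P n * q a)] (mod P (2 * n))"
      using power_sum_cong_sq cong_dvd_modulus by blast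
  qed
  also have "(\<Sum>a\<in>?A. r a ^ (2 * k) + of_nat (2 * k) * r a ^ (2 * k - 1) * (P n * q a))
      = ?S + 2 * int k * P n * (\<Sum>a\<in>?A. f a)"
    using sum.reindex_bij_betw [OF bij, of "\<lambda>a. a ^ (2 * k)"]
    by (simp add: sum.distrib sum_distrib_left f_def mult_ac)
  finally have 1: "[C ^ (2 * k) * ?S = ?S + 2 * int k * P n * (\<Sum>a\<in>?A. f a)] (mod P (2 * n))" .
  \<comment> \<open>A residue at the midpoint could only occur for \<open>p = 2\<close>, where
    \<open>2^(n-1)\<close> is even because \<open>n \<ge> 2\<close>.\<close>
  have half: "2 * a \<noteq> P n" if "a \<in> ?A" for a
  proof
    assume eq: "2 * a = P n"
    have "int p dvd 2 * a" using eq pP by simp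
    then have "p = 2"
      using that prime_int_p by (auto simp: prime_dvd_mult_iff residues_prime_to_def primes_dvd_imp_eq
          dest: zdvd_imp_le) (metis int_dvd_int_iff of_nat_numeral primes_dvd_imp_eq prime_p two_is_prime_nat)
    moreover obtain m where "n = Suc (Suc m)" using n by (metis add_2_eq_Suc le_Suc_ex)
    ultimately have "int p dvd a" using eq by simp
    then show False using that by (simp add: residues_prime_to_def)
  qed
  \<comment> \<open>Reflection sends the quotient \<open>q a\<close> to \<open>C - 1 - q a\<close>
    and changes the sign of the odd power of \<open>r a\<close>.\<close>
  have refl: "[f (P n - a) = - (r a ^ (2 * k - 1) * (C - 1 - q a))] (mod P n)" if "a \<in> ?A" for a
  proof -
    have eq: "C * (P n - a) = (P n - r a) + P n * (C - 1 - q a)"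
      using Ca [of a] by (simp add: algebra_simps)
    have "r (P n - a) = P n - r a"
      unfolding r [of "P n - a"] eq using r_range [OF that]
      by (subst mod_mult_self2) (intro mod_pos_pos_trivial, auto)
    moreover have "q (P n - a) = C - 1 - q a"
      unfolding q [of "P n - a"] eq using r_range [OF that]
      using p_pos by (subst div_mult_self2) auto
    moreover have "[(P n - r a) ^ (2 * k - 1) = (- r a) ^ (2 * k - 1)] (mod P n)"
      by (intro cong_pow) (simp add: cong_iff_dvd_diff)
    moreover have "(- r a) ^ (2 * k - 1) = - (r a ^ (2 * k - 1))"
      using k by (intro power_minus_odd) simp
    ultimately show ?thesis
      unfolding f_def by (metis cong_scalar_right mult_minus_left)
  qed
  have split: "(\<Sum>a\<in>?A. f a) = (\<Sum>a\<in>?H. f a + f (P n - a))"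
  proof -
    have "bij_betw (\<lambda>a. P n - a) ?H {a\<in>?A. \<not> 2 * a < P n}"
    proof (rule bij_betwI [where g = "\<lambda>a. P n - a"])
      have "int p dvd P n - a \<longleftrightarrow> int p dvd a" for a
        using pP by (simp add: dvd_diff_right_iff)
      then show "(\<lambda>a. P n - a) \<in> ?H \<rightarrow> {a\<in>?A. \<not> 2 * a < P n}"
        "(\<lambda>a. P n - a) \<in> {a\<in>?A. \<not> 2 * a < P n} \<rightarrow> ?H"
        using half by (fastforce simp: residues_prime_to_def)+
    qed auto
    then have "(\<Sum>a\<in>{a\<in>?A. \<not> 2 * a < P n}. f a) = (\<Sum>a\<in>?H. f (P n - a))"
      by (rule sum.reindex_bij_betw [symmetric])
    moreover have "(\<Sum>a\<in>?A. f a) = (\<Sum>a\<in>?H. f a) + (\<Sum>a\<in>{a\<in>?A. \<not> 2 * a < P n}. f a)"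
      by (subst sum.union_disjoint [symmetric]) (auto intro!: sum.cong)
    ultimately show ?thesis by (simp add: sum.distrib)
  qed
  have "[(\<Sum>a\<in>?A. f a) = (\<Sum>a\<in>?H. f a + - (r a ^ (2 * k - 1) * (C - 1 - q a)))] (mod P n)"
    unfolding split by (intro cong_sum cong_add cong_refl refl) auto
  also have "(\<Sum>a\<in>?H. f a + - (r a ^ (2 * k - 1) * (C - 1 - q a))) = 2 * ?L"
  proof -
    have "X * Q + - (X * (E - Q)) = 2 * (X * (Q - h))" if "2 * h = E" for X Q E h :: int
      unfolding that [symmetric] by (simp add: algebra_simps)
    moreover have "2 * ?h = C - 1" using C by simp
    ultimately have "f a + - (r a ^ (2 * k - 1) * (C - 1 - q a)) = 2 * (r a ^ (2 * k - 1) * (q a - ?h))" for a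
      unfolding f_def by blast
    then show ?thesis by (simp add: sum_distrib_left)
  qed
  finally have "P n dvd (\<Sum>a\<in>?A. f a) - 2 * ?L"
    by (simp only: cong_iff_dvd_diff)
  moreover have "P (2 * n) dvd 2 * K * P n * T - 4 * K * P n * L" if "P n dvd T - 2 * L" for K T L :: int
  proof -
    have "P n * P n dvd (2 * K) * P n * (T - 2 * L)"
      using that by (intro mult_dvd_mono dvd_triv_right)
    also have "(2 * K) * P n * (T - 2 * L) = 2 * K * P n * T - 4 * K * P n * L"
      by (simp add: algebra_simps)
    finally show ?thesis by (simp only: mult_2 power_add)
  qed
  ultimately have "P (2 * n) dvd 2 * int k * P n * (\<Sum>a\<in>?A. f a) - 4 * int k * P n * ?L"
    by blast
  moreover have "P (2 * n) dvd C ^ (2 * k) * ?S - (?S + 2 * int k * P n * (\<Sum>a\<in>?A. f a))"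
    using 1 by (simp only: cong_iff_dvd_diff)
  ultimately have "P (2 * n) dvd - ((2 * int k * P n * (\<Sum>a\<in>?A. f a) - 4 * int k * P n * ?L)
      + (C ^ (2 * k) * ?S - (?S + 2 * int k * P n * (\<Sum>a\<in>?A. f a))))"
    unfolding dvd_minus_iff by (rule dvd_add)
  moreover have "- ((2 * K * P n * T - 4 * K * P n * L) + (x * S - (S + 2 * K * P n * T)))
      = (1 - x) * S - - (4 * K * P n * L)" for K T L x S :: int
    by (simp add: algebra_simps)
  ultimately show ?thesis
    by (simp only: cong_iff_dvd_diff)
qed

text \<open>Removing the multiples of \<open>p\<close> subtracts \<open>p^m\<close> times the full
  sum at level \<open>n - 1\<close>; as \<open>p^m p^(n-1) = p^n p^(m-1)\<close>, the Euler factor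
  appears. The error at level \<open>n - 1\<close> dictates the modulus
  \<open>p^(2n-2)\<close>.\<close>

lemma unit_power_sums:
  assumes m: "m \<ge> 1"
  shows "\<exists>D N :: int. D > 0 \<and> of_int N = of_int D * bernoulli m \<and>
    (\<forall>n\<ge>1. [D * (\<Sum>a\<in>residues_prime_to n. a ^ m) = P n * ((1 - P (m - 1)) * N)] (mod P (2 * n - 2)))"
proof -
  obtain D :: int where D: "D > 0" "\<And>M. \<exists>Y::int.
     of_int D * ((\<Sum>a<M. (of_nat a :: rat) ^ m) - of_nat M * bernoulli m) = of_nat M ^ 2 * of_int Y"
    using sum_powers_quadratic_error by blast
  obtain x y where xy: "quotient_of (bernoulli m) = (x, y)" by fastforce
  then have y: "y > 0" "bernoulli m = of_int x / of_int y"
    using quotient_of_denom_pos quotient_of_div by blast+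
  \<comment> \<open>\<open>D\<close> clears the error terms and \<open>y\<close> the Bernoulli
    number itself, so the common multiplier is \<open>D * y\<close>.\<close>
  define N where "N = D * x"
  have N: "of_int N = of_int (D * y) * bernoulli m" using y by (simp add: N_def)
  have "[D * y * (\<Sum>a\<in>residues_prime_to n. a ^ m) = P n * ((1 - P (m - 1)) * N)] (mod P (2 * n - 2))"
    if n: "n \<ge> 1" for n
  proof -
    obtain l where l: "n = Suc l" using n by (metis Suc_le_D One_nat_def)
    obtain i where i: "m = Suc i" using m by (metis Suc_le_D One_nat_def)
    obtain Y1 Y2 :: int where Y:
      "of_int D * ((\<Sum>a<p ^ n. (of_nat a :: rat) ^ m) - of_nat (p ^ n) * bernoulli m) = of_nat (p ^ n) ^ 2 * of_int Y1"
      "of_int D * ((\<Sum>a<p ^ l. (of_nat a :: rat) ^ m) - of_nat (p ^ l) * bernoulli m) = of_nat (p ^ l) ^ 2 * of_int Y2"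
      using D(2) by metis
    have S: "(\<Sum>a\<in>residues_prime_to n. a ^ m)
        = (\<Sum>a<p ^ n. int a ^ m) - (\<Sum>a<p ^ l. (int p * int a) ^ m)"
    proof -
      have "(\<Sum>a<p ^ n. int a ^ m) = (\<Sum>a\<in>{0..<P n}. a ^ m)"
        by (rule sum.reindex_bij_witness [of _ nat int])
          (auto simp: nat_less_iff zless_nat_eq_int_zless simp flip: of_nat_power)
      also have "{0..<P n} = residues_prime_to n \<union> {a\<in>{0..<P n}. int p dvd a}"
      proof -
        have "0 < a" if "0 \<le> a" "\<not> int p dvd a" for a
          using that by (cases "a = 0") auto
        then show ?thesis by (auto simp: residues_prime_to_def)
      qed
      also have "(\<Sum>a\<in>\<dots>. a ^ m) = (\<Sum>a\<in>residues_prime_to n. a ^ m) + (\<Sum>a\<in>{a\<in>{0..<P n}. int p dvd a}. a ^ m)"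
      proof (rule sum.union_disjoint)
        show "residues_prime_to n \<inter> {a\<in>{0..<P n}. int p dvd a} = {}"
          by (auto simp: residues_prime_to_def)
      qed (auto intro: finite_subset [of _ "{0..<P n}"])
      also have "(\<Sum>a\<in>{a\<in>{0..<P n}. int p dvd a}. a ^ m) = (\<Sum>a<p ^ l. (int p * int a) ^ m)"
      proof (rule sum.reindex_bij_witness [of _ "\<lambda>a. int p * int a" "\<lambda>a. nat (a div int p)"])
        fix a assume a: "a \<in> {a\<in>{0..<P n}. int p dvd a}"
        then obtain b where b: "a = int p * b" by blast
        then have "0 \<le> b" "b < P l"
          using a p_pos by (auto simp: l zero_le_mult_iff)
        then show "int p * int (nat (a div int p)) = a" "nat (a div int p) \<in> {..<p ^ l}"
          "(int p * int (nat (a div int p))) ^ m = a ^ m"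
          using p_pos by (auto simp: b nat_less_iff)
      next
        fix a assume "a \<in> {..<p ^ l}"
        then have "int a < P l" by (simp flip: of_nat_power)
        then show "nat ((int p * int a) div int p) = a" "int p * int a \<in> {a\<in>{0..<P n}. int p dvd a}"
          using p_pos by (auto simp: l)
      qed
      finally show ?thesis by simp
    qed
    have "rat_of_int (D * y * (\<Sum>a\<in>residues_prime_to n. a ^ m))
        = of_int y * (of_int D * (\<Sum>a<p ^ n. (of_nat a :: rat) ^ m)
          - of_nat p ^ m * (of_int D * (\<Sum>a<p ^ l. (of_nat a :: rat) ^ m)))"
    proof -
      have "(\<Sum>a<p ^ l. (int p * int a) ^ m) = int p ^ m * (\<Sum>a<p ^ l. int a ^ m)"
        by (simp add: power_mult_distrib sum_distrib_left)
      then show ?thesis unfolding S by (simp add: algebra_simps)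
    qed
    also have "\<dots> = of_int y * ((of_nat (p ^ n) ^ 2 * of_int Y1 + of_int D * (of_nat (p ^ n) * bernoulli m))
          - of_nat p ^ m * (of_nat (p ^ l) ^ 2 * of_int Y2 + of_int D * (of_nat (p ^ l) * bernoulli m)))"
      unfolding Y [symmetric] by (simp add: algebra_simps)
    also have "\<dots> = of_nat (p ^ n) * (1 - of_nat p ^ i) * (of_int (D * y) * bernoulli m)
          + of_nat (p ^ l) ^ 2 * (of_int y * (of_nat p ^ 2 * of_int Y1 - of_nat p ^ m * of_int Y2))"
      by (simp add: l i algebra_simps power2_eq_square)
    also have "\<dots> = rat_of_int (P n * (1 - P i) * N + P l ^ 2 * (y * (int p ^ 2 * Y1 - int p ^ m * Y2)))"
      unfolding N [symmetric] by simp
    finally have "D * y * (\<Sum>a\<in>residues_prime_to n. a ^ m)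
        = P n * (1 - P i) * N + P l ^ 2 * (y * (int p ^ 2 * Y1 - int p ^ m * Y2))"
      by (simp only: of_int_eq_iff)
    moreover have "P l ^ 2 = P (2 * n - 2)"
      by (simp add: l power_mult [symmetric] mult.commute)
    ultimately show ?thesis
      by (simp add: cong_iff_dvd_diff i mult.assoc)
  qed
  then show ?thesis
    using D(1) y(1) N by (intro exI [of _ "D * y"] exI [of _ N]) simp
qed

section \<open>The zeta-ideal\<close>

definition zeta_moment :: "padic \<Rightarrow> nat \<Rightarrow> padic \<Rightarrow> bool" where
  "zeta_moment c k z \<longleftrightarrow> padic_eq_rat_mult p z (- bernoulli (2 * k) / of_nat (4 * k))
     ((\<^bold>1 \<^bold>- c \<^bold>^ (2 * k)) \<^bold>* \<iota> (1 - int p ^ (2 * k - 1)))"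

lemma zeta_momentD:
  assumes "zeta_moment c k z" "quotient_of (- bernoulli (2 * k) / of_nat (4 * k)) = (x, y)"
  shows "\<iota> y \<^bold>* z = \<iota> x \<^bold>* ((\<^bold>1 \<^bold>- c \<^bold>^ (2 * k)) \<^bold>* \<iota> (1 - P (2 * k - 1)))"
  using assms(1) unfolding zeta_moment_def padic_eq_rat_mult_def assms(2) fst_conv snd_conv .

text \<open>The sum of the \<open>a^(2k)\<close> is evaluated twice, through
  \<open>mazur_congruence\<close> and through \<open>unit_power_sums\<close>; dividing by
  \<open>p^n\<close> shows that the finite sums \<open>L n k\<close> approach the required
  moments.\<close>

lemma zeta_exists:
  assumes c: "c \<in> U"
  shows "\<exists>\<mu>\<in>padic_measures p. \<forall>k\<ge>1. zeta_moment c k (even_moment p \<mu> k)"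
proof -
  have cZ: "c \<in> Z" using c by simp
  \<comment> \<open>An odd integer representing \<open>c\<close> modulo \<open>p^n\<close>. For
    \<open>n \<ge> 1\<close>, an even \<open>c n\<close> forces \<open>p\<close> to be odd, so
    adding \<open>P n\<close> changes the parity.\<close>
  define C where "C n = (if odd (c n) then c n else c n + P n)" for n
  have C_odd: "odd (C n)" and C_p: "\<not> int p dvd C n" if n: "n \<ge> 1" for n
  proof -
    have "coprime (c n) (P 1)" using Units_coprime [OF c, of n 1] n by simp
    then have cn: "\<not> int p dvd c n"
      using prime_int_p by (metis P_1 coprime_common_divisor dvd_refl not_prime_unit)
    moreover have "int p dvd P n" using n by (simp add: dvd_power)
    ultimately show "\<not> int p dvd C n"
      by (simp add: C_def dvd_add_left_iff)
    have "odd (P n)" if "even (c n)"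
    proof -
      have "p \<noteq> 2" using cn that by auto
      then have "odd p" using prime_p prime_odd_nat prime_ge_2_nat by (metis le_neq_implies_less)
      then show ?thesis by simp
    qed
    then show "odd (C n)" by (simp add: C_def)
  qed
  have C_mod: "C n mod P n = c n" for n
    using cZ by (simp add: C_def)
  define H where "H n = {a\<in>residues_prime_to n. 2 * a < P n}" for n
  define r where "r n a = C n * a mod P n" for n a
  define q where "q n a = C n * a div P n" for n a
  have r: "r n a \<in> residues_prime_to n" if "a \<in> H n" "n \<ge> 1" for n a
    using that residues_prime_to_mult [OF _ C_p] by (auto simp: r_def H_def)
  have w_ex: "\<exists>w. [w * r n a = 1] (mod P n)" if "a \<in> H n" "n \<ge> 1" for n a
  proof -
    have "coprime (r n a) (P n)"
      using r [OF that] prime_int_p by (simp add: residues_prime_to_def coprime_commute prime_imp_coprime)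
    then show ?thesis
      using cong_solve_coprime_int by (metis mult.commute)
  qed
  \<comment> \<open>Only even functions can be integrated, so the odd power \<open>r^(2k-1)\<close>
    is written as \<open>w * r^(2k)\<close> with \<open>w\<close> inverse to \<open>r\<close>; the
    weight does not depend on \<open>k\<close>.\<close>
  define w where "w n a = (SOME w. [w * r n a = 1] (mod P n))" for n a
  have w: "[w n a * r n a = 1] (mod P n)" if "a \<in> H n" "n \<ge> 1" for n a
    unfolding w_def by (rule someI_ex [OF w_ex [OF that]])
  define J where "J n F N = (\<Sum>a\<in>H n. (w n a * (q n a - (C n - 1) div 2)) * F (\<iota> (r n a)) N) mod P N"
    for n F N
  have J: "lin (J n)" if "n \<ge> 1" for n
    unfolding J_def [abs_def] using r [OF _ that]
    by (intro lin_point_sum emb_Units) (auto simp: residues_prime_to_def)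
  define L where "L n k = (\<Sum>a\<in>H n. r n a ^ (2 * k - 1) * (q n a - (C n - 1) div 2))" for n k
  have JL: "[J n (pw k) N = L n k] (mod P N)" if "n \<ge> 1" "N \<le> n" "k \<ge> 1" for n k N
  proof -
    have "[(\<Sum>a\<in>H n. (w n a * (q n a - (C n - 1) div 2)) * pw k (\<iota> (r n a)) N) = L n k] (mod P N)"
      unfolding L_def
    proof (rule cong_sum)
      fix a assume a: "a \<in> H n"
      have "[w n a * r n a = 1] (mod P N)"
        using w [OF a \<open>n \<ge> 1\<close>] by (rule cong_dvd_modulus) (simp add: le_imp_power_dvd that)
      then have 1: "[w n a * r n a * (r n a ^ (2 * k - 1) * (q n a - (C n - 1) div 2))
          = 1 * (r n a ^ (2 * k - 1) * (q n a - (C n - 1) div 2))] (mod P N)"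
        by (rule cong_scalar_right)
      have "[pw k (\<iota> (r n a)) N = r n a ^ (2 * k)] (mod P N)"
        unfolding nth_pw [OF emb_closed] nth_emb power_mult [symmetric] power_mod
        by (simp add: cong_def)
      then have 2: "[(w n a * (q n a - (C n - 1) div 2)) * pw k (\<iota> (r n a)) N
          = (w n a * (q n a - (C n - 1) div 2)) * r n a ^ (2 * k)] (mod P N)"
        by (rule cong_scalar_left)
      have "2 * k = Suc (2 * k - 1)" using \<open>k \<ge> 1\<close> by simp
      then have "r n a ^ (2 * k) = r n a * r n a ^ (2 * k - 1)"
        by (metis power_Suc)
      then have 3: "(w n a * (q n a - (C n - 1) div 2)) * r n a ^ (2 * k)
          = (w n a * r n a) * (r n a ^ (2 * k - 1) * (q n a - (C n - 1) div 2))"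
        by (simp only: mult_ac)
      show "[(w n a * (q n a - (C n - 1) div 2)) * pw k (\<iota> (r n a)) N
          = r n a ^ (2 * k - 1) * (q n a - (C n - 1) div 2)] (mod P N)"
        using cong_trans [OF 2 [unfolded 3] 1] by (simp only: mult_1)
    qed
    then show ?thesis by (simp add: J_def cong_def)
  qed
  define Q where "Q k D N \<longleftrightarrow> D > 0 \<and> rat_of_int N = of_int D * bernoulli (2 * k) \<and>
    (\<forall>n\<ge>1. [D * (\<Sum>a\<in>residues_prime_to n. a ^ (2 * k)) = P n * ((1 - P (2 * k - 1)) * N)] (mod P (2 * n - 2)))"
    for k D N
  have "\<exists>D N. Q k D N" if "k \<ge> 1" for k
    unfolding Q_def by (rule unit_power_sums) (use that in simp)
  then obtain D N where Q: "\<And>k. k \<ge> 1 \<Longrightarrow> Q k (D k) (N k)" by metis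
  have "\<exists>\<mu>\<in>padic_measures p. \<forall>k\<ge>1. \<iota> (4 * int k * D k) \<^bold>* even_moment p \<mu> k
      = \<iota> (- N k * (1 - P (2 * k - 1))) \<^bold>* (\<^bold>1 \<^bold>- c \<^bold>^ (2 * k))"
  \<comment> \<open>The shift gives \<open>n \<ge> 2\<close> for \<open>n = m + 2\<close>, and
    \<open>p^(2n-2) = p^n p^m\<close> leaves precision \<open>p^m\<close> after division by
    \<open>p^n\<close>.\<close>
  proof (rule measure_limit [where J = "\<lambda>m. J (m + 2)"])
    show "lin (J (m + 2))" for m by (rule J) simp
    fix k :: nat assume k: "k \<ge> 1"
    show "\<iota> (4 * int k * D k) \<in> Z" by simp
    show "\<iota> (4 * int k * D k) \<noteq> \<^bold>0"
      using Q [OF k] k by (simp add: emb_eq_0_iff Q_def)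
    fix M
    have "(\<iota> (4 * int k * D k) \<^bold>* J (m + 2) (pw k)) M
        = (\<iota> (- N k * (1 - P (2 * k - 1))) \<^bold>* (\<^bold>1 \<^bold>- c \<^bold>^ (2 * k))) M" if m: "M \<le> m" for m
    proof -
      define n where "n = m + 2"
      then have "n \<ge> 1" by simp
      let ?S = "\<Sum>a\<in>residues_prime_to n. a ^ (2 * k)"
      have "[(1 - C n ^ (2 * k)) * ?S = - (4 * int k * P n * L n k)] (mod P (2 * n))"
        unfolding L_def H_def r_def q_def
        by (rule mazur_congruence) (use k C_odd [of n] C_p [of n] in \<open>simp_all add: n_def\<close>)
      then have "[(1 - C n ^ (2 * k)) * ?S = - (4 * int k * P n * L n k)] (mod P (2 * n - 2))"
        by (rule cong_dvd_modulus) (simp add: le_imp_power_dvd)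
      then have 1: "P (2 * n - 2) dvd D k * ((1 - C n ^ (2 * k)) * ?S - - (4 * int k * P n * L n k))"
        by (simp only: cong_iff_dvd_diff dvd_mult)
      have "[D k * ?S = P n * ((1 - P (2 * k - 1)) * N k)] (mod P (2 * n - 2))"
        using Q [OF k] \<open>n \<ge> 1\<close> unfolding Q_def by blast
      then have 2: "P (2 * n - 2) dvd (1 - C n ^ (2 * k)) * (D k * ?S - P n * ((1 - P (2 * k - 1)) * N k))"
        by (simp only: cong_iff_dvd_diff dvd_mult)
      have "(d::int) * ((1 - x) * S - - (K * Pn * l)) - (1 - x) * (d * S - Pn * (y * e))
          = Pn * (K * d * l - - e * y * (1 - x))" for d x S K Pn l y e
        by (simp add: algebra_simps)
      with dvd_diff [OF 1 2]
      have "P (2 * n - 2) dvd P n * (4 * int k * D k * L n k - - N k * (1 - P (2 * k - 1)) * (1 - C n ^ (2 * k)))"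
        by simp
      moreover have "P (2 * n - 2) = P n * P m"
        by (simp add: n_def power_add [symmetric] mult_2)
      ultimately have "P m dvd 4 * int k * D k * L n k - - N k * (1 - P (2 * k - 1)) * (1 - C n ^ (2 * k))"
        using P_pos(3) [of n] by (simp only: dvd_mult_cancel_left) blast
      then have 3: "[4 * int k * D k * L n k = - N k * (1 - P (2 * k - 1)) * (1 - C n ^ (2 * k))] (mod P M)"
        unfolding cong_iff_dvd_diff using m by (meson dvd_trans le_imp_power_dvd)
      have "[J n (pw k) M = L n k] (mod P M)"
        using JL [of n M k] k m by (simp add: n_def)
      then have 4: "[4 * int k * D k * J n (pw k) M = 4 * int k * D k * L n k] (mod P M)"
        by (rule cong_scalar_left)
      have "C n mod P M = c M"
        using C_mod [of n] nth_mod_le [OF cZ, of M n] m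
        by (metis mod_mod_cancel le_imp_power_dvd n_def trans_le_add1)
      then have "[C n = c M] (mod P M)"
        using cZ by (simp add: cong_def)
      then have "[- N k * (1 - P (2 * k - 1)) * (1 - C n ^ (2 * k))
          = - N k * (1 - P (2 * k - 1)) * (1 - c M ^ (2 * k))] (mod P M)"
        by (intro cong_scalar_left cong_diff cong_refl cong_pow)
      with 3 4 have "[4 * int k * D k * J n (pw k) M
          = - N k * (1 - P (2 * k - 1)) * (1 - c M ^ (2 * k))] (mod P M)"
        using cong_trans by blast
      then show ?thesis
        using cZ unfolding n_def [symmetric] cong_def
        by (simp only: nth_mult nth_emb nth_diff nth_one nth_pow Zp.one_closed Zp.nat_pow_closed mod_simps)
    qed
    then show "\<forall>\<^sub>F m in sequentially. (\<iota> (4 * int k * D k) \<^bold>* J (m + 2) (pw k)) M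
        = (\<iota> (- N k * (1 - P (2 * k - 1))) \<^bold>* (\<^bold>1 \<^bold>- c \<^bold>^ (2 * k))) M"
      unfolding eventually_sequentially by blast
  qed
  then obtain \<mu> where \<mu>: "\<mu> \<in> padic_measures p"
    "\<And>k. k \<ge> 1 \<Longrightarrow> \<iota> (4 * int k * D k) \<^bold>* even_moment p \<mu> k
      = \<iota> (- N k * (1 - P (2 * k - 1))) \<^bold>* (\<^bold>1 \<^bold>- c \<^bold>^ (2 * k))" by blast
  \<comment> \<open>\<open>D k\<close> and \<open>N k\<close> may give an unreduced fraction;
    comparison with \<open>quotient_of\<close> cancels \<open>4 * k * D k\<close>.\<close>
  have "zeta_moment c k (even_moment p \<mu> k)" if k: "k \<ge> 1" for k
  proof -
    obtain x y where xy: "quotient_of (- bernoulli (2 * k) / of_nat (4 * k)) = (x, y)" by fastforce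
    then have y: "y > 0" "- bernoulli (2 * k) / of_nat (4 * k) = of_int x / of_int y"
      using quotient_of_denom_pos quotient_of_div by blast+
    have D: "D k > 0" "rat_of_int (N k) = of_int (D k) * bernoulli (2 * k)"
      using Q [OF k] by (auto simp: Q_def)
    have "- bernoulli (2 * k) * of_int y = of_int x * of_nat (4 * k)"
      using y k by (simp add: field_simps)
    then have "of_int (D k) * (- bernoulli (2 * k) * of_int y) = of_int (D k) * (of_int x * of_nat (4 * k))"
      by simp
    then have "rat_of_int (y * - N k) = of_int (4 * int k * D k * x)"
      using D(2) by (simp add: mult_ac)
    then have eq: "y * - N k = 4 * int k * D k * x"
      by (simp only: of_int_eq_iff)
    let ?u = "\<^bold>1 \<^bold>- c \<^bold>^ (2 * k)" and ?v = "\<iota> (1 - P (2 * k - 1))"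
    have u: "?u \<in> Z" using cZ by simp
    have m: "even_moment p \<mu> k \<in> Z" using \<mu> by simp
    have "\<iota> (4 * int k * D k) \<^bold>* (\<iota> y \<^bold>* even_moment p \<mu> k)
        = \<iota> y \<^bold>* (\<iota> (4 * int k * D k) \<^bold>* even_moment p \<mu> k)"
      using m by (intro Zp.m_lcomm) auto
    also have "\<dots> = \<iota> y \<^bold>* (\<iota> (- N k) \<^bold>* ?v \<^bold>* ?u)"
      unfolding \<mu>(2) [OF k] emb_mult [of "- N k"] ..
    also have "\<dots> = \<iota> (y * - N k) \<^bold>* (?u \<^bold>* ?v)"
      unfolding emb_mult [of y "- N k"] using u by (simp add: Zp.m_ac)
    also have "\<dots> = \<iota> (4 * int k * D k) \<^bold>* (\<iota> x \<^bold>* (?u \<^bold>* ?v))"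
      unfolding eq emb_mult [of _ x] using u by (simp add: Zp.m_assoc)
    finally have "\<iota> y \<^bold>* even_moment p \<mu> k = \<iota> x \<^bold>* (?u \<^bold>* ?v)"
      by (rule padic_cancel [rotated -1]) (use u m D k in \<open>auto simp: emb_eq_0_iff\<close>)
    then show ?thesis
      unfolding zeta_moment_def padic_eq_rat_mult_def xy fst_conv snd_conv .
  qed
  then show ?thesis using \<mu>(1) by blast
qed

lemma zeta_moment_unique:
  assumes "zeta_moment c k z" "zeta_moment c k z'" "z \<in> Z" "z' \<in> Z"
  shows "z = z'"
proof (rule padic_cancel)
  let ?d = "snd (quotient_of (- bernoulli (2 * k) / of_nat (4 * k)))"
  show "\<iota> ?d \<noteq> \<^bold>0"
    using quotient_of_denom_pos' [of "- bernoulli (2 * k) / of_nat (4 * k)"]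
    by (simp add: emb_eq_0_iff)
  show "\<iota> ?d \<^bold>* z = \<iota> ?d \<^bold>* z'"
    using assms by (simp add: zeta_moment_def padic_eq_rat_mult_def)
qed (use assms in auto)

lemma zeta_measure:
  assumes c: "c \<in> U"
  shows "zeta_measure p c \<in> padic_measures p"
    and "k \<ge> 1 \<Longrightarrow> zeta_moment c k (even_moment p (zeta_measure p c) k)"
proof -
  let ?Q = "\<lambda>\<mu>. \<mu> \<in> padic_measures p \<and> (\<forall>k\<ge>1. zeta_moment c k (even_moment p \<mu> k))"
  have eq: "zeta_measure p c = (THE \<mu>. ?Q \<mu>)"
    by (simp add: zeta_measure_def zeta_moment_def)
  obtain \<mu> where \<mu>: "?Q \<mu>" using zeta_exists [OF c] by blast
  have "?Q (THE \<mu>. ?Q \<mu>)"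
  proof (rule theI [of ?Q, OF \<mu>])
    fix \<nu> assume \<nu>: "?Q \<nu>"
    show "\<nu> = \<mu>"
    proof (rule measure_unique)
      fix k :: nat assume "k \<ge> 2"
      then show "even_moment p \<nu> k = even_moment p \<mu> k"
        using \<mu> \<nu> by (intro zeta_moment_unique [of c k]) auto
    qed (use \<mu> \<nu> in auto)
  qed
  then show "zeta_measure p c \<in> padic_measures p"
    and "k \<ge> 1 \<Longrightarrow> zeta_moment c k (even_moment p (zeta_measure p c) k)"
    unfolding eq by blast+
qed

text \<open>
  Were the total mass zero, division by \<open>1 - [c]\<close> would make all \<open>(1 - p\<^sup>2\<^sup>k\<^sup>-\<^sup>1) B\<^sub>2\<^sub>k / 4k\<close>
  \<open>p\<close>-integral.
\<close>

lemma zeta_measure_mass: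
  assumes c: "top_generator p c"
  shows "even_moment p (zeta_measure p c) 0 \<noteq> \<^bold>0"
proof
  have cU: "c \<in> U" using c by (rule top_generator_Units)
  assume "even_moment p (zeta_measure p c) 0 = \<^bold>0"
  from augmentation_principal [OF c zeta_measure(1) [OF cU] this]
  obtain \<rho> where \<rho>: "\<rho> \<in> padic_measures p"
    "\<And>k. (\<^bold>1 \<^bold>- c \<^bold>^ (2 * k)) \<^bold>* even_moment p \<rho> k = even_moment p (zeta_measure p c) k" by blast
  \<comment> \<open>At this \<open>k\<close> the prime \<open>p\<close> divides the denominator of
    \<open>B_(2k)\<close>, hence also \<open>y\<close>.\<close>
  obtain k and d N :: int where k: "k \<ge> 1" and dN: "\<not> int p dvd N"
    "of_int (d * int p) * bernoulli (2 * k) = of_int N"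
    using bernoulli_denominator [OF prime_p] by blast
  obtain x y where xy: "quotient_of (- bernoulli (2 * k) / of_nat (4 * k)) = (x, y)" by fastforce
  then have y: "y > 0" "- bernoulli (2 * k) / of_nat (4 * k) = of_int x / of_int y"
    using quotient_of_denom_pos quotient_of_div by blast+
  have cop: "coprime x y" using xy quotient_of_coprime by blast
  have "- bernoulli (2 * k) * of_int y = of_int x * of_nat (4 * k)"
    using y k by (simp add: field_simps)
  then have "of_int (d * int p) * (- bernoulli (2 * k) * of_int y) = of_int (d * int p) * (of_int x * of_nat (4 * k))"
    by simp
  then have "- (of_int (d * int p) * bernoulli (2 * k)) * of_int y = of_int (d * int p) * (of_int x * of_nat (4 * k))"
    by (simp only: mult_minus_left mult_minus_right mult.assoc)
  then have "rat_of_int (- (N * y)) = of_int (int p * (d * x * (4 * int k)))"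
    unfolding dN(2) by (simp add: mult_ac)
  then have "- (N * y) = int p * (d * x * (4 * int k))"
    by (simp only: of_int_eq_iff)
  then have "int p dvd - (N * y)" by simp
  then have py: "int p dvd y"
    using dN(1) prime_int_p by (simp add: prime_dvd_mult_iff)
  let ?u = "\<^bold>1 \<^bold>- c \<^bold>^ (2 * k)" and ?v = "\<iota> (1 - P (2 * k - 1))"
  have u: "?u \<in> Z" using cU by simp
  have "?u \<noteq> \<^bold>0" using top_generator_not_torsion [OF c k] cU by simp
  moreover have "\<iota> y \<^bold>* (?u \<^bold>* even_moment p \<rho> k) = \<iota> x \<^bold>* (?u \<^bold>* ?v)"
    unfolding \<rho>(2) by (rule zeta_momentD [OF zeta_measure(2) [OF cU k] xy])
  then have "?u \<^bold>* (\<iota> y \<^bold>* even_moment p \<rho> k) = ?u \<^bold>* (\<iota> x \<^bold>* ?v)"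
    using u \<rho>(1) by (simp add: Zp.m_lcomm)
  ultimately have "\<iota> y \<^bold>* even_moment p \<rho> k = \<iota> x \<^bold>* ?v"
    using u \<rho>(1) padic_cancel by simp
  then have "(\<iota> y \<^bold>* even_moment p \<rho> k) 1 = (\<iota> x \<^bold>* ?v) 1" by simp
  \<comment> \<open>The Euler factor is 1 modulo \<open>p\<close>, so reduction modulo
    \<open>p\<close> leaves only \<open>x\<close> on the right and 0 on the left, contradicting that
    \<open>x\<close> and \<open>y\<close> are coprime.\<close>
  moreover have "(1 - P (2 * k - 1)) mod int p = 1 mod int p"
    using k by (simp add: mod_eq_dvd_iff dvd_power)
  ultimately have "x mod int p = 0"
    using py by (simp add: nth_mult nth_emb mod_simps dvd_imp_mod_0) (metis mod_mult_right_eq mult.right_neutral)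
  then have "int p dvd x" by auto
  then show False
    using py cop prime_int_p by (meson coprime_common_divisor not_prime_unit)
qed

text \<open>\<open>[1] - [c]\<close> has mass zero and is therefore a multiple of
  \<open>[1] - [c']\<close>; accordingly a zeta measure for \<open>c\<close> is a multiple of the
  one for \<open>c'\<close>.\<close>

lemma generator_change:
  assumes c: "c \<in> U" and c': "top_generator p c'"
  shows "\<exists>u\<in>padic_measures p. \<forall>k. (\<^bold>1 \<^bold>- c' \<^bold>^ (2 * k)) \<^bold>* even_moment p u k = \<^bold>1 \<^bold>- c \<^bold>^ (2 * k)"
proof -
  obtain d where d: "d \<in> padic_measures p" "\<And>k. even_moment p d k = \<^bold>1 \<^bold>- c \<^bold>^ (2 * k)"
    using dirac_difference [OF c] by blast
  have "even_moment p d 0 = \<^bold>0" by (simp add: d(2) Zp.minus_eq Zp.r_neg)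
  from augmentation_principal [OF c' d(1) this] show ?thesis by (simp add: d(2))
qed

text \<open>The generator behind \<open>zeta_ideal\<close> is an arbitrary choice, possibly
  different from \<open>c\<close>, which witnesses that there is something to choose. The name
  \<open>c'\<close> hides the choice from the later arguments.\<close>

lemma in_zeta_ideal:
  assumes "top_generator p c"
  obtains c' where "top_generator p c'"
    "\<And>\<mu>. \<mu> \<in> zeta_ideal p \<longleftrightarrow> (\<exists>\<nu>\<in>padic_measures p. \<mu> = \<nu> \<otimes>\<^bsub>measure_ring p\<^esub> zeta_measure p c')"
proof
  show "top_generator p (SOME c. top_generator p c)"
    using assms by (rule someI [of "top_generator p"])
  have "carrier (measure_ring p) = padic_measures p" by (simp add: measure_ring_def)
  then show "\<mu> \<in> zeta_ideal p \<longleftrightarrow> (\<exists>\<nu>\<in>padic_measures p. \<mu> = \<nu> \<otimes>\<^bsub>measure_ring p\<^esub> zeta_measure p (SOME c. top_generator p c))" for \<mu>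
    unfolding zeta_ideal_def cgenideal_def by blast
qed

text \<open>Up to the change of generator \<open>u\<close>, the moments of \<open>\<mu>\<close> are
  those of \<open>\<nu>\<close> times those of the zeta measure; hence the cofactor
  \<open>u * \<nu>\<close>. Moments are compared after multiplication by the denominator
  \<open>y\<close>.\<close>

lemma moments_imp_in_zeta_ideal:
  assumes c: "top_generator p c" and \<mu>: "\<mu> \<in> padic_measures p" and \<nu>: "\<nu> \<in> padic_measures p"
    and mom: "\<And>k. k \<ge> 2 \<Longrightarrow> even_moment p \<mu> k
      = (\<^bold>1 \<^bold>- c \<^bold>^ (2 * k)) \<^bold>* \<iota> ((1 - P (2 * k - 1)) * b (2 * k))"
    and q: "\<And>k. k \<ge> 2 \<Longrightarrow> even_moment p \<nu> k = \<iota> (q (2 * k))"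
    and bq: "\<And>k. k \<ge> 2 \<Longrightarrow>
      rat_of_int (b (2 * k)) = - bernoulli (2 * k) / of_nat (4 * k) * of_int (q (2 * k))"
  shows "\<mu> \<in> zeta_ideal p"
proof -
  obtain c' where c': "top_generator p c'" and ideal: "\<And>\<mu>. \<mu> \<in> zeta_ideal p \<longleftrightarrow>
      (\<exists>\<nu>\<in>padic_measures p. \<mu> = \<nu> \<otimes>\<^bsub>measure_ring p\<^esub> zeta_measure p c')"
    by (rule in_zeta_ideal [OF c]) (rule that)
  let ?z = "zeta_measure p c'"
  have U: "c \<in> U" "c' \<in> U" using c c' top_generator_Units by auto
  note z = zeta_measure [OF U(2)]
  obtain u where u: "u \<in> padic_measures p"
    "\<And>k. (\<^bold>1 \<^bold>- c' \<^bold>^ (2 * k)) \<^bold>* even_moment p u k = \<^bold>1 \<^bold>- c \<^bold>^ (2 * k)"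
    using generator_change [OF U(1) c'] by blast
  note u\<nu> = convolution [OF u(1) \<nu>]
  have "\<mu> = (u \<otimes>\<^bsub>measure_ring p\<^esub> \<nu>) \<otimes>\<^bsub>measure_ring p\<^esub> ?z"
  proof (rule measure_unique [OF \<mu> convolution(1) [OF u\<nu>(1) z(1)]])
    fix k :: nat assume k: "k \<ge> 2"
    obtain x y where xy: "quotient_of (- bernoulli (2 * k) / of_nat (4 * k)) = (x, y)" by fastforce
    then have y: "y > 0" "- bernoulli (2 * k) / of_nat (4 * k) = of_int x / of_int y"
      using quotient_of_denom_pos quotient_of_div by blast+
    have "rat_of_int (b (2 * k)) = of_int x / of_int y * of_int (q (2 * k))"
      using bq [OF k] unfolding y(2) .
    then have "rat_of_int (y * b (2 * k)) = of_int (x * q (2 * k))"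
      using y(1) by simp
    then have yb: "y * b (2 * k) = x * q (2 * k)"
      by (simp only: of_int_eq_iff)
    let ?d = "\<^bold>1 \<^bold>- c \<^bold>^ (2 * k)" and ?d' = "\<^bold>1 \<^bold>- c' \<^bold>^ (2 * k)" and ?v = "\<iota> (1 - P (2 * k - 1))"
    have Z: "?d \<in> Z" "?d' \<in> Z" "even_moment p u k \<in> Z" "even_moment p ?z k \<in> Z"
      using U u(1) z(1) by auto
    have "\<iota> y \<^bold>* even_moment p \<mu> k = \<iota> (y * b (2 * k)) \<^bold>* (?d \<^bold>* ?v)"
      unfolding mom [OF k] emb_mult using Z by (simp add: Zp.m_ac)
    also have "\<dots> = (even_moment p u k \<^bold>* \<iota> (q (2 * k))) \<^bold>* (\<iota> x \<^bold>* (?d' \<^bold>* ?v))"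
      unfolding yb emb_mult u(2) [symmetric] using Z by (simp add: Zp.m_ac)
    also have "\<dots> = (even_moment p u k \<^bold>* \<iota> (q (2 * k))) \<^bold>* (\<iota> y \<^bold>* even_moment p ?z k)"
      using zeta_momentD [OF z(2) xy] k by simp
    also have "\<dots> = \<iota> y \<^bold>* even_moment p ((u \<otimes>\<^bsub>measure_ring p\<^esub> \<nu>) \<otimes>\<^bsub>measure_ring p\<^esub> ?z) k"
      unfolding convolution(2) [OF u\<nu>(1) z(1)] u\<nu>(2) q [OF k] using Z by (simp add: Zp.m_ac)
    finally show "even_moment p \<mu> k = even_moment p ((u \<otimes>\<^bsub>measure_ring p\<^esub> \<nu>) \<otimes>\<^bsub>measure_ring p\<^esub> ?z) k"
      by (rule padic_cancel [rotated -1])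
        (use y(1) \<mu> convolution(1) [OF u\<nu>(1) z(1)] in \<open>simp_all add: emb_eq_0_iff\<close>)
  qed
  then show ?thesis unfolding ideal using u\<nu>(1) by (rule bexI)
qed

text \<open>The witness is \<open>n * u\<close>, with \<open>n\<close> the cofactor of the zeta
  measure and \<open>u\<close> the change of generator. Its moments are \<open>y b / x\<close>,
  stated without division because this fraction is not yet known to be an integer.\<close>

lemma in_zeta_ideal_imp_moments:
  assumes c: "top_generator p c" and \<mu>: "\<mu> \<in> padic_measures p" and \<beta>: "\<beta> \<in> padic_measures p"
    and mom: "\<And>k. k \<ge> 2 \<Longrightarrow> even_moment p \<mu> k
      = (\<^bold>1 \<^bold>- c \<^bold>^ (2 * k)) \<^bold>* \<iota> ((1 - P (2 * k - 1)) * b (2 * k))"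
    and b: "\<And>k. k \<ge> 2 \<Longrightarrow> even_moment p \<beta> k = \<iota> ((1 - P (2 * k - 1)) * b (2 * k))"
    and mem: "\<mu> \<in> zeta_ideal p"
  shows "\<exists>\<nu>\<in>padic_measures p. even_moment p \<nu> 0 = \<^bold>0 \<and>
    (\<forall>k\<ge>2. \<forall>x y. quotient_of (- bernoulli (2 * k) / of_nat (4 * k)) = (x, y) \<longrightarrow>
      \<iota> (y * b (2 * k)) = \<iota> x \<^bold>* even_moment p \<nu> k)"
proof -
  obtain c' where c': "top_generator p c'" and ideal: "\<And>\<mu>. \<mu> \<in> zeta_ideal p \<longleftrightarrow>
      (\<exists>\<nu>\<in>padic_measures p. \<mu> = \<nu> \<otimes>\<^bsub>measure_ring p\<^esub> zeta_measure p c')"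
    by (rule in_zeta_ideal [OF c]) (rule that)
  let ?z = "zeta_measure p c'"
  have U: "c \<in> U" "c' \<in> U" using c c' top_generator_Units by auto
  note z = zeta_measure [OF U(2)]
  obtain n where n: "n \<in> padic_measures p" "\<mu> = n \<otimes>\<^bsub>measure_ring p\<^esub> ?z"
    using ideal mem by blast
  obtain u where u: "u \<in> padic_measures p"
    "\<And>k. (\<^bold>1 \<^bold>- c \<^bold>^ (2 * k)) \<^bold>* even_moment p u k = \<^bold>1 \<^bold>- c' \<^bold>^ (2 * k)"
    using generator_change [OF U(2) c] by blast
  note nu = convolution [OF n(1) u(1)]
  \<comment> \<open>The given moments of \<open>\<mu>\<close> start at \<open>k = 2\<close>;
    uniqueness identifies \<open>\<mu>\<close> with \<open>([1] - [c]) * \<beta>\<close> and so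
    supplies its mass.\<close>
  have n0: "even_moment p n 0 = \<^bold>0"
  proof -
    obtain d where d: "d \<in> padic_measures p" "\<And>k. even_moment p d k = \<^bold>1 \<^bold>- c \<^bold>^ (2 * k)"
      using dirac_difference [OF U(1)] by blast
    have "\<mu> = d \<otimes>\<^bsub>measure_ring p\<^esub> \<beta>"
      by (rule measure_unique [OF \<mu> convolution(1) [OF d(1) \<beta>]])
        (simp add: convolution(2) [OF d(1) \<beta>] d(2) b mom)
    then have "even_moment p \<mu> 0 = \<^bold>0"
      using \<beta> by (simp add: convolution(2) [OF d(1) \<beta>] d(2) Zp.minus_eq Zp.r_neg)
    then have "even_moment p n 0 \<^bold>* even_moment p ?z 0 = \<^bold>0"
      by (simp add: n(2) convolution(2) [OF n(1) z(1)])
    then show ?thesis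
      using padic_domain [OF moment_closed [OF n(1)] moment_closed [OF z(1)]] zeta_measure_mass [OF c']
      by metis
  qed
  have "\<iota> (y * b (2 * k)) = \<iota> x \<^bold>* even_moment p (n \<otimes>\<^bsub>measure_ring p\<^esub> u) k"
    if k: "k \<ge> 2" and xy: "quotient_of (- bernoulli (2 * k) / of_nat (4 * k)) = (x, y)" for k x y
  proof -
    let ?d = "\<^bold>1 \<^bold>- c \<^bold>^ (2 * k)" and ?d' = "\<^bold>1 \<^bold>- c' \<^bold>^ (2 * k)" and ?v = "\<iota> (1 - P (2 * k - 1))"
    have Z: "?d \<in> Z" "?d' \<in> Z" "even_moment p u k \<in> Z" "even_moment p n k \<in> Z" "even_moment p ?z k \<in> Z"
      using U u(1) n(1) z(1) by auto
    have "?d \<noteq> \<^bold>0"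
      using top_generator_not_torsion [OF c, of k] k U by simp
    moreover have "P (2 * k - 1) > 1"
      using prime_gt_1_nat [OF prime_p] k by (intro one_less_power) auto
    then have "?v \<noteq> \<^bold>0" by (simp add: emb_eq_0_iff)
    \<comment> \<open>Both factors are nonzero, the first because \<open>c\<close> is not torsion,
      so they can be cancelled from the comparison of moments.\<close>
    ultimately have dv: "?d \<^bold>* ?v \<noteq> \<^bold>0"
      using padic_domain [OF Z(1) emb_closed] by metis
    have "(?d \<^bold>* ?v) \<^bold>* \<iota> (y * b (2 * k)) = \<iota> y \<^bold>* even_moment p \<mu> k"
      unfolding mom [OF k] emb_mult using Z by (simp add: Zp.m_ac)
    also have "\<dots> = even_moment p n k \<^bold>* (\<iota> y \<^bold>* even_moment p ?z k)"
      unfolding n(2) convolution(2) [OF n(1) z(1)] using Z by (simp add: Zp.m_ac)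
    also have "\<dots> = even_moment p n k \<^bold>* (\<iota> x \<^bold>* (?d' \<^bold>* ?v))"
      using zeta_momentD [OF z(2) xy] k by simp
    also have "\<dots> = (?d \<^bold>* ?v) \<^bold>* (\<iota> x \<^bold>* even_moment p (n \<otimes>\<^bsub>measure_ring p\<^esub> u) k)"
      unfolding nu(2) u(2) [symmetric] using Z by (simp add: Zp.m_ac)
    finally show ?thesis
      by (rule padic_cancel [rotated -1]) (use dv Z nu(1) in simp_all)
  qed
  moreover have "even_moment p (n \<otimes>\<^bsub>measure_ring p\<^esub> u) 0 = \<^bold>0"
    using u(1) by (simp add: nu(2) n0)
  ultimately show ?thesis using nu(1) by blast
qed

section \<open>From p-adic to integer divisibility\<close>

lemma dvd_of_padic_dvd:
  assumes "\<iota> a = \<iota> x \<^bold>* z" "P n dvd x"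
  shows "P n dvd a"
proof -
  have "a mod P n = (x mod P n * z n) mod P n"
    using assms(1) by (metis nth_mult nth_emb)
  then show ?thesis using assms(2) by (simp add: dvd_eq_mod_eq_0)
qed

end

text \<open>Divisibility of integers is local; this turns fractions that are integral at every prime
  into integers.\<close>

lemma int_dvdI_prime_powers:
  fixes x a :: int
  assumes "x \<noteq> 0" "\<And>p n. prime p \<Longrightarrow> int p ^ n dvd x \<Longrightarrow> int p ^ n dvd a"
  shows "x dvd a"
proof (cases "a = 0")
  case False
  show ?thesis
  proof (rule multiplicity_le_imp_dvd [OF assms(1)])
    fix p :: int assume p: "prime p"
    then have "p = int (nat p)" "prime (nat p)"
      using prime_ge_0_int by (auto simp: prime_nat_iff_prime)
    then have "p ^ multiplicity p x dvd a"
      using assms(2) [of "nat p" "multiplicity p x"] multiplicity_dvd [of p x] by simp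
    then show "multiplicity p x \<le> multiplicity p a"
      using False p not_prime_unit by (intro multiplicity_geI) auto
  qed
qed simp

theorem theorem3p3p2:
  fixes b :: "nat \<Rightarrow> int"
    and c :: "nat \<Rightarrow> padic"
    and \<mu> :: "nat \<Rightarrow> (padic set \<Rightarrow> padic) \<Rightarrow> padic"
  assumes "b \<in> mom_euler"
    and "\<And>p. prime p \<Longrightarrow> top_generator p (c p)"
    and "\<And>p. prime p \<Longrightarrow> \<mu> p \<in> padic_measures p"
    and "\<And>p k. prime p \<Longrightarrow> k \<ge> 2 \<Longrightarrow>
      even_moment p (\<mu> p) k =
        (\<one>\<^bsub>padic_ring p\<^esub> \<ominus>\<^bsub>padic_ring p\<^esub> c p [^]\<^bsub>padic_ring p\<^esub> (2 * k))
          \<otimes>\<^bsub>padic_ring p\<^esub> padic_of_int p ((1 - int p ^ (2 * k - 1)) * b (2 * k))"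
  shows "(\<lambda>k\<in>{4..}. rat_of_int (b k)) \<in> ev ` mom_zero \<longleftrightarrow>
    (\<forall>p. prime p \<longrightarrow> \<mu> p \<in> zeta_ideal p)"
proof
  assume "(\<lambda>k\<in>{4..}. rat_of_int (b k)) \<in> ev ` mom_zero"
  then obtain q where q: "q \<in> mom_zero" "(\<lambda>k\<in>{4..}. rat_of_int (b k)) = ev q" by blast
  have bq: "rat_of_int (b (2 * k)) = - bernoulli (2 * k) / of_nat (4 * k) * of_int (q (2 * k))"
    if "k \<ge> 2" for k
    using fun_cong [OF q(2), of "2 * k"] that by (simp add: ev_def)
  show "\<forall>p. prime p \<longrightarrow> \<mu> p \<in> zeta_ideal p"
  proof (intro allI impI)
    fix p :: nat assume p: "prime p"
    then interpret p_adic p by unfold_locales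
    obtain \<nu> where "\<nu> \<in> padic_measures p" "\<And>k. k \<ge> 2 \<Longrightarrow> even_moment p \<nu> k = padic_of_int p (q (2 * k))"
      using q(1) p unfolding mom_zero_def by blast
    then show "\<mu> p \<in> zeta_ideal p"
      using moments_imp_in_zeta_ideal [OF assms(2,3) [OF p], of \<nu> b q] assms(4) [OF p] bq by blast
  qed
next
  assume ideal: "\<forall>p. prime p \<longrightarrow> \<mu> p \<in> zeta_ideal p"
  \<comment> \<open>The index is \<open>n = 2k\<close>, so that \<open>2 * n\<close> is the
    \<open>4k\<close> of the zeta moments.\<close>
  define num where "num n = fst (quotient_of (- bernoulli n / of_nat (2 * n)))" for n
  define den where "den n = snd (quotient_of (- bernoulli n / of_nat (2 * n)))" for n
  have quot: "quotient_of (- bernoulli (2 * k) / of_nat (4 * k)) = (num (2 * k), den (2 * k))" for k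
    by (simp add: num_def den_def)
  have den: "den n > 0" and frac: "- bernoulli n / of_nat (2 * n) = of_int (num n) / of_int (den n)" for n
    using quotient_of_denom_pos [of "- bernoulli n / of_nat (2 * n)" "num n" "den n"]
      quotient_of_div [of "- bernoulli n / of_nat (2 * n)" "num n" "den n"]
    by (simp_all add: num_def den_def)
  \<comment> \<open>Nonvanishing lets \<open>q\<close> be recovered from \<open>b\<close> by
    division.\<close>
  have num: "num (2 * k) \<noteq> 0" if "k \<ge> 2" for k
    using frac [of "2 * k"] bernoulli_even_nonzero [of k] that by auto
  have key: "\<exists>\<nu>\<in>padic_measures p. even_moment p \<nu> 0 = \<zero>\<^bsub>padic_ring p\<^esub> \<and>
      (\<forall>k\<ge>2. padic_of_int p (den (2 * k) * b (2 * k))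
        = padic_of_int p (num (2 * k)) \<otimes>\<^bsub>padic_ring p\<^esub> even_moment p \<nu> k)"
    if p: "prime p" for p
  proof -
    interpret p_adic p using p by unfold_locales
    obtain \<beta> where \<beta>: "\<beta> \<in> padic_measures p" "\<And>k. k \<ge> 2 \<Longrightarrow>
        even_moment p \<beta> k = padic_of_int p ((1 - int p ^ (2 * k - 1)) * b (2 * k))"
      using assms(1) p unfolding mom_euler_def by blast
    show ?thesis
      using in_zeta_ideal_imp_moments [OF assms(2,3) [OF p] \<beta>(1) assms(4) [OF p] \<beta>(2)] ideal p quot
      by meson
  qed
  \<comment> \<open>At each prime the moment of \<open>\<nu>\<close> is a p-adic integer equal to
    \<open>den * b / num\<close>, so the power of \<open>p\<close> in the numerator divides.\<close>
  have dvd: "num (2 * k) dvd den (2 * k) * b (2 * k)" if k: "k \<ge> 2" for k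
  proof (rule int_dvdI_prime_powers [OF num [OF k]])
    fix p n :: nat assume p: "prime p" and n: "int p ^ n dvd num (2 * k)"
    interpret p_adic p using p by unfold_locales
    show "int p ^ n dvd den (2 * k) * b (2 * k)"
      using key [OF p] k n dvd_of_padic_dvd by blast
  qed
  \<comment> \<open>The division is exact at even indices by \<open>dvd\<close>; the value 0 at odd
    indices is imposed by \<open>mom_zero\<close>.\<close>
  define q where "q = (\<lambda>n\<in>{4..}. if even n then den n * b n div num n else 0)"
  have q: "num (2 * k) * q (2 * k) = den (2 * k) * b (2 * k)" if "k \<ge> 2" for k
    using dvd [OF that] that by (simp add: q_def)
  have "q \<in> mom_zero"
    unfolding mom_zero_def
  proof (intro CollectI conjI allI impI)
    fix p :: nat assume p: "prime p"
    interpret p_adic p using p by unfold_locales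
    obtain \<nu> where \<nu>: "\<nu> \<in> padic_measures p" "even_moment p \<nu> 0 = \<zero>\<^bsub>padic_ring p\<^esub>"
      "\<And>k. k \<ge> 2 \<Longrightarrow> padic_of_int p (den (2 * k) * b (2 * k))
        = padic_of_int p (num (2 * k)) \<otimes>\<^bsub>padic_ring p\<^esub> even_moment p \<nu> k"
      using key [OF p] by blast
    have "even_moment p \<nu> k = padic_of_int p (q (2 * k))" if k: "k \<ge> 2" for k
    proof (rule padic_cancel)
      show "padic_of_int p (num (2 * k)) \<otimes>\<^bsub>padic_ring p\<^esub> even_moment p \<nu> k
          = padic_of_int p (num (2 * k)) \<otimes>\<^bsub>padic_ring p\<^esub> padic_of_int p (q (2 * k))"
        unfolding emb_mult [symmetric] q [OF k] by (rule \<nu>(3) [OF k, symmetric])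
    qed (use \<nu>(1) num [OF k] in \<open>simp_all add: emb_eq_0_iff\<close>)
    \<comment> \<open>The constant function 1 is the even power of exponent 0.\<close>
    moreover have "\<nu> (descend p (\<lambda>_. \<one>\<^bsub>padic_ring p\<^esub>)) = \<zero>\<^bsub>padic_ring p\<^esub>"
      using \<nu>(2) by (simp add: even_moment_def)
    ultimately show "\<exists>\<mu>\<in>padic_measures p.
          (\<forall>k\<ge>2. even_moment p \<mu> k = padic_of_int p (q (2 * k))) \<and>
          \<mu> (descend p (\<lambda>_. \<one>\<^bsub>padic_ring p\<^esub>)) = \<zero>\<^bsub>padic_ring p\<^esub>"
      using \<nu>(1) by blast
  qed (simp_all add: q_def)
  moreover have "(\<lambda>k\<in>{4..}. rat_of_int (b k)) = ev q"
  proof (rule extensionalityI [where A = "{4..}"])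
    fix n :: nat assume n: "n \<in> {4..}"
    show "(\<lambda>k\<in>{4..}. rat_of_int (b k)) n = ev q n"
    proof (cases "even n")
      case True
      then obtain k where k: "n = 2 * k" "k \<ge> 2" using n by auto
      have "rat_of_int (den n) * of_int (b n) = of_int (num n) * of_int (q n)"
        using q [OF k(2)] k(1) by (metis of_int_mult)
      then have "rat_of_int (b n) = of_int (num n) / of_int (den n) * of_int (q n)"
        using den [of n] by (simp add: field_simps)
      then show ?thesis
        unfolding frac [symmetric] using n by (simp add: ev_def)
    next
      case False
      then obtain k where k: "n = 2 * k + 1" "k \<ge> 2" using n by (auto elim: oddE)
      then have "b n = 0" using assms(1) by (auto simp: mom_euler_def)
      moreover have "q n = 0" using False n by (simp add: q_def)
      ultimately show ?thesis using n by (simp add: ev_def)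
    qed
  qed (simp_all add: ev_def)
  ultimately show "(\<lambda>k\<in>{4..}. rat_of_int (b k)) \<in> ev ` mom_zero" by blast
qed

end
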